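(* Let $s\in(0,1)$, $\ell>0$, $p>1$, and let $h\in C(\mathbb{R}^N)$ satisfy $h>0$ in $\mathbb{R}^N$ and $\liminf_{|x|\to\infty}\frac{h(x)}{|x|^\ell}>0$. Consider the equation $$(-\Delta)^s u=h(x)u^p,\qquad u>0\quad\text{in }\mathbb{R}^N, \qquad (E)$$ and the condition $$N<2s+\frac{2(2s+\ell)}{p-1}\left(p+\sqrt{p^2-p}\right).\qquad (C)$$ (1) If $p>\frac43$, then $(E)$ has no stable solution if $(C)$ holds. In particular, if $N\le 10s+4\ell$, then $(E)$ has no stable solution for all $p>\frac43$. (2) If $1<p\le\frac43$, then $(E)$ has no bounded stable solution if $(C)$ holds. Therefore, there is no bounded stable solution of $(E)$ for all $p>1$ if $N\le 10s+4\ell$.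
   Context: $\mathcal{L}_s(\mathbb{R}^N)$ denotes the set of functions $u:\mathbb{R}^N\to\mathbb{R}$ with $\int_{\mathbb{R}^N}\frac{|u(y)|}{(1+|y|)^{N+2s}}\,dy<\infty$. For $u\in C^{2\alpha}_{loc}(\mathbb{R}^N)\cap\mathcal{L}_s(\mathbb{R}^N)$ with some $\alpha>s$, the fractional Laplacian is defined pointwise by $(-\Delta)^su(x)=c_{N,s}\,\mathrm{P.V.}\int_{\mathbb{R}^N}\frac{u(x)-u(y)}{|x-y|^{N+2s}}\,dy$, where $c_{N,s}>0$ is the usual normalization constant. A solution of the equation is a positive function $u\in C^{2\alpha}_{loc}(\mathbb{R}^N)\cap\mathcal{L}_s(\mathbb{R}^N)$ (for some $\alpha>s$) satisfying it pointwise in $\mathbb{R}^N$. A solution $u$ is called stable if the pair $(u,u)$ is a stable solution of the system $(-\Delta)^su=h v^p$, $(-\Delta)^sv=h u^p$, that is, if there are two positive functions $\zeta_1,\zeta_2\in C^{2\alpha}_{loc}(\mathbb{R}^N)\cap\mathcal{L}_s(\mathbb{R}^N)$ (for some $\alpha>s$) satisfying, in $\mathbb{R}^N$, $(-\Delta)^s\zeta_1=p\,h\,u^{p-1}\zeta_2$ and $(-\Delta)^s\zeta_2=p\,h\,u^{p-1}\zeta_1$. *)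

theory Defs
  imports "HOL-Analysis.Analysis"
begin

text \<open>
  Locally Hoelder space \<open>C\<^sup>k\<^sup>,\<^sup>\<beta>\<^sub>l\<^sub>o\<^sub>c\<close>: the function is \<open>k\<close> times continuously differentiable and its
  partial derivatives of order \<open>k\<close> are \<open>\<beta>\<close>-Hoelder continuous on every compact set. For \<open>\<beta> = 0\<close>
  the Hoelder bound says no more than boundedness on compact sets, so this is \<open>C\<^sup>k\<close>.
\<close>

primrec holder_loc :: "nat \<Rightarrow> real \<Rightarrow> (real ^ 'n \<Rightarrow> real) \<Rightarrow> bool" where
  "holder_loc 0 \<beta> u \<longleftrightarrow>
     continuous_on UNIV u \<and>
     (\<forall>K. compact K \<longrightarrow> (\<exists>C. \<forall>x\<in>K. \<forall>y\<in>K. \<bar>u x - u y\<bar> \<le> C * dist x y powr \<beta>))"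
| "holder_loc (Suc k) \<beta> u \<longleftrightarrow>
     (\<forall>x. u differentiable (at x)) \<and>
     (\<forall>e\<in>Basis. holder_loc k \<beta> (\<lambda>x. frechet_derivative u (at x) e))"

text \<open>
  \<open>C\<^sup>\<gamma>\<^sub>l\<^sub>o\<^sub>c\<close> for real \<open>\<gamma> \<ge> 0\<close>. For integer \<open>\<gamma>\<close> this is \<open>C\<^sup>\<gamma>\<close>; the other convention,
  \<open>C\<^sup>\<gamma>\<^sup>-\<^sup>1\<^sup>,\<^sup>1\<close>, gives the same class \<open>frac_domain\<close> below, since \<open>\<alpha> > s\<close> may be decreased there.
\<close>

definition C_loc :: "real \<Rightarrow> (real ^ 'n \<Rightarrow> real) set" where
  "C_loc \<gamma> = {u. holder_loc (nat \<lfloor>\<gamma>\<rfloor>) (\<gamma> - of_int \<lfloor>\<gamma>\<rfloor>) u}"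

definition L_space :: "real \<Rightarrow> (real ^ 'n \<Rightarrow> real) set" where
  "L_space s = {u. u \<in> borel_measurable lebesgue \<and>
     integrable lebesgue (\<lambda>y. \<bar>u y\<bar> / (1 + norm y) powr (real CARD('n) + 2 * s))}"

definition frac_domain :: "real \<Rightarrow> (real ^ 'n \<Rightarrow> real) set" where
  "frac_domain s = {u. \<exists>\<alpha>>s. u \<in> C_loc (2 * \<alpha>)} \<inter> L_space s"

text \<open>
  The constant for which \<open>(-\<Delta>)\<^sup>s\<close> has Fourier symbol \<open>\<bar>\<xi>\<bar>\<^sup>2\<^sup>s\<close>.
\<close>

definition frac_const :: "nat \<Rightarrow> real \<Rightarrow> real" where
  "frac_const N s =
     s * 2 powr (2 * s) * Gamma ((real N + 2 * s) / 2) / (pi powr (real N / 2) * Gamma (1 - s))"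

text \<open>
  \<open>has_frac_laplacian s u x L\<close> means that the principal value defining \<open>(-\<Delta>)\<^sup>s u(x)\<close> exists and
  that \<open>(-\<Delta>)\<^sup>s u(x) = L\<close>. It exists at every point for \<open>u \<in> frac_domain s\<close> when \<open>0 < s < 1\<close>.
\<close>

definition frac_quot :: "real \<Rightarrow> (real ^ 'n \<Rightarrow> real) \<Rightarrow> real ^ 'n \<Rightarrow> real ^ 'n \<Rightarrow> real" where
  "frac_quot s u x y = (u x - u y) / norm (x - y) powr (real CARD('n) + 2 * s)"

definition has_frac_laplacian ::
    "real \<Rightarrow> (real ^ 'n \<Rightarrow> real) \<Rightarrow> real ^ 'n \<Rightarrow> real \<Rightarrow> bool" where
  "has_frac_laplacian s u x L \<longleftrightarrow>
     (\<forall>\<epsilon>>0. set_integrable lebesgue {y. norm (x - y) > \<epsilon>} (frac_quot s u x)) \<and>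
     ((\<lambda>\<epsilon>. frac_const CARD('n) s * (LINT y:{y. norm (x - y) > \<epsilon>}|lebesgue. frac_quot s u x y))
        \<longlongrightarrow> L) (at_right 0)"

definition is_solution ::
    "real \<Rightarrow> real \<Rightarrow> (real ^ 'n \<Rightarrow> real) \<Rightarrow> (real ^ 'n \<Rightarrow> real) \<Rightarrow> bool" where
  "is_solution s p h u \<longleftrightarrow>
     u \<in> frac_domain s \<and> (\<forall>x. u x > 0) \<and>
     (\<forall>x. has_frac_laplacian s u x (h x * u x powr p))"

definition is_stable_solution ::
    "real \<Rightarrow> real \<Rightarrow> (real ^ 'n \<Rightarrow> real) \<Rightarrow> (real ^ 'n \<Rightarrow> real) \<Rightarrow> bool" where
  "is_stable_solution s p h u \<longleftrightarrow>
     is_solution s p h u \<and>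
     (\<exists>\<zeta>1 \<zeta>2. \<zeta>1 \<in> frac_domain s \<and> \<zeta>2 \<in> frac_domain s \<and>
        (\<forall>x. \<zeta>1 x > 0) \<and> (\<forall>x. \<zeta>2 x > 0) \<and>
        (\<forall>x. has_frac_laplacian s \<zeta>1 x (p * h x * u x powr (p - 1) * \<zeta>2 x)) \<and>
        (\<forall>x. has_frac_laplacian s \<zeta>2 x (p * h x * u x powr (p - 1) * \<zeta>1 x)))"

definition subcritical :: "nat \<Rightarrow> real \<Rightarrow> real \<Rightarrow> real \<Rightarrow> bool" where
  "subcritical N s l p \<longleftrightarrow>
     real N < 2 * s + 2 * (2 * s + l) / (p - 1) * (p + sqrt (p\<^sup>2 - p))"

end

theory Submission
  imports Defs
begin

text \<open>
  Write \<open>d = N + 2 s\<close> and let \<open>\<zeta> = \<zeta>1 + \<zeta>2\<close>, a positive solution of the linearised equation. Testing the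
  equation for \<open>\<zeta>\<close> with \<open>u\<^sup>2\<^sup>q \<eta>\<^sup>2 / \<zeta>\<close> and the one for \<open>u\<close> with \<open>u\<^sup>2\<^sup>q\<^sup>-\<^sup>1 \<eta>\<^sup>2\<close> gives, if \<open>q\<^sup>2 < p (2 q - 1)\<close>,
  \<open>\<integral> h u\<^sup>p\<^sup>+\<^sup>2\<^sup>q\<^sup>-\<^sup>1 \<eta>\<^sup>2 \<le> D \<integral>\<integral> u(x)\<^sup>2\<^sup>q (\<eta>(x) - \<eta>(y))\<^sup>2 |x - y|\<^sup>-\<^sup>d\<close>; for \<open>0 < 2 q < 1\<close> the equation for \<open>u\<close>
  alone suffices, because the power is then concave. All inequalities needed are pointwise in
  \<open>(x, y)\<close>, so they can be integrated against the kernel truncated at \<open>|x - y| > \<epsilon>\<close>; local regularity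
  is only used to let \<open>\<epsilon> \<rightarrow> 0\<close> under the integral over the compact support of \<open>\<eta>\<close>.

  With \<open>\<eta>(x) = (1 + |x| / R)\<^sup>-\<^sup>d\<^sup>/\<^sup>2\<close> the right-hand side is at most \<open>D R\<^sup>-\<^sup>2\<^sup>s \<integral> u\<^sup>2\<^sup>q \<eta>\<^sup>2\<close>: the weight reproduces
  itself. Hence finiteness of \<open>\<integral> u\<^sup>a (1 + |x|)\<^sup>-\<^sup>d\<close> propagates from \<open>a = 2 q\<close> to \<open>a = 2 q + p - 1\<close>, starting from
  \<open>a < 1\<close>, and for \<open>p > 4/3\<close> this reaches every \<open>a < 2 (p + \<surd>(p\<^sup>2 - p))\<close>. Absorbing \<open>u\<^sup>2\<^sup>q\<close> into
  \<open>h u\<^sup>p\<^sup>+\<^sup>2\<^sup>q\<^sup>-\<^sup>1\<close> bounds the left-hand side by a power of \<open>R\<close> whose exponent is negative for suitable \<open>q\<close> by the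
  dimension condition; let \<open>R \<rightarrow> \<infinity>\<close>.
\<close>

section \<open>Pointwise inequalities\<close>

text \<open>Picone's inequality: the gap between the two sides is the perfect square (b X - a Y)^2 /
  (a b). With values of \<open>\<zeta>\<close> for \<open>a\<close> and \<open>b\<close> it bounds
  the linearised equation, tested with X^2 / \<zeta>, by the energy of \<open>X\<close>
  alone.\<close>

lemma picone_pointwise:
  fixes a b X Y :: real
  assumes "a > 0" "b > 0"
  shows "(a - b) * (X\<^sup>2 / a - Y\<^sup>2 / b) \<le> (X - Y)\<^sup>2"
proof -
  have "(X - Y)\<^sup>2 - (a - b) * (X\<^sup>2 / a - Y\<^sup>2 / b) = (b * X - a * Y)\<^sup>2 / (a * b)"
    using assms by (simp add: field_simps power2_eq_square)
  also have "\<dots> \<ge> 0" using assms by simp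
  finally show ?thesis by simp
qed

text \<open>AM-GM with the geometric mean entering through its square, so that cross terms can be
  split without square roots.\<close>

lemma two_mult_le_add_if_square_le:
  fixes x y z :: real
  assumes "z\<^sup>2 \<le> x * y" "x \<ge> 0" "y \<ge> 0"
  shows "2 * z \<le> x + y"
proof -
  have "0 \<le> (x - y)\<^sup>2" by simp
  then have "(2 * z)\<^sup>2 \<le> (x + y)\<^sup>2"
    using assms(1) by (simp add: power2_eq_square algebra_simps)
  then show ?thesis by (rule power2_le_imp_le) (use assms in auto)
qed

lemma square_add_le_weighted:
  fixes x y e :: real
  assumes "e > 0"
  shows "(x + y)\<^sup>2 \<le> (1 + e) * x\<^sup>2 + (1 + 1 / e) * y\<^sup>2"
proof -
  have "2 * (x * y) \<le> e * x\<^sup>2 + y\<^sup>2 / e"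
    using assms by (intro two_mult_le_add_if_square_le) (auto simp: power2_eq_square)
  then show ?thesis by (simp add: power2_eq_square algebra_simps)
qed

text \<open>Cauchy-Schwarz for a^q - b^q, the integral of q x^(q-1) over [b, a]: the square of that
  integrand has integral q^2 / (2q-1) times a^(2q-1) - b^(2q-1). No integral is formed in the proof;
  instead \<open>F\<close>, an antiderivative of (q x^(q-1) - m)^2 with \<open>m\<close> the mean of
  q x^(q-1), is nondecreasing.\<close>

lemma powr_diff_square_le:
  fixes a b q :: real
  assumes "a > 0" "b > 0" "q > 1 / 2"
  shows "(2 * q - 1) * (a powr q - b powr q)\<^sup>2
    \<le> q\<^sup>2 * ((a - b) * (a powr (2 * q - 1) - b powr (2 * q - 1)))"
  using assms(1,2)
proof (induction b a rule: linorder_wlog)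
  case (le b a)
  show ?case
  proof (cases "a = b")
    case False
    with le have ab: "b < a" by simp
    define S where "S = a powr q - b powr q"
    define m where "m = S / (a - b)"
    have t: "2 * q - 1 > 0" using assms by simp
    define F where
      "F x = q\<^sup>2 / (2 * q - 1) * x powr (2 * q - 1) - 2 * m * x powr q + m\<^sup>2 * x" for x
    have "F b \<le> F a"
    proof (rule DERIV_nonneg_imp_nondecreasing[of b a F])
      fix x assume "b \<le> x" "x \<le> a"
      then have x: "x > 0" using le by simp
      have sq: "x powr (2 * q - 2) = (x powr (q - 1))\<^sup>2"
        using x by (simp add: powr_add[symmetric] power2_eq_square)
      have "(F has_real_derivative (q\<^sup>2 / (2 * q - 1) * ((2 * q - 1) * x powr (2 * q - 1 - 1))
          - 2 * m * (q * x powr (q - 1)) + m\<^sup>2)) (at x)"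
        unfolding F_def using x by (auto intro!: derivative_eq_intros)
      also have "q\<^sup>2 / (2 * q - 1) * ((2 * q - 1) * x powr (2 * q - 1 - 1))
          - 2 * m * (q * x powr (q - 1)) + m\<^sup>2 = (q * x powr (q - 1) - m)\<^sup>2"
        using t sq by (simp add: power2_diff power_mult_distrib)
      finally show "\<exists>y. (F has_real_derivative y) (at x) \<and> 0 \<le> y" by force
    qed (use le in auto)
    then have *: "q\<^sup>2 / (2 * q - 1) * (a powr (2 * q - 1) - b powr (2 * q - 1))
        \<ge> 2 * m * S - m\<^sup>2 * (a - b)"
      by (simp add: F_def S_def algebra_simps)
    \<comment> \<open>Among all \<open>m\<close>, the mean slope maximises this lower bound.\<close>
    have "2 * m * S - m\<^sup>2 * (a - b) = S\<^sup>2 / (a - b)"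
    proof -
      have "S = m * (a - b)" using ab by (simp add: m_def)
      then have "2 * m * S - m\<^sup>2 * (a - b) = m * S" by (simp add: power2_eq_square)
      then show ?thesis by (simp add: m_def power2_eq_square)
    qed
    with * have "S\<^sup>2 / (a - b) \<le> q\<^sup>2 / (2 * q - 1) * (a powr (2 * q - 1) - b powr (2 * q - 1))"
      by simp
    then show ?thesis using ab t unfolding S_def[symmetric]
      by (simp add: field_simps)
  qed auto
next
  case (sym b a)
  then show ?case by (simp add: power2_commute minus_mult_minus[of "a - b", symmetric] algebra_simps)
qed

text \<open>Divided by a^(t+1) and written with x = b / a, the claim is x^t (1 + t (1 - x)) <= 1,
  and the logarithm of the left-hand side is at most t (x - 1) + t (1 - x) = 0. It controls the
  cross term in \<open>weighted_powr_diff_le\<close>.\<close>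

lemma powr_mult_diff_le:
  fixes a b t :: real
  assumes "0 < b" "b \<le> a" "t > 0"
  shows "b powr t * (a - b) \<le> a / t * (a powr t - b powr t)"
proof -
  define x where "x = b / a"
  have x: "0 < x" "x \<le> 1" and b: "b = x * a" using assms by (auto simp: x_def)
  have "ln (x powr t * (1 + t * (1 - x))) \<le> 0"
  proof -
    have "1 + t * (1 - x) > 0" using assms x by (simp add: add_pos_nonneg)
    then have "ln (x powr t * (1 + t * (1 - x))) = t * ln x + ln (1 + t * (1 - x))"
      using x by (simp add: ln_mult ln_powr)
    also have "\<dots> \<le> t * (x - 1) + t * (1 - x)"
      using x assms by (intro add_mono mult_left_mono ln_le_minus_one ln_add_one_self_le_self) auto
    finally show ?thesis by (simp add: algebra_simps)
  qed
  moreover have "x powr t * (1 + t * (1 - x)) > 0" using assms x by (simp add: add_pos_nonneg)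
  ultimately have "x powr t * (1 + t * (1 - x)) \<le> 1" by simp
  then have "x powr t * (1 - x) \<le> (1 - x powr t) / t" using assms by (simp add: field_simps)
  then have "a powr t * a * (x powr t * (1 - x)) \<le> a powr t * a * ((1 - x powr t) / t)"
    using assms by (intro mult_left_mono) auto
  then show ?thesis using assms x unfolding b by (simp add: powr_mult algebra_simps diff_divide_distrib)
qed

text \<open>A version of \<open>powr_diff_square_le\<close> with weights, at the price of a factor 1
  + e. For b <= a both sides are expanded about \<open>A\<close>, with D = B - A: terms in D^2 go
  into the error, and terms linear in D are absorbed into an \<open>e\<close>-fraction of the main
  term E A^2 by Young's inequality.\<close>

lemma weighted_powr_diff_le:
  fixes q e :: real
  assumes q: "q > 1 / 2" and e: "e > 0"
  obtains C where "C \<ge> 0"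
    "\<And>a b A B :: real. \<lbrakk>a > 0; b > 0; A \<ge> 0; B \<ge> 0\<rbrakk> \<Longrightarrow>
       (2 * q - 1) * (a powr q * A - b powr q * B)\<^sup>2
       \<le> (1 + e) * q\<^sup>2 * ((a - b) * (a powr (2 * q - 1) * A\<^sup>2 - b powr (2 * q - 1) * B\<^sup>2))
         + C * (a powr (2 * q) + b powr (2 * q)) * (A - B)\<^sup>2"
proof -
  define t where "t = 2 * q - 1"
  have t: "t > 0" using q by (simp add: t_def)
  \<comment> \<open>\<open>C1\<close> comes from splitting the square on the left, \<open>C2\<close>
    from the term linear in D on the right, \<open>C3\<close> from the term in D^2 there. The first
    two each spend e / 2 of the slack \<open>e\<close>.\<close>
  define C1 where "C1 = t * (1 + 2 / e)"
  define C2 where "C2 = 2 * (1 + e)\<^sup>2 / e * q\<^sup>2 / t"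
  define C3 where "C3 = (1 + e) * q\<^sup>2"
  define C where "C = C1 + C2 + C3"
  have Cnn: "C1 \<ge> 0" "C2 \<ge> 0" "C3 \<ge> 0" using t e by (auto simp: C1_def C2_def C3_def)
  have main: "t * (a powr q * A - b powr q * B)\<^sup>2
       \<le> (1 + e) * q\<^sup>2 * ((a - b) * (a powr t * A\<^sup>2 - b powr t * B\<^sup>2))
         + C * (a powr (2 * q) + b powr (2 * q)) * (A - B)\<^sup>2"
    if ab: "0 < b" "b \<le> a" and AB: "A \<ge> 0" "B \<ge> 0" for a b A B :: real
  proof -
    define E where "E = (a - b) * (a powr t - b powr t)"
    define D where "D = B - A"
    have pm: "b powr t \<le> a powr t" "b powr (2 * q) \<le> a powr (2 * q)"
      using ab t q by (auto intro!: powr_mono2)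
    have Enn: "E \<ge> 0" using ab pm by (simp add: E_def)
    have sqb: "(b powr q)\<^sup>2 = b powr (2 * q)"
      using ab by (simp add: powr_add[symmetric] power2_eq_square)
    have "(a powr q * A - b powr q * B)\<^sup>2 = ((a powr q - b powr q) * A + (- (b powr q) * D))\<^sup>2"
      by (simp add: D_def algebra_simps)
    also have "\<dots> \<le> (1 + e / 2) * ((a powr q - b powr q) * A)\<^sup>2
        + (1 + 1 / (e / 2)) * (- (b powr q) * D)\<^sup>2"
      using e by (intro square_add_le_weighted) auto
    finally have "t * (a powr q * A - b powr q * B)\<^sup>2
        \<le> t * ((1 + e / 2) * ((a powr q - b powr q) * A)\<^sup>2 + (1 + 1 / (e / 2)) * (- (b powr q) * D)\<^sup>2)"
      using t by (intro mult_left_mono) auto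
    also have "\<dots> = (1 + e / 2) * (t * (a powr q - b powr q)\<^sup>2) * A\<^sup>2 + C1 * b powr (2 * q) * D\<^sup>2"
      unfolding power_mult_distrib power2_minus sqb C1_def by (simp add: algebra_simps)
    also have "\<dots> \<le> (1 + e / 2) * (q\<^sup>2 * E) * A\<^sup>2 + C1 * b powr (2 * q) * D\<^sup>2"
      using powr_diff_square_le[of a b q] ab q e unfolding E_def t_def
      by (intro add_mono mult_right_mono mult_left_mono) auto
    finally have 1: "t * (a powr q * A - b powr q * B)\<^sup>2
        \<le> (1 + e / 2) * (q\<^sup>2 * E) * A\<^sup>2 + C1 * b powr (2 * q) * D\<^sup>2" .
    define M where "M = (a - b) * b powr t"
    define J where "J = a powr (2 * q) / t"
    have Jnn: "J \<ge> 0" using t by (simp add: J_def)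
    have Mnn: "M \<ge> 0" using ab by (simp add: M_def)
    \<comment> \<open>The coefficient \<open>M\<close> of the linear term is dominated by the
      geometric mean of the main coefficient \<open>E\<close> and the error coefficient
      \<open>J\<close>, so the linear term can be absorbed however small \<open>e\<close>
      is.\<close>
    have MEJ: "M\<^sup>2 \<le> E * J"
    proof -
      have "M\<^sup>2 = ((a - b) * b powr t) * (b powr t * (a - b))"
        by (simp add: M_def power2_eq_square)
      also have "\<dots> \<le> ((a - b) * b powr t) * (a / t * (a powr t - b powr t))"
        using ab t powr_mult_diff_le[of b a t] by (intro mult_left_mono) auto
      also have "\<dots> \<le> ((a - b) * a powr t) * (a / t * (a powr t - b powr t))"
        using ab t pm by (intro mult_right_mono mult_left_mono) auto
      also have "\<dots> = E * ((a powr t * a) / t)" by (simp add: E_def algebra_simps)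
      also have "a powr t * a = a powr (2 * q)"
        using ab by (simp add: t_def powr_diff powr_minus)
      finally show ?thesis by (simp add: J_def)
    qed
    have cross: "2 * ((1 + e) * M * A * D) \<le> (e / 2) * E * A\<^sup>2 + 2 * (1 + e)\<^sup>2 / e * J * D\<^sup>2"
    proof (rule two_mult_le_add_if_square_le)
      have "((1 + e) * M * A * D)\<^sup>2 = (1 + e)\<^sup>2 * A\<^sup>2 * D\<^sup>2 * M\<^sup>2"
        by (simp add: power_mult_distrib)
      also have "\<dots> \<le> (1 + e)\<^sup>2 * A\<^sup>2 * D\<^sup>2 * (E * J)"
        using MEJ by (intro mult_left_mono) auto
      also have "\<dots> = ((e / 2) * E * A\<^sup>2) * (2 * (1 + e)\<^sup>2 / e * J * D\<^sup>2)"
        using e by (simp add: field_simps)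
      finally show "((1 + e) * M * A * D)\<^sup>2 \<le> ((e / 2) * E * A\<^sup>2) * (2 * (1 + e)\<^sup>2 / e * J * D\<^sup>2)" .
    qed (use e Enn Jnn in auto)
    have Mle: "M \<le> a powr (2 * q)"
    proof -
      have "M \<le> a * a powr t" unfolding M_def using ab pm by (intro mult_mono) auto
      also have "\<dots> = a powr (2 * q)" using ab by (simp add: t_def powr_diff powr_minus)
      finally show ?thesis .
    qed
    have 2: "(a - b) * (a powr t * A\<^sup>2 - b powr t * B\<^sup>2) = E * A\<^sup>2 - (2 * M * A * D + M * D\<^sup>2)"
      by (simp add: E_def M_def D_def power2_eq_square algebra_simps)
    have "q\<^sup>2 * (2 * ((1 + e) * M * A * D)) \<le> q\<^sup>2 * ((e / 2) * E * A\<^sup>2 + 2 * (1 + e)\<^sup>2 / e * J * D\<^sup>2)"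
      using cross by (intro mult_left_mono) auto
    also have "\<dots> = q\<^sup>2 * (e / 2) * E * A\<^sup>2 + C2 * a powr (2 * q) * D\<^sup>2"
      by (simp add: C2_def J_def algebra_simps)
    finally have 3: "(1 + e) * q\<^sup>2 * (2 * M * A * D) \<le> q\<^sup>2 * (e / 2) * E * A\<^sup>2 + C2 * a powr (2 * q) * D\<^sup>2"
      by (simp add: algebra_simps)
    have 4: "C3 * (M * D\<^sup>2) \<le> C3 * (a powr (2 * q) * D\<^sup>2)"
      using Mle Cnn by (intro mult_left_mono mult_right_mono) auto
    have 5: "C1 * b powr (2 * q) * D\<^sup>2 \<le> C1 * a powr (2 * q) * D\<^sup>2"
      using pm Cnn by (intro mult_left_mono mult_right_mono) auto
    have 6: "C * a powr (2 * q) * D\<^sup>2 \<le> C * (a powr (2 * q) + b powr (2 * q)) * D\<^sup>2"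
      using Cnn by (intro mult_left_mono mult_right_mono) (auto simp: C_def)
    have DD: "(A - B)\<^sup>2 = D\<^sup>2" by (simp add: D_def power2_commute)
    \<comment> \<open>Exact regrouping: the two bracketed differences are nonnegative by
      \<open>3\<close> and \<open>4\<close>, and what remains dominates the bound in
      \<open>1\<close> by \<open>5\<close>.\<close>
    have "(1 + e) * q\<^sup>2 * (E * A\<^sup>2 - (2 * M * A * D + M * D\<^sup>2)) + C * a powr (2 * q) * D\<^sup>2
       = (1 + e / 2) * (q\<^sup>2 * E) * A\<^sup>2 + C1 * a powr (2 * q) * D\<^sup>2
        + (q\<^sup>2 * (e / 2) * E * A\<^sup>2 + C2 * a powr (2 * q) * D\<^sup>2 - (1 + e) * q\<^sup>2 * (2 * M * A * D))
        + (C3 * (a powr (2 * q) * D\<^sup>2) - C3 * (M * D\<^sup>2))"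
      by (simp add: C_def C3_def algebra_simps)
    with 1 3 4 5 6 show ?thesis unfolding 2 DD by linarith
  qed
  have "t * (a powr q * A - b powr q * B)\<^sup>2
       \<le> (1 + e) * q\<^sup>2 * ((a - b) * (a powr t * A\<^sup>2 - b powr t * B\<^sup>2))
         + C * (a powr (2 * q) + b powr (2 * q)) * (A - B)\<^sup>2"
    if "a > 0" "b > 0" "A \<ge> 0" "B \<ge> 0" for a b A B :: real
  proof (cases "b \<le> a")
    case True
    with main that show ?thesis by blast
  next
    case False
    with that main[of a b B A] have "t * (b powr q * B - a powr q * A)\<^sup>2
       \<le> (1 + e) * q\<^sup>2 * ((b - a) * (b powr t * B\<^sup>2 - a powr t * A\<^sup>2))
         + C * (b powr (2 * q) + a powr (2 * q)) * (B - A)\<^sup>2"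
      by simp
    also have "(b - a) * (b powr t * B\<^sup>2 - a powr t * A\<^sup>2) = (a - b) * (a powr t * A\<^sup>2 - b powr t * B\<^sup>2)"
      by (simp add: algebra_simps)
    finally show ?thesis
      by (simp add: power2_commute[of "b powr q * B"] power2_commute[of B] add.commute[of "b powr (2*q)"])
  qed
  moreover have "C \<ge> 0" using Cnn by (simp add: C_def)
  ultimately show ?thesis using that unfolding t_def by blast
qed

text \<open>The tangent at 1 lies above the concave power; this is Young's inequality with second
  factor 1.\<close>

lemma powr_le_affine:
  fixes x m :: real
  assumes "0 < x" "0 < m" "m < 1"
  shows "x powr m \<le> 1 - m * (1 - x)"
proof -
  have "x powr m * 1 powr (1 - m) \<le> m * x + (1 - m) * 1"
    using assms by (intro Youngs_inequality_0) auto
  then show ?thesis by (simp add: algebra_simps)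
qed

text \<open>For a negative exponent the unweighted product (a - b) (a^t - b^t) is nonpositive, so
  only the variation of the weights can make the left-hand side positive. This requires that the
  larger value carries the larger weight, and the negative part then leaves at most a multiple of (A
  - B)^2.\<close>

lemma weighted_negative_powr_diff_le:
  fixes a b A B t :: real
  assumes t: "-1 < t" "t < 0" and pos: "a > 0" "b > 0" "A \<ge> 0" "B \<ge> 0"
  shows "(a - b) * (a powr t * A\<^sup>2 - b powr t * B\<^sup>2)
    \<le> 1 / (- t) * (a powr (1 + t) + b powr (1 + t)) * (A - B)\<^sup>2"
proof -
  define m where "m = - t"
  have m: "0 < m" "m < 1" using t by (auto simp: m_def)
  have main: "(a - b) * (a powr t * A\<^sup>2 - b powr t * B\<^sup>2)
      \<le> 1 / m * (a powr (1 + t) + b powr (1 + t)) * (A - B)\<^sup>2"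
    if ab: "0 < b" "b \<le> a" and AB: "A \<ge> 0" "B \<ge> 0" for a b A B :: real
  proof -
    have rhs: "0 \<le> 1 / m * (a powr (1 + t) + b powr (1 + t)) * (A - B)\<^sup>2" using m by simp
    have ple: "a powr t \<le> b powr t" using ab t by (intro powr_mono2') auto
    consider "a = b" | "A \<le> B" | "b < a" "B < A" using ab by force
    then show ?thesis
    proof cases
      case 1 then show ?thesis using rhs by simp
    next
      case 2
      have "a powr t * A\<^sup>2 \<le> b powr t * B\<^sup>2" using 2 ple AB by (intro mult_mono power_mono) auto
      then have "(a - b) * (a powr t * A\<^sup>2 - b powr t * B\<^sup>2) \<le> 0"
        using ab by (intro mult_nonneg_nonpos) auto
      then show ?thesis using rhs by linarith
    next
      case 3
      define x where "x = b / a"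
      have x: "0 < x" "x < 1" and b: "b = x * a" using 3 ab by (auto simp: x_def)
      have a: "a > 0" using ab 3 by simp
      define y where "y = x powr m"
      have y: "y > 0" "y \<le> 1 - m * (1 - x)" "y < 1"
        using powr_le_affine[of x m] x m powr_less_mono2[of m x 1] by (auto simp: y_def)
      have bt: "b powr t = a powr t / y"
        using x a unfolding b by (simp add: powr_mult m_def y_def powr_minus field_simps)
      define D where "D = A - B"
      have "a powr t * A\<^sup>2 - b powr t * B\<^sup>2 = a powr t * ((B + D)\<^sup>2 - B\<^sup>2 / y)"
        by (simp add: bt D_def right_diff_distrib)
      also have "\<dots> \<le> a powr t * (D\<^sup>2 / (1 - y))"
      proof -
        \<comment> \<open>The Young parameter 1 / y - 1 makes the coefficient of B^2 exactly 1 / y,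
          which cancels against the subtracted term.\<close>
        have "(B + D)\<^sup>2 \<le> (1 + (1 / y - 1)) * B\<^sup>2 + (1 + 1 / (1 / y - 1)) * D\<^sup>2"
          using y by (intro square_add_le_weighted) auto
        also have "1 + 1 / (1 / y - 1) = 1 / (1 - y)" using y by (simp add: field_simps)
        finally have "(B + D)\<^sup>2 - B\<^sup>2 / y \<le> D\<^sup>2 / (1 - y)" by simp
        then show ?thesis by (intro mult_left_mono) auto
      qed
      finally have "(a - b) * (a powr t * A\<^sup>2 - b powr t * B\<^sup>2) \<le> (a - b) * (a powr t * (D\<^sup>2 / (1 - y)))"
        using ab by (intro mult_left_mono) auto
      also have "\<dots> = a powr (1 + t) * D\<^sup>2 * ((1 - x) / (1 - y))"
        using a by (simp add: b powr_add algebra_simps diff_divide_distrib)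
      \<comment> \<open>The bound y <= 1 - m (1 - x) keeps (1 - x) / (1 - y) bounded as
        \<open>b\<close> approaches \<open>a\<close>.\<close>
      also have "\<dots> \<le> a powr (1 + t) * D\<^sup>2 * (1 / m)"
        using y m x by (intro mult_left_mono) (auto simp: field_simps)
      also have "\<dots> \<le> 1 / m * (a powr (1 + t) + b powr (1 + t)) * (A - B)\<^sup>2"
        using m by (simp add: D_def algebra_simps divide_right_mono)
      finally show ?thesis .
    qed
  qed
  show ?thesis
  proof (cases "b \<le> a")
    case True
    with main pos show ?thesis by (simp add: m_def)
  next
    case False
    with main[of a b B A] pos have "(b - a) * (b powr t * B\<^sup>2 - a powr t * A\<^sup>2)
      \<le> 1 / m * (b powr (1 + t) + a powr (1 + t)) * (B - A)\<^sup>2" by simp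
    also have "(b - a) * (b powr t * B\<^sup>2 - a powr t * A\<^sup>2) = (a - b) * (a powr t * A\<^sup>2 - b powr t * B\<^sup>2)"
      by (simp add: algebra_simps)
    finally show ?thesis
      by (simp add: m_def power2_commute[of B] add.commute[of "b powr (1 + t)"])
  qed
qed

section \<open>Weights and their fractional energy\<close>

text \<open>A substitute for polar coordinates: \<open>f\<close> is dominated by the sum of the step
  functions with value \<open>c j\<close> on the ball of radius \<open>r j\<close>, whose volume is
  proportional to \<open>r j ^ DIM('a)\<close>.\<close>

lemma nn_integral_finite_if_ball_cover:
  fixes f :: "'a::euclidean_space \<Rightarrow> real" and r c :: "nat \<Rightarrow> real"
  assumes "\<And>j. r j \<ge> 0" and "\<And>j. c j \<ge> 0"
    and "summable (\<lambda>j. c j * r j ^ DIM('a))"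
    and "\<And>x. f x \<le> 0 \<or> (\<exists>j. norm x \<le> r j \<and> f x \<le> c j)"
  shows "(\<integral>\<^sup>+x. ennreal (f x) \<partial>lborel) < \<infinity>"
proof -
  have single: "g j \<le> (\<Sum>j. g j)" for g :: "nat \<Rightarrow> ennreal" and j
    using sum_le_suminf[of g "{j}"] by auto
  have "ennreal (f x) \<le> (\<Sum>j. ennreal (c j) * indicator (cball 0 (r j)) x)" for x
  proof (cases "f x \<le> 0")
    case False
    with assms(4)[of x] obtain j where j: "norm x \<le> r j" "f x \<le> c j" by auto
    have "ennreal (f x) \<le> ennreal (c j) * indicator (cball 0 (r j)) x"
      using j by (simp add: ennreal_leI)
    also have "\<dots> \<le> (\<Sum>j. ennreal (c j) * indicator (cball 0 (r j)) x)"
      by (rule single)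
    finally show ?thesis .
  qed (simp add: ennreal_neg)
  then have "(\<integral>\<^sup>+x. ennreal (f x) \<partial>lborel)
      \<le> (\<integral>\<^sup>+x. (\<Sum>j. ennreal (c j) * indicator (cball 0 (r j)) (x::'a)) \<partial>lborel)"
    by (auto intro!: nn_integral_mono)
  also have "\<dots> = (\<Sum>j. ennreal (c j) * emeasure lborel (cball (0::'a) (r j)))"
    by (subst nn_integral_suminf)
      (auto simp: nn_integral_cmult_indicator
        intro!: borel_measurable_times_ennreal borel_measurable_indicator borel_closed)
  also have "\<dots> = (\<Sum>j. ennreal (unit_ball_vol (DIM('a)) * (c j * r j ^ DIM('a))))"
    using assms(1,2) by (simp add: emeasure_cball ennreal_mult[symmetric] mult_ac)
  also have "\<dots> = ennreal (\<Sum>j. unit_ball_vol (DIM('a)) * (c j * r j ^ DIM('a)))"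
    using assms by (intro suminf_ennreal2) (auto intro: summable_mult)
  finally show ?thesis by (simp add: order_le_less_trans)
qed

lemma nn_integral_norm_powr_cball_finite:
  fixes a :: real
  assumes "0 \<le> a" "a < DIM('a)"
  shows "(\<integral>\<^sup>+x. ennreal (indicator (cball 0 1) x * norm (x::'a::euclidean_space) powr (- a)) \<partial>lborel) < \<infinity>"
proof (rule nn_integral_finite_if_ball_cover)
  let ?r = "\<lambda>j. 2 powr (- real j)" and ?c = "\<lambda>j. 2 powr (a * (real j + 1))"
  show "summable (\<lambda>j. ?c j * ?r j ^ DIM('a))"
  proof -
    have eq: "?c j * ?r j ^ DIM('a) = 2 powr a * (2 powr (a - DIM('a))) ^ j" for j
      by (simp add: powr_realpow[symmetric] powr_powr powr_add[symmetric] algebra_simps)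
    have "2 powr (a - DIM('a)) < (1::real)" using assms by (simp add: powr_less_one)
    then show ?thesis unfolding eq by (intro summable_mult summable_geometric) auto
  qed
  fix x :: 'a
  show "indicator (cball 0 1) x * norm x powr (- a) \<le> 0 \<or>
     (\<exists>j. norm x \<le> ?r j \<and> indicator (cball 0 1) x * norm x powr (- a) \<le> ?c j)"
  \<comment> \<open>At the origin \<open>powr\<close> takes the value 0, so the singular point falls
    under the first alternative.\<close>
  proof (cases "x \<noteq> 0 \<and> norm x \<le> 1")
    case True
    \<comment> \<open>The dyadic shell 2^(-j-1) < |x| <= 2^(-j).\<close>
    define j where "j = nat \<lfloor>- log 2 (norm x)\<rfloor>"
    have "- log 2 (norm x) \<ge> 0" using True by simp
    then have j: "real j \<le> - log 2 (norm x)" "- log 2 (norm x) < real j + 1"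
      by (auto simp: j_def)
    have nx: "norm x = 2 powr (log 2 (norm x))" using True by simp
    have "norm x \<le> ?r j" by (subst nx) (use j in \<open>intro powr_mono\<close>, auto)
    moreover have "norm x powr (- a) \<le> ?c j"
    proof -
      have "norm x powr (- a) = 2 powr (a * (- log 2 (norm x)))"
        by (subst nx) (simp add: powr_powr mult.commute)
      also have "\<dots> \<le> ?c j" using j assms by (intro powr_mono mult_left_mono) auto
      finally show ?thesis .
    qed
    ultimately show ?thesis using True by auto
  qed auto
qed auto

lemma nn_integral_one_plus_norm_powr_finite:
  fixes b :: real
  assumes "DIM('a) < b"
  shows "(\<integral>\<^sup>+x. ennreal ((1 + norm (x::'a::euclidean_space)) powr (- b)) \<partial>lborel) < \<infinity>"
proof (rule nn_integral_finite_if_ball_cover)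
  let ?r = "\<lambda>j. 2 powr (real j + 1)" and ?c = "\<lambda>j. 2 powr (- b * real j)"
  show "summable (\<lambda>j. ?c j * ?r j ^ DIM('a))"
  proof -
    have eq: "?c j * ?r j ^ DIM('a) = 2 powr DIM('a) * (2 powr (DIM('a) - b)) ^ j" for j
      by (simp add: powr_realpow[symmetric] powr_powr powr_add[symmetric] algebra_simps)
    have "2 powr (DIM('a) - b) < (1::real)" using assms by (simp add: powr_less_one)
    then show ?thesis unfolding eq by (intro summable_mult summable_geometric) auto
  qed
  fix x :: 'a
  have pos: "1 + norm x > 0" by (simp add: add_pos_nonneg)
  define j where "j = nat \<lfloor>log 2 (1 + norm x)\<rfloor>"
  have "log 2 (1 + norm x) \<ge> 0" using pos by (subst zero_le_log_cancel_iff) auto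
  then have j: "real j \<le> log 2 (1 + norm x)" "log 2 (1 + norm x) < real j + 1"
    by (auto simp: j_def)
  have nx: "1 + norm x = 2 powr (log 2 (1 + norm x))" using pos by simp
  have "1 + norm x \<le> ?r j" by (subst nx) (use j in \<open>intro powr_mono\<close>, auto)
  moreover have "(1 + norm x) powr (- b) \<le> ?c j"
  proof -
    have "(1 + norm x) powr (- b) = 2 powr (- b * log 2 (1 + norm x))"
      by (subst nx) (simp add: powr_powr mult.commute)
    also have "\<dots> \<le> ?c j"
      using j assms by (intro powr_mono mult_left_mono_neg) (auto intro: order_trans[of _ "- real DIM('a)"])
    finally show ?thesis .
  qed
  ultimately show "(1 + norm x) powr (- b) \<le> 0 \<or>
     (\<exists>j. norm x \<le> ?r j \<and> (1 + norm x) powr (- b) \<le> ?c j)"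
    by (intro disjI2 exI[of _ j]) simp
qed auto

lemma nn_integral_lborel_affine:
  fixes f :: "'a::euclidean_space \<Rightarrow> ennreal"
  assumes "f \<in> borel_measurable borel" "c \<noteq> 0"
  shows "(\<integral>\<^sup>+x. f x \<partial>lborel) = ennreal (\<bar>c\<bar> ^ DIM('a)) * (\<integral>\<^sup>+x. f (t + c *\<^sub>R x) \<partial>lborel)"
  using assms by (subst lborel_affine[of c t])
    (auto simp: nn_integral_density nn_integral_distr nn_integral_cmult ennreal_power)

lemma nn_integral_lborel_minus:
  fixes f :: "'a::euclidean_space \<Rightarrow> ennreal"
  assumes "f \<in> borel_measurable borel"
  shows "(\<integral>\<^sup>+y. f (x - y) \<partial>lborel) = (\<integral>\<^sup>+y. f y \<partial>lborel)"
  using nn_integral_lborel_affine[OF assms, of "-1" x] by simp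

lemma lborel_distr_minus:
  fixes x :: "'a::euclidean_space"
  shows "distr lborel borel (\<lambda>y. x - y) = lborel"
  using lborel_affine[of "-1" x] by (simp add: density_1)

section \<open>Comparing the weight at different points\<close>

lemma one_plus_norm_mult:
  fixes x y :: "'a::real_normed_vector"
  shows "1 + norm y \<le> (1 + norm x) * (1 + norm (x - y))"
proof -
  have "norm y \<le> norm x + norm (x - y)" by (metis norm_triangle_sub add.commute norm_minus_commute)
  moreover have "0 \<le> norm x * norm (x - y)" by simp
  moreover have "(1 + norm x) * (1 + norm (x - y)) = 1 + norm x + norm (x - y) + norm x * norm (x - y)"
    by (simp add: algebra_simps)
  ultimately show ?thesis by linarith
qed

text \<open>Peetre's inequality: 1 + |x| is submultiplicative, so moving the centre of a tail costs
  only a factor (1 + |x|)^d.\<close>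

lemma tail_translate_le:
  fixes x y :: "'a::real_normed_vector"
  assumes "d \<ge> 0"
  shows "(1 + norm (x - y)) powr (- d) \<le> (1 + norm x) powr d * (1 + norm y) powr (- d)"
proof -
  have p: "1 + norm x > 0" "1 + norm y > 0" "1 + norm (x - y) > 0" by (auto simp: add_pos_nonneg)
  have "(1 + norm y) powr d \<le> ((1 + norm x) * (1 + norm (x - y))) powr d"
    using assms p one_plus_norm_mult[of y x] by (intro powr_mono2) auto
  also have "\<dots> = (1 + norm x) powr d * (1 + norm (x - y)) powr d" by (simp add: powr_mult)
  finally show ?thesis using p by (simp add: powr_minus field_simps)
qed

lemma norm_powr_le_tail:
  fixes z :: "'a::real_normed_vector"
  assumes "d \<ge> 0" "norm z \<ge> e" "0 < e" "e \<le> 1"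
  shows "norm z powr (- d) \<le> (2 / e) powr d * (1 + norm z) powr (- d)"
proof -
  have "1 + norm z \<le> (2 / e) * norm z"
  proof -
    have "e * norm z \<le> 1 * norm z" using assms by (intro mult_right_mono) auto
    then have "e * (1 + norm z) \<le> 2 * norm z" using assms by (simp add: distrib_left)
    then show ?thesis using assms by (simp add: field_simps)
  qed
  then have "(1 + norm z) powr d \<le> ((2 / e) * norm z) powr d"
    using assms by (intro powr_mono2) auto
  also have "\<dots> = (2 / e) powr d * norm z powr d" using assms by (subst powr_mult) auto
  finally have "(1 + norm z) powr d \<le> (2 / e) powr d * norm z powr d" .
  moreover have "norm z powr d > 0" "(1 + norm z) powr d > 0" using assms by auto
  ultimately show ?thesis unfolding powr_minus by (simp add: field_simps)
qed

text \<open>By the triangle inequality one of \<open>y\<close>, \<open>x - y\<close> has norm at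
  least |x| / 2, and its tail is at most 2^d times the tail at \<open>x\<close>. Integrated in
  \<open>y\<close>, for \<open>d\<close> above the dimension, this bounds the convolution of the
  tail with itself by a multiple of the tail.\<close>

lemma tail_mult_tail_le:
  fixes x y :: "'a::real_normed_vector"
  assumes "d \<ge> 0"
  shows "(1 + norm y) powr (- d) * (1 + norm (x - y)) powr (- d)
    \<le> 2 powr d * (1 + norm x) powr (- d) * ((1 + norm y) powr (- d) + (1 + norm (x - y)) powr (- d))"
proof -
  have half: "(1 + norm v) powr (- d) \<le> 2 powr d * (1 + norm x) powr (- d)"
    if "norm x \<le> 2 * norm v" for v :: 'a
  proof -
    have "(1 + norm x) powr d \<le> (2 * (1 + norm v)) powr d"
      using assms that by (intro powr_mono2) auto
    then have "(1 + norm x) powr d \<le> 2 powr d * (1 + norm v) powr d"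
      by (subst (asm) powr_mult) auto
    moreover have "1 + norm x > 0" "1 + norm v > 0" by (auto simp: add_pos_nonneg)
    ultimately show ?thesis by (simp add: powr_minus field_simps)
  qed
  have "norm x \<le> norm y + norm (x - y)" by (metis norm_triangle_sub)
  then consider "norm x \<le> 2 * norm y" | "norm x \<le> 2 * norm (x - y)" by linarith
  then show ?thesis
  proof cases
    case 1
    have "(1 + norm y) powr (- d) * (1 + norm (x - y)) powr (- d)
      \<le> 2 powr d * (1 + norm x) powr (- d) * (1 + norm (x - y)) powr (- d)"
      using half[OF 1] by (intro mult_right_mono) auto
    then show ?thesis by (simp add: distrib_left add_increasing)
  next
    case 2
    have "(1 + norm y) powr (- d) * (1 + norm (x - y)) powr (- d)
      \<le> (1 + norm y) powr (- d) * (2 powr d * (1 + norm x) powr (- d))"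
      using half[OF 2] by (intro mult_left_mono) auto
    then show ?thesis by (simp add: distrib_left mult_ac add_increasing2)
  qed
qed

text \<open>The exponent is halved because the function enters the energies squared: its square is
  (1 + |x|)^(-d), which for d = N + 2 s is the weight in the definition of L_s.\<close>

definition bump :: "real \<Rightarrow> 'a::real_normed_vector \<Rightarrow> real" where
  "bump d x = (1 + norm x) powr (- d / 2)"

lemma bump_nonneg [simp]: "bump d x \<ge> 0"
  by (simp add: bump_def)

lemma bump_pos: "bump d x > 0"
  unfolding bump_def using norm_ge_zero[of x] by (smt (verit) powr_gt_zero)

lemma bump_square: "(bump d x)\<^sup>2 = (1 + norm x) powr (- d)"
  by (simp add: bump_def power2_eq_square powr_add[symmetric])

lemma borel_measurable_bump [measurable]:
  "bump d \<in> borel_measurable (borel :: 'a::euclidean_space measure)"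
  unfolding bump_def by measurable

text \<open>Mean value theorem in the radial variable. For r >= 0 within distance 1 of |x| one has 1
  + r >= (1 + |x|) / 2, so the derivative is controlled by the bump at \<open>x\<close> itself and
  not merely by a constant.\<close>

lemma bump_diff_le:
  fixes x y :: "'a::real_normed_vector"
  assumes "d \<ge> 0" "norm (x - y) \<le> 1"
  shows "\<bar>bump d x - bump d y\<bar> \<le> d / 2 * 2 powr (d / 2) * bump d x * norm (x - y)"
proof -
  define m where "m = d / 2"
  define g where "g r = (1 + r) powr (- m)" for r :: real
  define K where "K = m * 2 powr m * bump d x"
  have m: "m \<ge> 0" using assms by (simp add: m_def)
  have xy: "\<bar>norm x - norm y\<bar> \<le> norm (x - y)" by (rule norm_triangle_ineq3)
  have "norm (g (norm x) - g (norm y)) \<le> K * norm (norm x - norm y)"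
  proof (rule field_differentiable_bound)
    let ?S = "{r::real. r \<ge> 0 \<and> \<bar>r - norm x\<bar> \<le> 1}"
    show "convex ?S"
    proof -
      have "?S = {0..} \<inter> {norm x - 1..norm x + 1}" by auto
      then show ?thesis by (simp add: convex_Int)
    qed
    fix r assume r: "r \<in> ?S"
    then have r1: "1 + r > 0" by auto
    show "(g has_field_derivative (- m * (1 + r) powr (- m - 1))) (at r within ?S)"
      unfolding g_def using r1 by (auto intro!: derivative_eq_intros)
    have "(1 + r) powr (- m - 1) \<le> (1 + r) powr (- m)" using r m by (intro powr_mono) auto
    also have "\<dots> \<le> ((1 + norm x) / 2) powr (- m)"
      using r m by (intro powr_mono2') (auto simp: add_pos_nonneg)
    also have "\<dots> = 2 powr m * bump d x"
      by (simp add: powr_divide bump_def m_def powr_minus field_simps)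
    finally show "norm (- m * (1 + r) powr (- m - 1)) \<le> K"
      using m by (simp add: K_def abs_mult mult_left_mono mult.assoc)
  qed (use assms xy in auto)
  also have "\<dots> \<le> K * norm (x - y)"
    using xy m by (intro mult_left_mono) (auto simp: K_def)
  finally show ?thesis by (simp add: g_def K_def bump_def m_def)
qed

lemma square_diff_le_add_squares:
  fixes A B :: real
  assumes "A \<ge> 0" "B \<ge> 0"
  shows "(A - B)\<^sup>2 \<le> A\<^sup>2 + B\<^sup>2"
  using assms by (simp add: power2_diff)

text \<open>For |x - y| <= 1 the Lipschitz bound leaves the singularity |x - y|^(2-d), integrable
  because d < DIM('a) + 2. For |x - y| > 1 the kernel is bounded by a multiple of a tail, and
  \<open>tail_mult_tail_le\<close> returns the decay in \<open>x\<close>.\<close>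

lemma bump_energy_bound:
  fixes d :: real
  assumes d: "DIM('a) < d" "d < DIM('a) + 2"
  obtains C where "C \<ge> 0"
    "\<And>x::'a::euclidean_space.
      (\<integral>\<^sup>+y. ennreal ((bump d x - bump d y)\<^sup>2 * norm (x - y) powr (- d)) \<partial>lborel)
      \<le> ennreal (C * (1 + norm x) powr (- d))"
proof -
  have d0: "d \<ge> 0" using d by (meson less_eq_real_def of_nat_0_le_iff order_trans)
  \<comment> \<open>In dimension one d - 2 may be negative, while the integrability lemma asks for a
    nonnegative exponent.\<close>
  define a where "a = max 0 (d - 2)"
  have a: "0 \<le> a" "a < DIM('a)" using d DIM_positive[where 'a='a] by (auto simp: a_def)
  define K where "K = (d / 2 * 2 powr (d / 2))\<^sup>2"
  define K2 where "K2 = 2 powr d * (1 + 2 powr d)"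
  have K2: "K2 \<ge> 0" "K \<ge> 0" by (auto simp: K2_def K_def)
  define near where "near z = indicator (cball 0 1) z * norm z powr (- a)" for z :: 'a
  define w where "w z = (1 + norm z) powr (- d)" for z :: 'a
  have wnn: "w z \<ge> 0" "near z \<ge> 0" for z by (auto simp: w_def near_def)
  have [measurable]: "near \<in> borel_measurable borel" "w \<in> borel_measurable borel"
    unfolding near_def w_def
    by (rule borel_measurable_times[OF borel_measurable_indicator[OF borel_closed[OF closed_cball]]])
      measurable
  have pw: "(bump d x - bump d y)\<^sup>2 * norm (x - y) powr (- d)
      \<le> (K + K2) * w x * (near (x - y) + (w (x - y) + w y))" for x y :: 'a
  proof (cases "norm (x - y) \<le> 1")
    case True
    show ?thesis
    proof (cases "x = y")
      case False
      have "(bump d x - bump d y)\<^sup>2 \<le> (d / 2 * 2 powr (d / 2) * bump d x * norm (x - y))\<^sup>2"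
        using bump_diff_le[OF d0 True] by (metis abs_ge_zero power2_abs power_mono)
      also have "\<dots> = K * w x * norm (x - y) powr 2"
        using False by (simp add: K_def w_def power_mult_distrib power_divide bump_square[symmetric] powr_numeral)
      finally have "(bump d x - bump d y)\<^sup>2 * norm (x - y) powr (- d)
          \<le> K * w x * norm (x - y) powr 2 * norm (x - y) powr (- d)"
        by (intro mult_right_mono) auto
      also have "\<dots> = K * w x * norm (x - y) powr (- (d - 2))"
        using powr_add[of "norm (x - y)" 2 "- d"] by (simp only: mult.assoc) simp
      also have "norm (x - y) powr (- (d - 2)) \<le> near (x - y)"
        using True False unfolding near_def a_def by (auto intro!: powr_mono')
      then have "K * w x * norm (x - y) powr (- (d - 2)) \<le> K * w x * near (x - y)"
        using wnn K2 by (intro mult_left_mono) auto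
      also have "\<dots> \<le> (K + K2) * w x * (near (x - y) + (w (x - y) + w y))"
        using wnn K2 by (intro mult_mono) auto
      finally show ?thesis .
    qed (use wnn K2 in auto)
  next
    case False
    have "(bump d x - bump d y)\<^sup>2 \<le> w x + w y"
      using square_diff_le_add_squares[of "bump d x" "bump d y"] by (simp add: w_def bump_square)
    moreover have "norm (x - y) powr (- d) \<le> 2 powr d * w (x - y)"
      using norm_powr_le_tail[of d 1 "x - y"] False d0 by (simp add: w_def)
    ultimately have "(bump d x - bump d y)\<^sup>2 * norm (x - y) powr (- d)
        \<le> (w x + w y) * (2 powr d * w (x - y))"
      using wnn by (intro mult_mono) auto
    also have "\<dots> = 2 powr d * (w x * w (x - y) + w y * w (x - y))" by (simp add: algebra_simps)
    also have "\<dots> \<le> 2 powr d * (w x * (w (x - y) + w y) + 2 powr d * w x * (w y + w (x - y)))"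
      using tail_mult_tail_le[OF d0, of y x] wnn unfolding w_def
      by (intro mult_left_mono add_mono) auto
    also have "\<dots> = K2 * w x * (w (x - y) + w y)" by (simp add: K2_def algebra_simps)
    also have "\<dots> \<le> (K + K2) * w x * (near (x - y) + (w (x - y) + w y))"
      using wnn K2 by (intro mult_mono) auto
    finally show ?thesis .
  qed
  have fin: "(\<integral>\<^sup>+x. ennreal (near x) \<partial>lborel) < \<infinity>" "(\<integral>\<^sup>+x. ennreal (w x) \<partial>lborel) < \<infinity>"
    using nn_integral_norm_powr_cball_finite[OF a] nn_integral_one_plus_norm_powr_finite[OF d(1)]
    by (auto simp: near_def w_def)
  define I where "I = (\<integral>\<^sup>+x. ennreal (near x) \<partial>lborel) + ((\<integral>\<^sup>+x. ennreal (w x) \<partial>lborel) + (\<integral>\<^sup>+x. ennreal (w x) \<partial>lborel))"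
  have I: "I = ennreal (enn2real I)" using fin by (simp add: I_def)
  show thesis
  proof
    show "0 \<le> (K + K2) * enn2real I" using K2 by simp
    fix x :: 'a
    have "(\<integral>\<^sup>+y. ennreal ((bump d x - bump d y)\<^sup>2 * norm (x - y) powr (- d)) \<partial>lborel)
        \<le> (\<integral>\<^sup>+y. ennreal ((K + K2) * w x) * (ennreal (near (x - y)) + (ennreal (w (x - y)) + ennreal (w y))) \<partial>lborel)"
      using pw[of x] wnn K2
      by (intro nn_integral_mono) (simp add: ennreal_mult[symmetric] ennreal_leI del: ennreal_plus flip: ennreal_plus)
    also have "\<dots> = ennreal ((K + K2) * w x) * I"
      unfolding I_def
      using nn_integral_lborel_minus[of "\<lambda>z. ennreal (near z)" x] nn_integral_lborel_minus[of "\<lambda>z. ennreal (w z)" x]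
      by (simp add: nn_integral_cmult nn_integral_add)
    also have "\<dots> = ennreal ((K + K2) * enn2real I * (1 + norm x) powr (- d))"
      using wnn K2 by (subst I) (simp add: ennreal_mult[symmetric] w_def mult_ac)
    finally show "(\<integral>\<^sup>+y. ennreal ((bump d x - bump d y)\<^sup>2 * norm (x - y) powr (- d)) \<partial>lborel)
        \<le> ennreal ((K + K2) * enn2real I * (1 + norm x) powr (- d))" .
  qed
qed

text \<open>The substitution y = R y' reduces to R = 1; kernel and volume element contribute R^(-d)
  and R^N, together R^(-2s) when d = N + 2 s.\<close>

lemma scaled_bump_energy_bound:
  fixes d :: real
  assumes d: "DIM('a) < d" "d < DIM('a) + 2"
  obtains C where "C \<ge> 0"
    "\<And>(x::'a::euclidean_space) R. R > 0 \<Longrightarrow>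
      (\<integral>\<^sup>+y. ennreal ((bump d (x /\<^sub>R R) - bump d (y /\<^sub>R R))\<^sup>2 * norm (x - y) powr (- d)) \<partial>lborel)
      \<le> ennreal (C * R powr (DIM('a) - d) * (bump d (x /\<^sub>R R))\<^sup>2)"
proof -
  from bump_energy_bound[OF d] obtain C where C: "C \<ge> 0"
    "\<And>x::'a. (\<integral>\<^sup>+y. ennreal ((bump d x - bump d y)\<^sup>2 * norm (x - y) powr (- d)) \<partial>lborel)
      \<le> ennreal (C * (1 + norm x) powr (- d))" by blast
  have "(\<integral>\<^sup>+y. ennreal ((bump d (x /\<^sub>R R) - bump d (y /\<^sub>R R))\<^sup>2 * norm (x - y) powr (- d)) \<partial>lborel)
      \<le> ennreal (C * R powr (DIM('a) - d) * (bump d (x /\<^sub>R R))\<^sup>2)" if R: "R > 0" for x :: 'a and R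
  proof -
    let ?x = "x /\<^sub>R R"
    have eq: "norm (x - R *\<^sub>R y) powr (- d) = R powr (- d) * norm (?x - y) powr (- d)" for y
    proof -
      have "x - R *\<^sub>R y = R *\<^sub>R (?x - y)" using R by (simp add: scaleR_diff_right)
      then show ?thesis using R by (simp add: powr_mult)
    qed
    have "(\<integral>\<^sup>+y. ennreal ((bump d ?x - bump d (y /\<^sub>R R))\<^sup>2 * norm (x - y) powr (- d)) \<partial>lborel)
      = ennreal (\<bar>R\<bar> ^ DIM('a)) * (\<integral>\<^sup>+y. ennreal ((bump d ?x - bump d y)\<^sup>2 * (norm (x - R *\<^sub>R y) powr (- d))) \<partial>lborel)"
      using R by (subst nn_integral_lborel_affine[where c=R and t=0]) auto
    also have "\<dots> = ennreal (R ^ DIM('a)) * (\<integral>\<^sup>+y. ennreal (R powr (- d)) * ennreal ((bump d ?x - bump d y)\<^sup>2 * norm (?x - y) powr (- d)) \<partial>lborel)"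
      using R unfolding eq by (simp add: ennreal_mult[symmetric] mult_ac)
    also have "\<dots> = ennreal (R powr (DIM('a) - d)) * (\<integral>\<^sup>+y. ennreal ((bump d ?x - bump d y)\<^sup>2 * norm (?x - y) powr (- d)) \<partial>lborel)"
      using R by (subst nn_integral_cmult)
        (auto simp: mult.assoc[symmetric] ennreal_mult[symmetric] powr_realpow[symmetric] powr_add[symmetric])
    also have "\<dots> \<le> ennreal (R powr (DIM('a) - d)) * ennreal (C * (1 + norm ?x) powr (- d))"
      by (intro mult_left_mono C) auto
    finally show ?thesis using C(1) unfolding bump_square
      by (simp add: ennreal_mult[symmetric] mult_ac)
  qed
  with C(1) show thesis by (rule that)
qed

section \<open>The truncated operator\<close>

abbreviation tail :: "real \<Rightarrow> 'a::real_normed_vector \<Rightarrow> real" where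
  "tail d x \<equiv> (1 + norm x) powr (- d)"

definition trunc_kernel :: "real \<Rightarrow> real \<Rightarrow> 'a::real_normed_vector \<Rightarrow> real" where
  "trunc_kernel d e z = (if norm z > e then norm z powr (- d) else 0)"

text \<open>With the kernel cut off near the diagonal the integral converges absolutely for e > 0
  and every continuous \<open>f\<close> with finite weighted integral, so Fubini and the splitting
  of differences are available. The principal value is the limit as \<open>e\<close> decreases to
  0.\<close>

definition trunc_op :: "real \<Rightarrow> real \<Rightarrow> ('a::euclidean_space \<Rightarrow> real) \<Rightarrow> 'a \<Rightarrow> real" where
  "trunc_op d e f x = (\<integral>y. (f x - f y) * trunc_kernel d e (x - y) \<partial>lborel)"

lemma borel_measurable_trunc_kernel [measurable]:
  "trunc_kernel d e \<in> borel_measurable (borel :: 'a::euclidean_space measure)"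
  unfolding trunc_kernel_def by measurable

lemma trunc_kernel_nonneg [simp]: "trunc_kernel d e z \<ge> 0"
  by (simp add: trunc_kernel_def)

lemma trunc_kernel_minus [simp]: "trunc_kernel d e (- z) = trunc_kernel d e z"
  by (simp add: trunc_kernel_def)

lemma trunc_kernel_commute: "trunc_kernel d e (x - y) = trunc_kernel d e (y - x)"
  by (simp add: trunc_kernel_def norm_minus_commute)

lemma trunc_kernel_le: "trunc_kernel d e z \<le> norm z powr (- d)"
  by (simp add: trunc_kernel_def)

lemma trunc_kernel_le_tail:
  assumes "d \<ge> 0" "e > 0"
  shows "trunc_kernel d e z \<le> (2 / min e 1) powr d * tail d z"
  using norm_powr_le_tail[of d "min e 1" z] assms by (auto simp: trunc_kernel_def)

lemma integrable_tail:
  fixes d :: real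
  assumes "DIM('a) < d"
  shows "integrable lborel (tail d :: 'a::euclidean_space \<Rightarrow> real)"
  using nn_integral_one_plus_norm_powr_finite[OF assms]
  by (intro integrableI_bounded) auto

lemma integrable_lborel_minus:
  fixes f :: "'a::euclidean_space \<Rightarrow> real"
  assumes "integrable lborel f"
  shows "integrable lborel (\<lambda>y. f (x - y))"
  using assms integrable_distr_eq[of "\<lambda>y. x - y" lborel borel f] lborel_distr_minus[of x]
  by simp

lemma integral_lborel_minus:
  fixes f :: "'a::euclidean_space \<Rightarrow> real"
  assumes "f \<in> borel_measurable borel"
  shows "(\<integral>y. f (x - y) \<partial>lborel) = (\<integral>y. f y \<partial>lborel)"
  using assms integral_distr[of "\<lambda>y. x - y" lborel borel f] lborel_distr_minus[of x]
  by simp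

lemma integrable_lborel_plus:
  fixes f :: "'a::euclidean_space \<Rightarrow> real"
  assumes "integrable lborel f"
  shows "integrable lborel (\<lambda>y. f (x + y))"
  using assms integrable_distr_eq[of "\<lambda>y. x + y" lborel borel f] lborel_distr_plus[of x]
  by simp

lemma integral_lborel_plus:
  fixes f :: "'a::euclidean_space \<Rightarrow> real"
  assumes "f \<in> borel_measurable borel"
  shows "(\<integral>y. f (x + y) \<partial>lborel) = (\<integral>y. f y \<partial>lborel)"
  using assms integral_distr[of "\<lambda>y. x + y" lborel borel f] lborel_distr_plus[of x]
  by simp

lemma (in pair_sigma_finite) integrable_mult_prod:
  fixes a b :: "_ \<Rightarrow> real"
  assumes "integrable M1 a" "integrable M2 b"
  shows "integrable (M1 \<Otimes>\<^sub>M M2) (\<lambda>(x, y). a x * b y)"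
proof (rule Fubini_integrable)
  have [measurable]: "a \<in> borel_measurable M1" "b \<in> borel_measurable M2" using assms by auto
  show "(\<lambda>(x, y). a x * b y) \<in> borel_measurable (M1 \<Otimes>\<^sub>M M2)" by measurable
  show "integrable M1 (\<lambda>x. \<integral>y. norm (case (x, y) of (x, y) \<Rightarrow> a x * b y) \<partial>M2)"
    using assms by (simp add: abs_mult)
  show "AE x in M1. integrable M2 (\<lambda>y. case (x, y) of (x, y) \<Rightarrow> a x * b y)"
    using assms by simp
qed

lemma integrable_continuous_compact_support:
  fixes g :: "'a::euclidean_space \<Rightarrow> real"
  assumes "continuous_on UNIV g" "\<And>x. norm x > r \<Longrightarrow> g x = 0"
  shows "integrable lborel g"
proof -
  have "integrable lborel (\<lambda>x. indicator (cball 0 r) x *\<^sub>R g x)"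
    by (rule borel_integrable_compact) (use assms in \<open>auto intro: continuous_on_subset\<close>)
  also have "(\<lambda>x. indicator (cball 0 r) x *\<^sub>R g x) = g"
    using assms(2) by (auto simp: fun_eq_iff indicator_def not_le)
  finally show ?thesis .
qed

section \<open>The truncated operator on continuous functions with finite weighted integral\<close>

context
  fixes d :: real and f :: "'a::euclidean_space \<Rightarrow> real"
  assumes d: "DIM('a) < d"
    and f_cont: "continuous_on UNIV f"
    and f_int: "integrable lborel (\<lambda>y. f y * tail d y)"
begin

lemma d_nonneg: "d \<ge> 0"
  using d by (meson less_eq_real_def of_nat_0_le_iff order_trans)

lemma f_measurable [measurable]: "f \<in> borel_measurable borel"
  using f_cont by (rule borel_measurable_continuous_onI)

lemma abs_f_int: "integrable lborel (\<lambda>y. \<bar>f y\<bar> * tail d y)"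
  using integrable_abs[OF f_int] by (simp add: abs_mult)

lemma trunc_kernel_translate_le:
  fixes x y :: 'a
  assumes "e > 0" "norm x \<le> r"
  shows "trunc_kernel d e (x - y) \<le> (2 / min e 1) powr d * (1 + r) powr d * tail d y"
proof -
  have "tail d (x - y) \<le> (1 + norm x) powr d * tail d y" by (rule tail_translate_le[OF d_nonneg])
  also have "\<dots> \<le> (1 + r) powr d * tail d y"
    using assms d_nonneg by (intro mult_right_mono powr_mono2) auto
  finally have "(2 / min e 1) powr d * tail d (x - y) \<le> (2 / min e 1) powr d * ((1 + r) powr d * tail d y)"
    by (intro mult_left_mono) auto
  with trunc_kernel_le_tail[OF d_nonneg assms(1), of "x - y"] show ?thesis by simp
qed

lemma integrable_trunc_kernel_mult:
  assumes "e > 0"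
  shows "integrable lborel (\<lambda>y. f y * trunc_kernel d e (x - y))"
    and "integrable lborel (\<lambda>y. trunc_kernel d e (x - y))"
proof -
  define K where "K = (2 / min e 1) powr d * (1 + norm x) powr d"
  have K: "trunc_kernel d e (x - y) \<le> K * tail d y" for y
    unfolding K_def using trunc_kernel_translate_le[OF assms] by blast
  have Knn: "K \<ge> 0" by (simp add: K_def)
  show "integrable lborel (\<lambda>y. f y * trunc_kernel d e (x - y))"
  proof (rule Bochner_Integration.integrable_bound)
    show "integrable lborel (\<lambda>y. K * (\<bar>f y\<bar> * tail d y))" using abs_f_int by simp
    show "AE y in lborel. norm (f y * trunc_kernel d e (x - y)) \<le> norm (K * (\<bar>f y\<bar> * tail d y))"
      using K Knn by (intro AE_I2) (simp add: abs_mult mult.left_commute[of K] mult_left_mono)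
  qed measurable
  show "integrable lborel (\<lambda>y. trunc_kernel d e (x - y))"
  proof (rule Bochner_Integration.integrable_bound)
    show "integrable lborel (\<lambda>y::'a. K * tail d y)" using integrable_tail[OF d] by simp
    show "AE y in lborel. norm (trunc_kernel d e (x - y)) \<le> norm (K * tail d y)"
      using K Knn by (intro AE_I2) simp
  qed measurable
qed

lemma integrable_trunc_op:
  assumes "e > 0"
  shows "integrable lborel (\<lambda>y. (f x - f y) * trunc_kernel d e (x - y))"
  using integrable_trunc_kernel_mult[OF assms, of x] by (simp add: left_diff_distrib)

lemma borel_measurable_trunc_op [measurable]: "trunc_op d e f \<in> borel_measurable borel"
proof -
  have "(\<lambda>x. \<integral>y. (f x - f y) * trunc_kernel d e (x - y) \<partial>lborel) \<in> borel_measurable borel"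
    by measurable
  then show ?thesis by (simp add: trunc_op_def[abs_def])
qed

text \<open>The integrand is P (x, y) + P (y, x), where \<open>P\<close> carries the factor
  \<open>g x\<close> only. Truncation and the compact support of \<open>g\<close> make
  \<open>P\<close> absolutely integrable on the product, so by Fubini the two halves have the same
  integral, namely the pairing of \<open>g\<close> with \<open>trunc_op\<close>.\<close>

lemma trunc_op_energy:
  fixes g :: "'a \<Rightarrow> real"
  assumes e: "e > 0" and g: "continuous_on UNIV g" "\<And>x. norm x > r \<Longrightarrow> g x = 0"
  shows "integrable (lborel \<Otimes>\<^sub>M lborel) (\<lambda>(x, y). (f x - f y) * (g x - g y) * trunc_kernel d e (x - y))"
    and "(\<integral>z. (case z of (x, y) \<Rightarrow> (f x - f y) * (g x - g y) * trunc_kernel d e (x - y)) \<partial>(lborel \<Otimes>\<^sub>M lborel))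
      = 2 * (\<integral>x. g x * trunc_op d e f x \<partial>lborel)"
proof -
  have [measurable]: "g \<in> borel_measurable borel" using g(1) by (rule borel_measurable_continuous_onI)
  define r' where "r' = max r 0"
  define P where "P = (\<lambda>(x, y). (f x - f y) * g x * trunc_kernel d e (x - y))"
  define K where "K = (2 / min e 1) powr d * (1 + r') powr d"
  have Knn: "K \<ge> 0" by (simp add: K_def)
  have g_int: "integrable lborel (\<lambda>x. \<bar>g x\<bar>)" "integrable lborel (\<lambda>x. \<bar>f x * g x\<bar>)"
    using f_cont g by (auto intro!: integrable_continuous_compact_support[where r=r] continuous_intros)
  have P_int: "integrable (lborel \<Otimes>\<^sub>M lborel) P"
  proof (rule Bochner_Integration.integrable_bound)
    show "integrable (lborel \<Otimes>\<^sub>M lborel)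
        (\<lambda>z. K * ((case z of (x, y) \<Rightarrow> \<bar>f x * g x\<bar> * tail d y) + (case z of (x, y) \<Rightarrow> \<bar>g x\<bar> * (\<bar>f y\<bar> * tail d y))))"
      by (intro integrable_mult_right Bochner_Integration.integrable_add
          lborel_pair.integrable_mult_prod g_int abs_f_int integrable_tail d)
    show "P \<in> borel_measurable (lborel \<Otimes>\<^sub>M lborel)" unfolding P_def by measurable
    have "norm (P (x, y)) \<le> norm (K * (\<bar>f x * g x\<bar> * tail d y + \<bar>g x\<bar> * (\<bar>f y\<bar> * tail d y)))" for x y
    proof (cases "norm x \<le> r")
      case True
      have "norm (P (x, y)) = \<bar>f x - f y\<bar> * \<bar>g x\<bar> * trunc_kernel d e (x - y)"
        by (simp add: P_def abs_mult)
      also have "\<dots> \<le> (\<bar>f x\<bar> + \<bar>f y\<bar>) * \<bar>g x\<bar> * (K * tail d y)"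
        using trunc_kernel_translate_le[OF e, of x r' y] True unfolding K_def
        by (intro mult_mono mult_right_mono abs_triangle_ineq4) (auto simp: r'_def)
      also have "\<dots> = K * (\<bar>f x * g x\<bar> * tail d y + \<bar>g x\<bar> * (\<bar>f y\<bar> * tail d y))"
        by (simp add: abs_mult algebra_simps)
      finally show ?thesis by simp
    qed (use g(2) in \<open>simp add: P_def\<close>)
    then show "AE z in lborel \<Otimes>\<^sub>M lborel. norm (P z) \<le> norm (K * ((case z of (x, y) \<Rightarrow> \<bar>f x * g x\<bar> * tail d y) + (case z of (x, y) \<Rightarrow> \<bar>g x\<bar> * (\<bar>f y\<bar> * tail d y))))"
      by (intro AE_I2) (auto split: prod.splits)
  qed
  have swap_int: "integrable (lborel \<Otimes>\<^sub>M lborel) (\<lambda>(x, y). P (y, x))"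
    using lborel_pair.integrable_product_swap[OF P_int] .
  have eq: "(\<lambda>(x, y). (f x - f y) * (g x - g y) * trunc_kernel d e (x - y))
      = (\<lambda>z. P z + (case z of (x, y) \<Rightarrow> P (y, x)))"
    by (auto simp: P_def fun_eq_iff trunc_kernel_commute[of d e "_" "_"] algebra_simps)
  show "integrable (lborel \<Otimes>\<^sub>M lborel) (\<lambda>(x, y). (f x - f y) * (g x - g y) * trunc_kernel d e (x - y))"
    unfolding eq using P_int swap_int by (rule Bochner_Integration.integrable_add)
  have "(\<integral>x. g x * trunc_op d e f x \<partial>lborel) = (\<integral>x. (\<integral>y. P (x, y) \<partial>lborel) \<partial>lborel)"
    unfolding trunc_op_def P_def
    by (simp add: integral_mult_right_zero[symmetric] mult_ac del: integral_mult_right_zero)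
  also have "\<dots> = (\<integral>z. P z \<partial>(lborel \<Otimes>\<^sub>M lborel))"
    using lborel_pair.integral_fst'[OF P_int] .
  finally have 1: "(\<integral>z. P z \<partial>(lborel \<Otimes>\<^sub>M lborel)) = (\<integral>x. g x * trunc_op d e f x \<partial>lborel)" by simp
  have "P \<in> borel_measurable (lborel \<Otimes>\<^sub>M lborel)" using P_int by simp
  then have 2: "(\<integral>z. (case z of (x, y) \<Rightarrow> P (y, x)) \<partial>(lborel \<Otimes>\<^sub>M lborel)) = (\<integral>z. P z \<partial>(lborel \<Otimes>\<^sub>M lborel))"
    by (rule lborel_pair.integral_product_swap)
  show "(\<integral>z. (case z of (x, y) \<Rightarrow> (f x - f y) * (g x - g y) * trunc_kernel d e (x - y)) \<partial>(lborel \<Otimes>\<^sub>M lborel))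
      = 2 * (\<integral>x. g x * trunc_op d e f x \<partial>lborel)"
    unfolding eq using P_int swap_int 1 2 by (subst Bochner_Integration.integral_add) auto
qed

text \<open>Averaging over z and -z replaces the first difference of \<open>f\<close> by a second
  difference. Near 0 it is of order |z|^\<tau> with \<tau> > d - DIM('a), which makes the bound
  uniform in \<open>e\<close>; away from 0 the decay of the kernel and the weighted integrability of
  \<open>f\<close> suffice.\<close>

lemma trunc_op_locally_bounded:
  assumes \<tau>: "d - DIM('a) < \<tau>"
    and sd: "\<And>x z. \<lbrakk>norm x \<le> r; norm z \<le> 1\<rbrakk> \<Longrightarrow> \<bar>2 * f x - f (x + z) - f (x - z)\<bar> \<le> C * norm z powr \<tau>"
    and r: "r \<ge> 0"
  obtains B where "\<And>e x. \<lbrakk>e > 0; norm x \<le> r\<rbrakk> \<Longrightarrow> \<bar>trunc_op d e f x\<bar> \<le> B"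
proof -
  define a where "a = max 0 (d - \<tau>)"
  have a: "0 \<le> a" "a < DIM('a)" using \<tau> DIM_positive[where 'a='a] by (auto simp: a_def)
  define near where "near z = indicator (cball 0 1) z * norm z powr (- a)" for z :: 'a
  have near_nn: "near z \<ge> 0" for z by (simp add: near_def)
  have [measurable]: "near \<in> borel_measurable borel"
    unfolding near_def
    by (rule borel_measurable_times[OF borel_measurable_indicator[OF borel_closed[OF closed_cball]]])
      measurable
  have near_int: "integrable lborel near"
    using nn_integral_norm_powr_cball_finite[OF a] near_nn
    by (intro integrableI_bounded) (auto simp: near_def)
  obtain F where F: "\<And>x. norm x \<le> r \<Longrightarrow> \<bar>f x\<bar> \<le> F"
  proof -
    have "compact (f ` cball 0 r)"
      by (intro compact_continuous_image continuous_on_subset[OF f_cont]) auto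
    then obtain F where "\<forall>y\<in>f ` cball 0 r. norm y \<le> F"
      using compact_imp_bounded bounded_iff by metis
    then show thesis using that[of F] by auto
  qed
  define C' where "C' = \<bar>C\<bar>"
  define K where "K = (1 + r) powr d"
  \<comment> \<open>A dominating function for the symmetrised integrand, in which each far value of
    \<open>f\<close> carries the tail at its own point \<open>x + z\<close> or \<open>x - z\<close>.
    By translation invariance its integral \<open>B\<close> does not depend on
    \<open>x\<close>.\<close>
  define bd where "bd x z = C' * near z
      + (2 powr d * (2 * F) * tail d z + (2 powr d * K * (\<bar>f (x + z)\<bar> * tail d (x + z))
      + 2 powr d * K * (\<bar>f (x - z)\<bar> * tail d (x - z))))" for x z
  have bd_int: "integrable lborel (bd x)" for x
    unfolding bd_def
    by (intro Bochner_Integration.integrable_add integrable_mult_right near_int integrable_tail d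
        integrable_lborel_plus[OF abs_f_int] integrable_lborel_minus[OF abs_f_int])
  define A where "A = (\<integral>y. \<bar>f y\<bar> * tail d y \<partial>lborel)"
  define B where "B = C' * (\<integral>z. near z \<partial>lborel) + (2 powr d * (2 * F) * (\<integral>z. tail d (z::'a) \<partial>lborel)
      + (2 powr d * K * A + 2 powr d * K * A))"
  have bd_integral: "(\<integral>z. bd x z \<partial>lborel) = B" for x
  proof -
    have "(\<integral>z. \<bar>f (x + z)\<bar> * tail d (x + z) \<partial>lborel) = A" "(\<integral>z. \<bar>f (x - z)\<bar> * tail d (x - z) \<partial>lborel) = A"
      using integral_lborel_plus[of "\<lambda>y. \<bar>f y\<bar> * tail d y" x] integral_lborel_minus[of "\<lambda>y. \<bar>f y\<bar> * tail d y" x]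
      by (auto simp: A_def)
    then show ?thesis
      unfolding bd_def B_def
      using near_int integrable_tail[OF d] integrable_lborel_plus[OF abs_f_int, of x] integrable_lborel_minus[OF abs_f_int, of x]
      by (simp del: integral_mult_right_zero add: integral_mult_right)
  qed
  have "\<bar>trunc_op d e f x\<bar> \<le> B" if e: "e > 0" and x: "norm x \<le> r" for e x
  proof -
    let ?S = "\<lambda>y. (f x - f y) * trunc_kernel d e (x - y)"
    have S: "integrable lborel ?S" using integrable_trunc_op[OF e] .
    have [measurable]: "?S \<in> borel_measurable borel" using S by simp
    have "trunc_op d e f x = (\<integral>z. ?S (x - z) \<partial>lborel)" "trunc_op d e f x = (\<integral>z. ?S (x + z) \<partial>lborel)"
      unfolding trunc_op_def by (subst integral_lborel_minus integral_lborel_plus; simp)+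
    moreover have "integrable lborel (\<lambda>z. ?S (x - z))" "integrable lborel (\<lambda>z. ?S (x + z))"
      by (rule integrable_lborel_minus[OF S] integrable_lborel_plus[OF S])+
    ultimately have tw: "2 * trunc_op d e f x = (\<integral>z. ?S (x - z) + ?S (x + z) \<partial>lborel)"
      and tw_int: "integrable lborel (\<lambda>z. ?S (x - z) + ?S (x + z))" by simp_all
    have eq: "?S (x - z) + ?S (x + z) = (2 * f x - f (x + z) - f (x - z)) * trunc_kernel d e z" for z
      by (simp add: algebra_simps)
    have pw: "\<bar>(2 * f x - f (x + z) - f (x - z)) * trunc_kernel d e z\<bar> \<le> bd x z" for z
    proof (cases "norm z \<le> 1")
      case True
      have Fnn: "F \<ge> 0" using F[OF x] by simp
      have "\<bar>(2 * f x - f (x + z) - f (x - z)) * trunc_kernel d e z\<bar>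
          \<le> (C * norm z powr \<tau>) * norm z powr (- d)"
        unfolding abs_mult using sd[OF x True] trunc_kernel_le[of d e z]
        by (intro mult_mono) auto
      also have "\<dots> \<le> C' * (norm z powr \<tau> * norm z powr (- d))"
        unfolding C'_def mult.assoc by (intro mult_right_mono) auto
      also have "norm z powr \<tau> * norm z powr (- d) \<le> near z"
      proof (cases "z = 0")
        case False
        then show ?thesis using True unfolding near_def a_def powr_add[symmetric]
          by (auto intro!: powr_mono')
      qed (simp add: near_def)
      then have "C' * (norm z powr \<tau> * norm z powr (- d)) \<le> C' * near z"
        by (intro mult_left_mono) (auto simp: C'_def)
      also have "\<dots> \<le> bd x z" unfolding bd_def using Fnn by (simp add: K_def)
      finally show ?thesis .
    next
      case False
      have t: "tail d z \<le> K * tail d y" if "y = x + z \<or> y = x - z" for y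
      proof -
        have "norm (x - y) = norm z" using that by auto
        then have "tail d z \<le> (1 + norm x) powr d * tail d y"
          using tail_translate_le[OF d_nonneg, of x y] by simp
        also have "\<dots> \<le> K * tail d y"
          unfolding K_def using x d_nonneg by (intro mult_right_mono powr_mono2) auto
        finally show ?thesis .
      qed
      have kz: "trunc_kernel d e z \<le> 2 powr d * tail d z"
        using trunc_kernel_le[of d e z] norm_powr_le_tail[OF d_nonneg, of 1 z] False by simp
      have "\<bar>(2 * f x - f (x + z) - f (x - z)) * trunc_kernel d e z\<bar>
          \<le> (2 * F + \<bar>f (x + z)\<bar> + \<bar>f (x - z)\<bar>) * (2 powr d * tail d z)"
        unfolding abs_mult using F[OF x] kz by (intro mult_mono) auto
      also have "\<dots> = 2 powr d * (2 * F) * tail d z + (2 powr d * (\<bar>f (x + z)\<bar> * tail d z) + 2 powr d * (\<bar>f (x - z)\<bar> * tail d z))"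
        by (simp add: algebra_simps)
      also have "\<dots> \<le> 2 powr d * (2 * F) * tail d z + (2 powr d * (\<bar>f (x + z)\<bar> * (K * tail d (x + z))) + 2 powr d * (\<bar>f (x - z)\<bar> * (K * tail d (x - z))))"
        using t F[OF x] by (intro add_mono mult_left_mono) auto
      also have "\<dots> \<le> bd x z" unfolding bd_def using near_nn[of z] by (simp add: C'_def mult_ac)
      finally show ?thesis .
    qed
    have "\<bar>2 * trunc_op d e f x\<bar> \<le> (\<integral>z. \<bar>?S (x - z) + ?S (x + z)\<bar> \<partial>lborel)"
      unfolding tw by (rule integral_abs_bound)
    also have "\<dots> \<le> (\<integral>z. bd x z \<partial>lborel)"
      using tw_int bd_int[of x] pw unfolding eq by (intro integral_mono) auto
    finally have "\<bar>2 * trunc_op d e f x\<bar> \<le> B" by (simp only: bd_integral)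
    then show ?thesis by simp
  qed
  then show thesis by (rule that)
qed

end

text \<open>
  The normalising constant of the fractional Laplacian is left out here; the local bound on the
  truncations is what dominated convergence needs.
\<close>

definition frac_rep :: "real \<Rightarrow> ('a::euclidean_space \<Rightarrow> real) \<Rightarrow> ('a \<Rightarrow> real) \<Rightarrow> bool" where
  "frac_rep d f F \<longleftrightarrow>
     continuous_on UNIV f \<and> integrable lborel (\<lambda>y. f y * tail d y) \<and>
     (\<forall>r. \<exists>B. \<forall>e>0. \<forall>x. norm x \<le> r \<longrightarrow> \<bar>trunc_op d e f x\<bar> \<le> B) \<and>
     (\<forall>x. ((\<lambda>e. trunc_op d e f x) \<longlongrightarrow> F x) (at_right 0))"

lemma frac_rep_add:
  fixes f g :: "'a::euclidean_space \<Rightarrow> real" and d :: real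
  assumes d: "DIM('a) < d" and f: "frac_rep d f F" and g: "frac_rep d g G"
  shows "frac_rep d (\<lambda>x. f x + g x) (\<lambda>x. F x + G x)"
proof -
  have c: "continuous_on UNIV f" "continuous_on UNIV g"
    and i: "integrable lborel (\<lambda>y. f y * tail d y)" "integrable lborel (\<lambda>y. g y * tail d y)"
    using f g by (auto simp: frac_rep_def)
  have eq: "trunc_op d e (\<lambda>x. f x + g x) x = trunc_op d e f x + trunc_op d e g x" if "e > 0" for e x
  proof -
    have "(\<integral>y. (f x - f y) * trunc_kernel d e (x - y) + (g x - g y) * trunc_kernel d e (x - y) \<partial>lborel)
        = trunc_op d e f x + trunc_op d e g x"
      unfolding trunc_op_def
      by (intro Bochner_Integration.integral_add integrable_trunc_op d c i that)
    then show ?thesis unfolding trunc_op_def by (simp add: algebra_simps)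
  qed
  have "\<exists>B. \<forall>e>0. \<forall>x. norm x \<le> r \<longrightarrow> \<bar>trunc_op d e (\<lambda>x. f x + g x) x\<bar> \<le> B" for r
  proof -
    obtain A B where "\<forall>e>0. \<forall>x. norm x \<le> r \<longrightarrow> \<bar>trunc_op d e f x\<bar> \<le> A"
      "\<forall>e>0. \<forall>x. norm x \<le> r \<longrightarrow> \<bar>trunc_op d e g x\<bar> \<le> B"
      using f g unfolding frac_rep_def by meson
    then have "\<forall>e>0. \<forall>x. norm x \<le> r \<longrightarrow> \<bar>trunc_op d e (\<lambda>x. f x + g x) x\<bar> \<le> A + B"
      by (auto simp: eq intro!: order_trans[OF abs_triangle_ineq] add_mono)
    then show ?thesis ..
  qed
  moreover have "((\<lambda>e. trunc_op d e (\<lambda>x. f x + g x) x) \<longlongrightarrow> F x + G x) (at_right 0)" for x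
  proof (rule Lim_transform_eventually)
    show "((\<lambda>e. trunc_op d e f x + trunc_op d e g x) \<longlongrightarrow> F x + G x) (at_right 0)"
      using f g by (intro tendsto_add) (auto simp: frac_rep_def)
    show "\<forall>\<^sub>F e in at_right 0. trunc_op d e f x + trunc_op d e g x = trunc_op d e (\<lambda>x. f x + g x) x"
      using eventually_at_right_less[of "0::real"] by eventually_elim (simp add: eq)
  qed
  ultimately show ?thesis
    using c i by (auto simp: frac_rep_def distrib_right intro!: continuous_intros)
qed

text \<open>On the support of \<open>g\<close> the truncations are bounded uniformly in the radius,
  so dominated convergence takes the limit under the integral. The radii 1 / (n + 1) turn the
  one-sided limit into a sequence.\<close>

lemma frac_rep_pairing:
  fixes f :: "'a::euclidean_space \<Rightarrow> real" and d :: real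
  assumes d: "DIM('a) < d" and f: "frac_rep d f F"
    and g: "continuous_on UNIV g" "\<And>x. norm x > r \<Longrightarrow> g x = 0"
  shows "integrable lborel (\<lambda>x. g x * F x)"
    and "(\<lambda>n. \<integral>x. g x * trunc_op d (1 / real (Suc n)) f x \<partial>lborel) \<longlonglongrightarrow> (\<integral>x. g x * F x \<partial>lborel)"
proof -
  have c: "continuous_on UNIV f" and i: "integrable lborel (\<lambda>y. f y * tail d y)"
    using f by (auto simp: frac_rep_def)
  note [measurable] = borel_measurable_trunc_op[OF d c i] borel_measurable_continuous_onI[OF g(1)]
  obtain B where B: "\<And>e x. \<lbrakk>e > 0; norm x \<le> r\<rbrakk> \<Longrightarrow> \<bar>trunc_op d e f x\<bar> \<le> B"
    using f unfolding frac_rep_def by meson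
  have fl: "filterlim (\<lambda>n. 1 / real (Suc n)) (at_right 0) sequentially"
    using LIMSEQ_inverse_real_of_nat
    by (auto simp: filterlim_at inverse_eq_divide intro!: always_eventually)
  have lim: "(\<lambda>n. trunc_op d (1 / real (Suc n)) f x) \<longlonglongrightarrow> F x" for x
    using filterlim_compose[OF _ fl] f unfolding frac_rep_def by blast
  have [measurable]: "F \<in> borel_measurable borel"
    by (rule borel_measurable_LIMSEQ_real[OF lim]) auto
  have w: "integrable lborel (\<lambda>x. B * \<bar>g x\<bar>)"
    using g by (intro integrable_mult_right integrable_abs integrable_continuous_compact_support[where r=r]) auto
  have bd: "AE x in lborel. norm (g x * trunc_op d (1 / real (Suc n)) f x) \<le> B * \<bar>g x\<bar>" for n
  proof (intro AE_I2)
    fix x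
    show "norm (g x * trunc_op d (1 / real (Suc n)) f x) \<le> B * \<bar>g x\<bar>"
    proof (cases "norm x \<le> r")
      case True
      then have "\<bar>g x\<bar> * \<bar>trunc_op d (1 / real (Suc n)) f x\<bar> \<le> \<bar>g x\<bar> * B"
        by (intro mult_left_mono B) auto
      then show ?thesis by (simp add: abs_mult mult.commute)
    qed (use g(2)[of x] in simp)
  qed
  have lim': "AE x in lborel. (\<lambda>n. g x * trunc_op d (1 / real (Suc n)) f x) \<longlonglongrightarrow> g x * F x"
    by (intro AE_I2 tendsto_mult tendsto_const lim)
  show "integrable lborel (\<lambda>x. g x * F x)"
    by (rule integrable_dominated_convergence[OF _ _ w lim' bd]) auto
  show "(\<lambda>n. \<integral>x. g x * trunc_op d (1 / real (Suc n)) f x \<partial>lborel) \<longlonglongrightarrow> (\<integral>x. g x * F x \<partial>lborel)"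
    by (rule integral_dominated_convergence[OF _ _ w lim' bd]) auto
qed

text \<open>Transfers a pointwise inequality between products of differences to the two equations:
  it is integrated against the truncated kernel, where \<open>trunc_op_energy\<close> turns both
  products into pairings, and then the radius tends to 0.\<close>

lemma energy_comparison:
  fixes f1 f2 :: "'a::euclidean_space \<Rightarrow> real" and d :: real
  assumes d: "DIM('a) < d" and f1: "frac_rep d f1 F1" and f2: "frac_rep d f2 F2"
    and g1: "continuous_on UNIV g1" "\<And>x. norm x > r \<Longrightarrow> g1 x = 0"
    and g2: "continuous_on UNIV g2" "\<And>x. norm x > r \<Longrightarrow> g2 x = 0"
    and [measurable]: "H \<in> borel_measurable borel" "\<eta> \<in> borel_measurable borel"
    and H: "\<And>x. H x \<ge> 0"
    and pw: "\<And>x y. (f1 x - f1 y) * (g1 x - g1 y)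
      \<le> K * ((f2 x - f2 y) * (g2 x - g2 y)) + (H x + H y) * (\<eta> x - \<eta> y)\<^sup>2"
    and B: "B \<ge> 0"
      "(\<integral>\<^sup>+x. ennreal (H x) * (\<integral>\<^sup>+y. ennreal ((\<eta> x - \<eta> y)\<^sup>2 * norm (x - y) powr (- d)) \<partial>lborel) \<partial>lborel) \<le> ennreal B"
  shows "(\<integral>x. g1 x * F1 x \<partial>lborel) \<le> K * (\<integral>x. g2 x * F2 x \<partial>lborel) + B"
proof -
  have c: "continuous_on UNIV f1" "continuous_on UNIV f2"
    and i: "integrable lborel (\<lambda>y. f1 y * tail d y)" "integrable lborel (\<lambda>y. f2 y * tail d y)"
    using f1 f2 by (auto simp: frac_rep_def)
  let ?LL = "lborel \<Otimes>\<^sub>M lborel :: ('a \<times> 'a) measure"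
  \<comment> \<open>The error term uses the full kernel, so that the bound \<open>B\<close> serves
    all truncation radii.\<close>
  define G0 where "G0 = (\<lambda>(x, y). ennreal (H x * ((\<eta> x - \<eta> y)\<^sup>2 * norm (x - y) powr (- d))))"
  have [measurable]: "G0 \<in> borel_measurable ?LL" unfolding G0_def by measurable
  have G0_int: "(\<integral>\<^sup>+z. G0 z \<partial>?LL) \<le> ennreal B"
  proof -
    have "(\<integral>\<^sup>+z. G0 z \<partial>?LL) = (\<integral>\<^sup>+x. (\<integral>\<^sup>+y. G0 (x, y) \<partial>lborel) \<partial>lborel)"
      by (rule lborel.nn_integral_fst[symmetric]) measurable
    also have "\<dots> = (\<integral>\<^sup>+x. ennreal (H x) * (\<integral>\<^sup>+y. ennreal ((\<eta> x - \<eta> y)\<^sup>2 * norm (x - y) powr (- d)) \<partial>lborel) \<partial>lborel)"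
      using H by (simp add: G0_def ennreal_mult' nn_integral_cmult)
    finally show ?thesis using B by simp
  qed
  have G0_swap: "(\<integral>\<^sup>+z. (case z of (x, y) \<Rightarrow> G0 (y, x)) \<partial>?LL) \<le> ennreal B"
  proof -
    have "(\<integral>\<^sup>+z. (case z of (x, y) \<Rightarrow> G0 (y, x)) \<partial>?LL) = (\<integral>\<^sup>+x. (\<integral>\<^sup>+y. G0 (y, x) \<partial>lborel) \<partial>lborel)"
      by (subst lborel.nn_integral_fst[symmetric]) auto
    also have "\<dots> = (\<integral>\<^sup>+z. G0 z \<partial>?LL)"
      by (rule lborel_pair.nn_integral_snd) measurable
    finally show ?thesis using G0_int by simp
  qed
  have step: "(\<integral>x. g1 x * trunc_op d (1 / real (Suc n)) f1 x \<partial>lborel)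
      \<le> K * (\<integral>x. g2 x * trunc_op d (1 / real (Suc n)) f2 x \<partial>lborel) + B" for n
  proof -
    define e where "e = 1 / real (Suc n)"
    have e: "e > 0" by (simp add: e_def)
    define J where "J f g = (\<lambda>(x, y). (f x - f y) * (g x - g y) * trunc_kernel d e (x - y))"
      for f g :: "'a \<Rightarrow> real"
    have J: "integrable ?LL (J f1 g1)" "(\<integral>z. J f1 g1 z \<partial>?LL) = 2 * (\<integral>x. g1 x * trunc_op d e f1 x \<partial>lborel)"
      "integrable ?LL (J f2 g2)" "(\<integral>z. J f2 g2 z \<partial>?LL) = 2 * (\<integral>x. g2 x * trunc_op d e f2 x \<partial>lborel)"
      using trunc_op_energy[OF d c(1) i(1) e g1] trunc_op_energy[OF d c(2) i(2) e g2] unfolding J_def by auto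
    have "ennreal (J f1 g1 z - K * J f2 g2 z) \<le> G0 z + (case z of (x, y) \<Rightarrow> G0 (y, x))" for z
    proof (cases z)
      case (Pair x y)
      have "J f1 g1 z - K * J f2 g2 z
          = ((f1 x - f1 y) * (g1 x - g1 y) - K * ((f2 x - f2 y) * (g2 x - g2 y))) * trunc_kernel d e (x - y)"
        by (simp add: J_def Pair algebra_simps)
      also have "\<dots> \<le> ((H x + H y) * (\<eta> x - \<eta> y)\<^sup>2) * trunc_kernel d e (x - y)"
        using pw[of x y] by (intro mult_right_mono) auto
      also have "\<dots> \<le> ((H x + H y) * (\<eta> x - \<eta> y)\<^sup>2) * norm (x - y) powr (- d)"
        using H by (intro mult_left_mono trunc_kernel_le) auto
      also have "\<dots> = H x * ((\<eta> x - \<eta> y)\<^sup>2 * norm (x - y) powr (- d)) + H y * ((\<eta> y - \<eta> x)\<^sup>2 * norm (y - x) powr (- d))"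
        by (simp add: power2_commute[of "\<eta> y"] norm_minus_commute[of y] algebra_simps)
      finally have "ennreal (J f1 g1 z - K * J f2 g2 z)
          \<le> ennreal (H x * ((\<eta> x - \<eta> y)\<^sup>2 * norm (x - y) powr (- d)) + H y * ((\<eta> y - \<eta> x)\<^sup>2 * norm (y - x) powr (- d)))"
        by (rule ennreal_leI)
      then show ?thesis using H by (simp add: G0_def Pair ennreal_plus)
    qed
    then have "(\<integral>\<^sup>+z. ennreal (J f1 g1 z - K * J f2 g2 z) \<partial>?LL)
        \<le> (\<integral>\<^sup>+z. G0 z + (case z of (x, y) \<Rightarrow> G0 (y, x)) \<partial>?LL)"
      by (intro nn_integral_mono)
    also have "\<dots> = (\<integral>\<^sup>+z. G0 z \<partial>?LL) + (\<integral>\<^sup>+z. (case z of (x, y) \<Rightarrow> G0 (y, x)) \<partial>?LL)"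
      by (intro nn_integral_add) auto
    \<comment> \<open>\<open>H x\<close> and \<open>H y\<close> obey the same bound by symmetry, and
      the resulting 2 cancels against the factor 2 of \<open>trunc_op_energy\<close>.\<close>
    also have "\<dots> \<le> ennreal (2 * B)"
      using add_mono[OF G0_int G0_swap] B(1) by (simp flip: ennreal_plus)
    finally have "(\<integral>z. J f1 g1 z - K * J f2 g2 z \<partial>?LL) \<le> 2 * B"
      using B(1) by (intro integral_real_bounded) auto
    then show ?thesis using J unfolding e_def[symmetric] by simp
  qed
  show ?thesis
  proof (rule LIMSEQ_le)
    show "(\<lambda>n. \<integral>x. g1 x * trunc_op d (1 / real (Suc n)) f1 x \<partial>lborel) \<longlonglongrightarrow> (\<integral>x. g1 x * F1 x \<partial>lborel)"
      by (rule frac_rep_pairing(2)[OF d f1 g1])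
    show "(\<lambda>n. K * (\<integral>x. g2 x * trunc_op d (1 / real (Suc n)) f2 x \<partial>lborel) + B)
        \<longlonglongrightarrow> K * (\<integral>x. g2 x * F2 x \<partial>lborel) + B"
      by (intro tendsto_intros frac_rep_pairing(2)[OF d f2 g2])
  qed (use step in blast)
qed

section \<open>Regularity\<close>

lemma holder_loc_imp_continuous:
  fixes u :: "real ^ 'n \<Rightarrow> real"
  assumes "holder_loc k \<beta> u"
  shows "continuous_on UNIV u"
proof (cases k)
  case (Suc m)
  with assms have "\<forall>x. u differentiable (at x)" by simp
  then show ?thesis
    by (intro differentiable_imp_continuous_on) (auto simp: differentiable_on_def)
qed (use assms in simp)

lemma frechet_derivative_component_sum:
  fixes v :: "'a::euclidean_space \<Rightarrow> real"
  assumes "v differentiable (at x)"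
  shows "frechet_derivative v (at x) h = (\<Sum>e\<in>Basis. (h \<bullet> e) * frechet_derivative v (at x) e)"
proof -
  have lin: "linear (frechet_derivative v (at x))"
    using assms by (rule linear_frechet_derivative)
  have "frechet_derivative v (at x) h = frechet_derivative v (at x) (\<Sum>e\<in>Basis. (h \<bullet> e) *\<^sub>R e)"
    by (simp add: euclidean_representation)
  also have "\<dots> = (\<Sum>e\<in>Basis. (h \<bullet> e) * frechet_derivative v (at x) e)"
    by (simp add: linear_sum[OF lin] linear_scale[OF lin])
  finally show ?thesis .
qed

text \<open>Continuous partial derivatives are bounded on the compact ball, and the sum of their
  bounds controls the operator norm of the derivative; convexity of the ball then gives the mean
  value inequality.\<close>

lemma C1_imp_lipschitz_on_cball:
  fixes v :: "'a::euclidean_space \<Rightarrow> real"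
  assumes diff: "\<And>x. v differentiable (at x)"
    and cont: "\<And>e. e \<in> Basis \<Longrightarrow> continuous_on UNIV (\<lambda>x. frechet_derivative v (at x) e)"
  obtains C where "\<And>x y. \<lbrakk>x \<in> cball 0 r; y \<in> cball 0 r\<rbrakk> \<Longrightarrow> \<bar>v x - v y\<bar> \<le> C * norm (x - y)"
proof -
  have "\<exists>B. \<forall>x\<in>cball 0 r. \<bar>frechet_derivative v (at x) e\<bar> \<le> B" if "e \<in> Basis" for e
  proof -
    have "compact ((\<lambda>x. frechet_derivative v (at x) e) ` cball 0 r)"
      by (intro compact_continuous_image continuous_on_subset[OF cont[OF that]]) auto
    from compact_imp_bounded[OF this] show ?thesis unfolding bounded_iff by auto
  qed
  then have "\<forall>e\<in>Basis. \<exists>B. \<forall>x\<in>cball 0 r. \<bar>frechet_derivative v (at x) e\<bar> \<le> B" by blast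
  from bchoice[OF this]
  obtain B where B': "\<forall>e\<in>Basis. \<forall>x\<in>cball 0 r. \<bar>frechet_derivative v (at x) e\<bar> \<le> B e" ..
  have B: "\<bar>frechet_derivative v (at x) e\<bar> \<le> B e" if "e \<in> Basis" "x \<in> cball 0 r" for e x
    by (rule bspec[OF bspec[OF B' that(1)] that(2)])
  show thesis
  proof (rule that)
    fix x y :: 'a assume xy: "x \<in> cball 0 r" "y \<in> cball 0 r"
    have "norm (v x - v y) \<le> (\<Sum>e\<in>Basis. B e) * norm (x - y)"
    proof (rule differentiable_bound[where S = "cball 0 r" and f = v and f' = "\<lambda>z. frechet_derivative v (at z)"])
      fix z :: 'a assume z: "z \<in> cball 0 r"
      show "(v has_derivative frechet_derivative v (at z)) (at z within cball 0 r)"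
        by (rule has_derivative_at_withinI, rule frechet_derivative_works[THEN iffD1, OF diff])
      have "norm (frechet_derivative v (at z) h) \<le> (\<Sum>e\<in>Basis. B e) * norm h" for h
      proof -
        have "norm (frechet_derivative v (at z) h) = \<bar>\<Sum>e\<in>Basis. (h \<bullet> e) * frechet_derivative v (at z) e\<bar>"
          by (subst frechet_derivative_component_sum[OF diff]) (rule real_norm_def)
        also have "\<dots> \<le> (\<Sum>e\<in>Basis. \<bar>(h \<bullet> e) * frechet_derivative v (at z) e\<bar>)"
          by (rule sum_abs)
        also have "\<dots> \<le> (\<Sum>e\<in>Basis. norm h * B e)"
          unfolding abs_mult using B[OF _ z] by (intro sum_mono mult_mono Basis_le_norm) auto
        finally show ?thesis by (simp only: sum_distrib_left mult.commute)
      qed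
      then show "onorm (frechet_derivative v (at z)) \<le> (\<Sum>e\<in>Basis. B e)"
        by (intro onorm_le)
    qed (use xy in auto)
    then show "\<bar>v x - v y\<bar> \<le> (\<Sum>e\<in>Basis. B e) * norm (x - y)" by simp
  qed
qed

text \<open>The mean value theorem for u (x + t z) + u (x - t z) as a function of t leaves a
  difference of gradients at two points at distance at most 2 |z|, applied to \<open>z\<close>. The
  Hoelder bound gives |z|^\<beta>, the direction one more power. The radius r + 1 keeps both points
  in the ball.\<close>

lemma holder_gradient_imp_second_difference:
  fixes u :: "'a::euclidean_space \<Rightarrow> real"
  assumes diff: "\<And>x. u differentiable (at x)"
    and hol: "\<And>e. e \<in> Basis \<Longrightarrow> \<exists>C. \<forall>x\<in>cball 0 (r + 1). \<forall>y\<in>cball 0 (r + 1).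
      \<bar>frechet_derivative u (at x) e - frechet_derivative u (at y) e\<bar> \<le> C * norm (x - y) powr \<beta>"
    and \<beta>: "\<beta> \<ge> 0"
  obtains C where "\<And>x z. \<lbrakk>norm x \<le> r; norm z \<le> 1\<rbrakk> \<Longrightarrow>
      \<bar>2 * u x - u (x + z) - u (x - z)\<bar> \<le> C * norm z powr (1 + \<beta>)"
proof -
  have "\<forall>e\<in>Basis. \<exists>C. \<forall>x\<in>cball 0 (r + 1). \<forall>y\<in>cball 0 (r + 1).
      \<bar>frechet_derivative u (at x) e - frechet_derivative u (at y) e\<bar> \<le> C * norm (x - y) powr \<beta>"
    using hol by blast
  from bchoice[OF this] obtain C where C': "\<forall>e\<in>Basis. \<forall>x\<in>cball 0 (r + 1). \<forall>y\<in>cball 0 (r + 1).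
      \<bar>frechet_derivative u (at x) e - frechet_derivative u (at y) e\<bar> \<le> C e * norm (x - y) powr \<beta>" ..
  have C: "\<bar>frechet_derivative u (at x) e - frechet_derivative u (at y) e\<bar> \<le> C e * norm (x - y) powr \<beta>"
    if "e \<in> Basis" "x \<in> cball 0 (r + 1)" "y \<in> cball 0 (r + 1)" for e x y
    by (rule bspec[OF bspec[OF bspec[OF C' that(1)] that(2)] that(3)])
  show thesis
  proof (rule that)
    fix x z :: 'a assume x: "norm x \<le> r" and z: "norm z \<le> 1"
    let ?D = "\<lambda>y. frechet_derivative u (at y)"
    define \<phi> where "\<phi> t = u (x + t *\<^sub>R z) + u (x - t *\<^sub>R z)" for t
    have lin: "linear (?D y)" for y using diff by (rule linear_frechet_derivative)
    have der: "(u has_derivative ?D y) (at y)" for y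
      by (rule frechet_derivative_works[THEN iffD1, OF diff])
    have "(\<phi> has_real_derivative ?D (x + t *\<^sub>R z) z - ?D (x - t *\<^sub>R z) z) (at t)" for t
    proof -
      have "((\<lambda>t. u (x + t *\<^sub>R z)) has_derivative (\<lambda>h. ?D (x + t *\<^sub>R z) (h *\<^sub>R z))) (at t)"
        by (rule has_derivative_compose[OF _ der]) (auto intro!: derivative_eq_intros)
      moreover have "((\<lambda>t. u (x - t *\<^sub>R z)) has_derivative (\<lambda>h. ?D (x - t *\<^sub>R z) (- (h *\<^sub>R z)))) (at t)"
        by (rule has_derivative_compose[OF _ der]) (auto intro!: derivative_eq_intros)
      ultimately have "(\<phi> has_derivative (\<lambda>h. ?D (x + t *\<^sub>R z) (h *\<^sub>R z) + ?D (x - t *\<^sub>R z) (- (h *\<^sub>R z)))) (at t)"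
        unfolding \<phi>_def[abs_def] by (rule has_derivative_add)
      then show ?thesis unfolding has_field_derivative_def
        by (rule has_derivative_eq_rhs)
          (auto simp: fun_eq_iff linear_scale[OF lin] linear_neg[OF lin] algebra_simps)
    qed
    then obtain \<xi> where \<xi>: "0 < \<xi>" "\<xi> < 1" "\<phi> 1 - \<phi> 0 = (1 - 0) * (?D (x + \<xi> *\<^sub>R z) z - ?D (x - \<xi> *\<^sub>R z) z)"
      using MVT2[of 0 1 \<phi> "\<lambda>t. ?D (x + t *\<^sub>R z) z - ?D (x - t *\<^sub>R z) z"] by auto
    have "norm (\<xi> *\<^sub>R z) \<le> 1" using \<xi> z by (simp add: mult_le_one)
    then have in_ball: "x + \<xi> *\<^sub>R z \<in> cball 0 (r + 1)" "x - \<xi> *\<^sub>R z \<in> cball 0 (r + 1)"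
      using x norm_triangle_ineq[of x "\<xi> *\<^sub>R z"] norm_triangle_ineq4[of x "\<xi> *\<^sub>R z"] by auto
    have diffn: "norm ((x + \<xi> *\<^sub>R z) - (x - \<xi> *\<^sub>R z)) \<le> 2 * norm z"
    proof -
      have "(x + \<xi> *\<^sub>R z) - (x - \<xi> *\<^sub>R z) = (2 * \<xi>) *\<^sub>R z" by (simp flip: scaleR_2 scaleR_add_left)
      then show ?thesis using \<xi> by (simp add: mult_left_le_one_le mult.commute mult.left_commute)
    qed
    have "\<bar>2 * u x - u (x + z) - u (x - z)\<bar> = \<bar>\<phi> 1 - \<phi> 0\<bar>" by (simp add: \<phi>_def)
    also have "\<dots> = \<bar>\<Sum>e\<in>Basis. (z \<bullet> e) * (?D (x + \<xi> *\<^sub>R z) e - ?D (x - \<xi> *\<^sub>R z) e)\<bar>"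
      unfolding \<xi>(3)
      by (subst (1 2) frechet_derivative_component_sum[OF diff]) (simp add: sum_subtractf right_diff_distrib)
    also have "\<dots> \<le> (\<Sum>e\<in>Basis. \<bar>(z \<bullet> e) * (?D (x + \<xi> *\<^sub>R z) e - ?D (x - \<xi> *\<^sub>R z) e)\<bar>)"
      by (rule sum_abs)
    also have "\<dots> \<le> (\<Sum>e\<in>Basis. norm z * (\<bar>C e\<bar> * (2 * norm z) powr \<beta>))"
    proof (rule sum_mono)
      fix e :: 'a assume e: "e \<in> Basis"
      have "\<bar>?D (x + \<xi> *\<^sub>R z) e - ?D (x - \<xi> *\<^sub>R z) e\<bar> \<le> \<bar>C e\<bar> * norm ((x + \<xi> *\<^sub>R z) - (x - \<xi> *\<^sub>R z)) powr \<beta>"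
        using C[OF e in_ball] by (rule order_trans) (intro mult_right_mono, auto)
      also have "\<dots> \<le> \<bar>C e\<bar> * (2 * norm z) powr \<beta>"
        using diffn \<beta> by (intro mult_left_mono powr_mono2) auto
      finally show "\<bar>(z \<bullet> e) * (?D (x + \<xi> *\<^sub>R z) e - ?D (x - \<xi> *\<^sub>R z) e)\<bar> \<le> norm z * (\<bar>C e\<bar> * (2 * norm z) powr \<beta>)"
        unfolding abs_mult using Basis_le_norm[OF e, of z] by (intro mult_mono) auto
    qed
    also have "\<dots> = (2 powr \<beta> * (\<Sum>e\<in>Basis. \<bar>C e\<bar>)) * norm z powr (1 + \<beta>)"
      by (simp add: sum_distrib_left[symmetric] sum_distrib_right[symmetric] powr_mult powr_add powr_one mult_ac)
    finally show "\<bar>2 * u x - u (x + z) - u (x - z)\<bar> \<le> (2 powr \<beta> * (\<Sum>e\<in>Basis. \<bar>C e\<bar>)) * norm z powr (1 + \<beta>)" .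
  qed
qed

lemma first_difference_imp_second_difference:
  fixes u :: "'a::real_normed_vector \<Rightarrow> real"
  assumes hol: "\<And>x y. \<lbrakk>x \<in> cball 0 (r + 1); y \<in> cball 0 (r + 1)\<rbrakk> \<Longrightarrow> \<bar>u x - u y\<bar> \<le> C * norm (x - y) powr \<beta>"
    and x: "norm x \<le> r" and z: "norm z \<le> 1"
  shows "\<bar>2 * u x - u (x + z) - u (x - z)\<bar> \<le> (2 * C) * norm z powr \<beta>"
proof -
  have "x \<in> cball 0 (r + 1)" "x + z \<in> cball 0 (r + 1)" "x - z \<in> cball 0 (r + 1)"
    using x z norm_triangle_ineq[of x z] norm_triangle_ineq4[of x z] by auto
  then have "\<bar>u x - u (x + z)\<bar> \<le> C * norm z powr \<beta>" "\<bar>u x - u (x - z)\<bar> \<le> C * norm z powr \<beta>"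
    using hol[of x "x + z"] hol[of x "x - z"] by auto
  then show ?thesis by (simp add: abs_le_iff)
qed

text \<open>With k the integer part of 2 \<alpha>, the exponent \<tau> is 2 \<alpha> for k = 0
  (Hoelder function), 1 for k = 1 and 2 s < 1 (Lipschitz function), 2 \<alpha> for k = 1 and 2 s >=
  1 (Hoelder gradient), and 2 for k >= 2 (Lipschitz gradient), which exceeds 2 s because s <
  1.\<close>

lemma C_loc_second_difference:
  fixes u :: "real ^ 'n \<Rightarrow> real"
  assumes u: "u \<in> C_loc (2 * \<alpha>)" and s: "0 < s" "s < 1" "s < \<alpha>"
  obtains \<tau> where "\<tau> > 2 * s"
    "\<And>r. \<exists>C. \<forall>x z. norm x \<le> r \<longrightarrow> norm z \<le> 1 \<longrightarrow> \<bar>2 * u x - u (x + z) - u (x - z)\<bar> \<le> C * norm z powr \<tau>"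
proof -
  define k where "k = nat \<lfloor>2 * \<alpha>\<rfloor>"
  define \<beta> where "\<beta> = 2 * \<alpha> - of_int \<lfloor>2 * \<alpha>\<rfloor>"
  have hol: "holder_loc k \<beta> u" using u by (simp add: C_loc_def k_def \<beta>_def)
  have \<beta>: "\<beta> \<ge> 0" "2 * \<alpha> = real k + \<beta>" using s by (auto simp: \<beta>_def k_def)
  consider "k = 0" | "k = 1" "2 * s < 1" | "k = 1" "2 * s \<ge> 1" | m where "k = Suc (Suc m)"
    by (metis One_nat_def linorder_not_less old.nat.exhaust)
  then show thesis
  proof cases
    case 1
    have "\<exists>C. \<forall>x z. norm x \<le> r \<longrightarrow> norm z \<le> 1 \<longrightarrow> \<bar>2 * u x - u (x + z) - u (x - z)\<bar> \<le> C * norm z powr \<beta>" for r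
    proof -
      have "\<forall>K. compact K \<longrightarrow> (\<exists>C. \<forall>x\<in>K. \<forall>y\<in>K. \<bar>u x - u y\<bar> \<le> C * dist x y powr \<beta>)"
        using hol 1 by simp
      then obtain C where "\<forall>x\<in>cball 0 (r + 1). \<forall>y\<in>cball 0 (r + 1). \<bar>u x - u y\<bar> \<le> C * dist x y powr \<beta>"
        using compact_cball by blast
      then show ?thesis
        using first_difference_imp_second_difference[of r u C \<beta>]
        by (intro exI[of _ "2 * C"]) (auto simp: dist_norm)
    qed
    then show thesis using that[of \<beta>] 1 \<beta> s by auto
  next
    case 2
    have diff: "u differentiable (at x)" and
      cont: "e \<in> Basis \<Longrightarrow> continuous_on UNIV (\<lambda>x. frechet_derivative u (at x) e)" for x e
      using hol 2 by auto
    have "\<exists>C. \<forall>x z. norm x \<le> r \<longrightarrow> norm z \<le> 1 \<longrightarrow> \<bar>2 * u x - u (x + z) - u (x - z)\<bar> \<le> C * norm z powr 1" for r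
    proof -
      obtain C where "\<And>x y. \<lbrakk>x \<in> cball 0 (r + 1); y \<in> cball 0 (r + 1)\<rbrakk> \<Longrightarrow> \<bar>u x - u y\<bar> \<le> C * norm (x - y)"
        using C1_imp_lipschitz_on_cball[OF diff cont] by blast
      then show ?thesis
        using first_difference_imp_second_difference[of r u C 1]
        by (intro exI[of _ "2 * C"]) (auto simp: powr_one)
    qed
    then show thesis using that[of 1] 2 by auto
  next
    case 3
    have diff: "u differentiable (at x)" for x using hol 3 by auto
    have grad: "\<exists>C. \<forall>x\<in>cball 0 (r + 1). \<forall>y\<in>cball 0 (r + 1).
        \<bar>frechet_derivative u (at x) e - frechet_derivative u (at y) e\<bar> \<le> C * norm (x - y) powr \<beta>"
      if "e \<in> Basis" for e r
    proof -
      have "\<forall>K. compact K \<longrightarrow> (\<exists>C. \<forall>x\<in>K. \<forall>y\<in>K.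
          \<bar>frechet_derivative u (at x) e - frechet_derivative u (at y) e\<bar> \<le> C * dist x y powr \<beta>)"
        using hol 3 that by simp
      then show ?thesis using compact_cball unfolding dist_norm by blast
    qed
    have "\<exists>C. \<forall>x z. norm x \<le> r \<longrightarrow> norm z \<le> 1 \<longrightarrow> \<bar>2 * u x - u (x + z) - u (x - z)\<bar> \<le> C * norm z powr (1 + \<beta>)" for r
      using holder_gradient_imp_second_difference[OF diff grad \<beta>(1)] by metis
    then show thesis using that[of "1 + \<beta>"] 3 \<beta> s by auto
  next
    case (4 m)
    have diff: "u differentiable (at x)" for x using hol 4 by auto
    have grad: "\<exists>C. \<forall>x\<in>cball 0 (r + 1). \<forall>y\<in>cball 0 (r + 1).
        \<bar>frechet_derivative u (at x) e - frechet_derivative u (at y) e\<bar> \<le> C * norm (x - y) powr 1"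
      if e: "e \<in> Basis" for e r
    proof -
      let ?v = "\<lambda>x. frechet_derivative u (at x) e"
      have h: "holder_loc (Suc m) \<beta> ?v" using hol 4 e by simp
      have "?v differentiable (at x)" for x using h by simp
      moreover have "continuous_on UNIV (\<lambda>x. frechet_derivative ?v (at x) e')" if "e' \<in> Basis" for e'
        by (rule holder_loc_imp_continuous[of m \<beta>]) (use h that in simp)
      ultimately obtain C where "\<And>x y. \<lbrakk>x \<in> cball 0 (r + 1); y \<in> cball 0 (r + 1)\<rbrakk> \<Longrightarrow> \<bar>?v x - ?v y\<bar> \<le> C * norm (x - y)"
        using C1_imp_lipschitz_on_cball[of ?v "r + 1"] by blast
      then show ?thesis by (intro exI[of _ C]) (auto simp: powr_one)
    qed
    have "\<exists>C. \<forall>x z. norm x \<le> r \<longrightarrow> norm z \<le> 1 \<longrightarrow> \<bar>2 * u x - u (x + z) - u (x - z)\<bar> \<le> C * norm z powr (1 + 1)" for r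
      using holder_gradient_imp_second_difference[where \<beta> = 1, OF diff grad zero_le_one] by metis
    then show thesis using that[of "1 + 1"] s by auto
  qed
qed

lemma frac_const_pos:
  assumes "0 < s" "s < 1"
  shows "frac_const N s > 0"
  using assms unfolding frac_const_def
  by (intro divide_pos_pos mult_pos_pos Gamma_real_pos) (auto simp: add_nonneg_pos)

text \<open>\<open>u\<close> is continuous, hence Borel, so the Lebesgue integrals in the
  definitions are integrals over \<open>lborel\<close>. The local bound comes from the second
  differences of \<open>C_loc_second_difference\<close>, the limit from the principal value after
  division by the normalising constant.\<close>

lemma frac_rep_if_has_frac_laplacian:
  fixes u F :: "real ^ 'n \<Rightarrow> real"
  assumes s: "0 < s" "s < 1" and u: "u \<in> frac_domain s"
    and lap: "\<And>x. has_frac_laplacian s u x (F x)"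
  shows "frac_rep (real CARD('n) + 2 * s) u (\<lambda>x. F x / frac_const CARD('n) s)"
proof -
  define d where "d = real CARD('n) + 2 * s"
  define c where "c = frac_const CARD('n) s"
  have c: "c > 0" using frac_const_pos[OF s] by (simp add: c_def)
  have d: "DIM(real ^ 'n) < d" using s by (simp add: d_def)
  from u obtain \<alpha> where \<alpha>: "s < \<alpha>" "u \<in> C_loc (2 * \<alpha>)" and L: "u \<in> L_space s"
    by (auto simp: frac_domain_def)
  have cont: "continuous_on UNIV u"
    using \<alpha>(2) by (auto simp: C_loc_def intro: holder_loc_imp_continuous)
  then have [measurable]: "u \<in> borel_measurable borel" by (rule borel_measurable_continuous_onI)
  have int: "integrable lborel (\<lambda>y. u y * tail d y)"
  proof -
    have "integrable lebesgue (\<lambda>y. \<bar>u y\<bar> / (1 + norm y) powr d)"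
      using L by (simp add: L_space_def d_def)
    then have "integrable lborel (\<lambda>y. \<bar>u y\<bar> / (1 + norm y) powr d)"
      by (subst (asm) integrable_completion) auto
    then show ?thesis
      by (rule Bochner_Integration.integrable_bound) (auto simp: powr_minus divide_inverse abs_mult)
  qed
  have trunc: "(LINT y:{y. norm (x - y) > e}|lebesgue. frac_quot s u x y) = trunc_op d e u x" for e x
  proof -
    have eq: "(\<lambda>y. indicator {y. norm (x - y) > e} y *\<^sub>R frac_quot s u x y)
        = (\<lambda>y. (u x - u y) * trunc_kernel d e (x - y))"
      unfolding frac_quot_def trunc_kernel_def d_def[symmetric]
      by (auto simp: fun_eq_iff powr_minus divide_inverse)
    show ?thesis
      unfolding set_lebesgue_integral_def eq trunc_op_def by (rule integral_completion) measurable
  qed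
  obtain \<tau> where \<tau>: "\<tau> > 2 * s"
    "\<And>r. \<exists>C. \<forall>x z. norm x \<le> r \<longrightarrow> norm z \<le> 1 \<longrightarrow> \<bar>2 * u x - u (x + z) - u (x - z)\<bar> \<le> C * norm z powr \<tau>"
    using C_loc_second_difference[OF \<alpha>(2) s \<alpha>(1)] by blast
  have "\<exists>B. \<forall>e>0. \<forall>x. norm x \<le> r \<longrightarrow> \<bar>trunc_op d e u x\<bar> \<le> B" for r
  proof -
    obtain C where "\<forall>x z. norm x \<le> max r 0 \<longrightarrow> norm z \<le> 1 \<longrightarrow> \<bar>2 * u x - u (x + z) - u (x - z)\<bar> \<le> C * norm z powr \<tau>"
      using \<tau>(2) by blast
    moreover have "d - DIM(real ^ 'n) < \<tau>" using \<tau> by (simp add: d_def)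
    ultimately obtain B where "\<And>e x. \<lbrakk>e > 0; norm x \<le> max r 0\<rbrakk> \<Longrightarrow> \<bar>trunc_op d e u x\<bar> \<le> B"
      using trunc_op_locally_bounded[OF d cont int, of \<tau> "max r 0" C] by auto
    then show ?thesis by (intro exI[of _ B]) auto
  qed
  moreover have "((\<lambda>e. trunc_op d e u x) \<longlongrightarrow> F x / c) (at_right 0)" for x
  proof -
    have "((\<lambda>e. c * trunc_op d e u x) \<longlongrightarrow> F x) (at_right 0)"
      using lap[of x] unfolding has_frac_laplacian_def trunc by (simp add: c_def)
    then have "((\<lambda>e. c * trunc_op d e u x / c) \<longlongrightarrow> F x / c) (at_right 0)"
      using c by (intro tendsto_divide) auto
    then show ?thesis using c by simp
  qed
  ultimately show ?thesis using cont int unfolding frac_rep_def c_def d_def by blast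
qed

text \<open>Outside a ball of radius at least 1 the lower limit gives h >= y |x|^l, and 1 + |x| <= 2
  |x| there; inside, the positive continuous quotient attains a positive minimum.\<close>

lemma lower_bound_if_Liminf_pos:
  fixes h :: "'a::euclidean_space \<Rightarrow> real"
  assumes l: "l > 0" and h: "continuous_on UNIV h" "\<And>x. h x > 0"
    and lim: "Liminf at_infinity (\<lambda>x. ereal (h x / norm x powr l)) > 0"
  obtains m where "m > 0" "\<And>x. m * (1 + norm x) powr l \<le> h x"
proof -
  obtain y where y: "0 < ereal y" "ereal y < Liminf at_infinity (\<lambda>x. ereal (h x / norm x powr l))"
    using ereal_dense2[OF lim] by auto
  have "\<forall>\<^sub>F x in at_infinity. ereal y < ereal (h x / norm x powr l)"
    using y(2) by (rule less_LiminfD)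
  then obtain b where b: "\<And>x. norm x \<ge> b \<Longrightarrow> y < h x / norm x powr l"
    by (auto simp: eventually_at_infinity)
  define r where "r = max b 1"
  have "continuous_on (cball 0 r) (\<lambda>x. h x / (1 + norm x) powr l)"
    by (intro continuous_intros continuous_on_subset[OF h(1)]) (auto simp: add_nonneg_eq_0_iff)
  then obtain x0 where x0: "\<And>x. x \<in> cball 0 r \<Longrightarrow> h x0 / (1 + norm x0) powr l \<le> h x / (1 + norm x) powr l"
    using continuous_attains_inf[of "cball (0::'a) r"] by (force simp: r_def)
  define m0 where "m0 = h x0 / (1 + norm x0) powr l"
  have one_pos: "1 + norm x > 0" for x :: 'a by (simp add: add_pos_nonneg)
  have m0: "m0 > 0" using h(2)[of x0] one_pos[of x0] by (simp add: m0_def)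
  define m where "m = min m0 (y / 2 powr l)"
  show thesis
  proof
    show "m > 0" using m0 y by (simp add: m_def)
    fix x
    show "m * (1 + norm x) powr l \<le> h x"
    proof (cases "norm x \<le> r")
      case True
      have "m * (1 + norm x) powr l \<le> m0 * (1 + norm x) powr l"
        by (intro mult_right_mono) (auto simp: m_def)
      also have "\<dots> \<le> h x" using x0[of x] True one_pos[of x] by (simp add: m0_def pos_le_divide_eq)
      finally show ?thesis .
    next
      case False
      then have x: "norm x \<ge> 1" "norm x \<ge> b" by (auto simp: r_def)
      have "m * (1 + norm x) powr l \<le> (y / 2 powr l) * (2 * norm x) powr l"
        using x l y by (intro mult_mono powr_mono2) (auto simp: m_def)
      also have "\<dots> = y * norm x powr l" by (simp add: powr_mult)
      also have "\<dots> \<le> h x"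
      proof -
        have "norm x powr l > 0" using x(1) by auto
        then show ?thesis using b[OF x(2)] by (simp add: pos_less_divide_eq)
      qed
      finally show ?thesis .
    qed
  qed
qed

section \<open>Integral estimates\<close>

text \<open>\<open>c\<close> stands for the normalising constant and \<open>m\<close> for the
  constant of \<open>lower_bound_if_Liminf_pos\<close>. The Hoelder classes no longer appear:
  \<open>frac_rep\<close> carries both the regularity and the equations.\<close>

locale stable_pair =
  fixes s p c l m :: real and h u \<zeta> :: "'a::euclidean_space \<Rightarrow> real"
  assumes s: "0 < s" "s < 1" and p: "1 < p" and c: "c > 0" and l: "l > 0" and m: "m > 0"
    and h_cont: "continuous_on UNIV h" and h_ge: "\<And>x. m * (1 + norm x) powr l \<le> h x"
    and u_pos: "\<And>x. u x > 0" and \<zeta>_pos: "\<And>x. \<zeta> x > 0"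
    and u_rep: "frac_rep (DIM('a) + 2 * s) u (\<lambda>x. h x * u x powr p / c)"
    and \<zeta>_rep: "frac_rep (DIM('a) + 2 * s) \<zeta> (\<lambda>x. p * h x * u x powr (p - 1) * \<zeta> x / c)"
begin

definition d :: real where "d = DIM('a) + 2 * s"

text \<open>The equation for \<open>u\<close> is tested with the power 2q-1 of \<open>u\<close>. In
  the first range this exponent lies in (-1, 0); in the second it is positive, and the coefficient p
  supplied by stability beats the loss q^2 / (2q-1) of \<open>powr_diff_square_le\<close>.\<close>

definition admissible :: "real \<Rightarrow> bool" where
  "admissible q \<longleftrightarrow> 0 < q \<and> q < 1 / 2 \<or> 1 / 2 < q \<and> q\<^sup>2 < p * (2 * q - 1)"

lemma d: "DIM('a) < d" "d < DIM('a) + 2" "d > 0"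
  using s by (auto simp: d_def add_nonneg_pos)

lemma u_cont: "continuous_on UNIV u" and \<zeta>_cont: "continuous_on UNIV \<zeta>"
  using u_rep \<zeta>_rep by (auto simp: frac_rep_def)

lemma measurable_facts [measurable]:
  "u \<in> borel_measurable borel" "\<zeta> \<in> borel_measurable borel" "h \<in> borel_measurable borel"
  using u_cont \<zeta>_cont h_cont by (auto intro: borel_measurable_continuous_onI)

lemma h_ge_m: "m \<le> h x"
proof -
  have "m * 1 \<le> m * (1 + norm x) powr l" using m l by (intro mult_left_mono ge_one_powr_ge_zero) auto
  with h_ge[of x] show ?thesis by simp
qed

lemma h_pos: "h x > 0"
  using h_ge_m[of x] m by simp

text \<open>\<open>D\<close> depends neither on the cutoff nor on its support nor on
  \<open>B\<close>; this uniformity permits the later passage to cutoffs without compact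
  support.\<close>

lemma compact_support_estimate:
  assumes "admissible q"
  obtains D where "D \<ge> 0"
    "\<And>\<eta> r B. \<lbrakk>continuous_on UNIV \<eta>; \<And>x. \<eta> x \<ge> 0; \<And>x. norm x > r \<Longrightarrow> \<eta> x = 0; B \<ge> 0;
      (\<integral>\<^sup>+x. ennreal (u x powr (2 * q)) *
        (\<integral>\<^sup>+y. ennreal ((\<eta> x - \<eta> y)\<^sup>2 * norm (x - y) powr (- d)) \<partial>lborel) \<partial>lborel) \<le> ennreal B\<rbrakk> \<Longrightarrow>
      (\<integral>x. h x * u x powr (p + 2 * q - 1) * (\<eta> x)\<^sup>2 \<partial>lborel) \<le> D * B"
proof -
  have un0: "u x \<noteq> 0" "\<zeta> x \<noteq> 0" for x using u_pos[of x] \<zeta>_pos[of x] by auto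
  have rep: "frac_rep d u (\<lambda>x. h x * u x powr p / c)"
    "frac_rep d \<zeta> (\<lambda>x. p * h x * u x powr (p - 1) * \<zeta> x / c)"
    using u_rep \<zeta>_rep by (simp_all add: d_def)
  have scaled: "(\<integral>\<^sup>+x. ennreal (k * u x powr (2 * q)) *
        (\<integral>\<^sup>+y. ennreal ((\<eta> x - \<eta> y)\<^sup>2 * norm (x - y) powr (- d)) \<partial>lborel) \<partial>lborel) \<le> ennreal (k * B)"
    if k: "k \<ge> 0" and [measurable]: "\<eta> \<in> borel_measurable borel" and B: "B \<ge> 0"
     "(\<integral>\<^sup>+x. ennreal (u x powr (2 * q)) *
        (\<integral>\<^sup>+y. ennreal ((\<eta> x - \<eta> y)\<^sup>2 * norm (x - y) powr (- d)) \<partial>lborel) \<partial>lborel) \<le> ennreal B" for k \<eta> B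
  proof -
    have "(\<integral>\<^sup>+x. ennreal (k * u x powr (2 * q)) *
        (\<integral>\<^sup>+y. ennreal ((\<eta> x - \<eta> y)\<^sup>2 * norm (x - y) powr (- d)) \<partial>lborel) \<partial>lborel)
      = ennreal k * (\<integral>\<^sup>+x. ennreal (u x powr (2 * q)) *
        (\<integral>\<^sup>+y. ennreal ((\<eta> x - \<eta> y)\<^sup>2 * norm (x - y) powr (- d)) \<partial>lborel) \<partial>lborel)"
      using k by (subst nn_integral_cmult[symmetric]) (auto simp: ennreal_mult mult.assoc)
    also have "\<dots> \<le> ennreal k * ennreal B" by (intro mult_left_mono B) auto
    finally show ?thesis using k B by (simp add: ennreal_mult)
  qed
  from assms consider "0 < q" "q < 1 / 2" | "1 / 2 < q" "q\<^sup>2 < p * (2 * q - 1)"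
    by (auto simp: admissible_def)
  then show thesis
  proof cases
    case 1
    define t where "t = 2 * q - 1"
    have t: "-1 < t" "t < 0" "1 + t = 2 * q" using 1 by (auto simp: t_def)
    show thesis
    proof (rule that)
      show "c / (- t) \<ge> 0" using t c by (simp add: divide_nonneg_neg)
      fix \<eta> :: "'a \<Rightarrow> real" and r B
      assume \<eta>: "continuous_on UNIV \<eta>" "\<And>x. \<eta> x \<ge> 0" "\<And>x. norm x > r \<Longrightarrow> \<eta> x = 0" and B: "B \<ge> 0"
       "(\<integral>\<^sup>+x. ennreal (u x powr (2 * q)) *
        (\<integral>\<^sup>+y. ennreal ((\<eta> x - \<eta> y)\<^sup>2 * norm (x - y) powr (- d)) \<partial>lborel) \<partial>lborel) \<le> ennreal B"
      have [measurable]: "\<eta> \<in> borel_measurable borel" using \<eta>(1) by (rule borel_measurable_continuous_onI)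
      \<comment> \<open>The comparison has factor 0: by
        \<open>weighted_negative_powr_diff_le\<close> the energy of this test function is bounded by
        the error term alone.\<close>
      have "(\<integral>x. (u x powr t * (\<eta> x)\<^sup>2) * (h x * u x powr p / c) \<partial>lborel)
          \<le> 0 * (\<integral>x. (u x powr t * (\<eta> x)\<^sup>2) * (h x * u x powr p / c) \<partial>lborel) + 1 / (- t) * B"
      proof (rule energy_comparison[OF d(1) rep(1) rep(1)])
        show "continuous_on UNIV (\<lambda>x. u x powr t * (\<eta> x)\<^sup>2)"
          using u_cont \<eta>(1) un0 by (intro continuous_intros) auto
        show "continuous_on UNIV (\<lambda>x. u x powr t * (\<eta> x)\<^sup>2)"
          using u_cont \<eta>(1) un0 by (intro continuous_intros) auto
        show "u x powr t * (\<eta> x)\<^sup>2 = 0" if "norm x > r" for x using \<eta>(3)[OF that] by simp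
        show "u x powr t * (\<eta> x)\<^sup>2 = 0" if "norm x > r" for x using \<eta>(3)[OF that] by simp
        show "(\<lambda>x. 1 / (- t) * u x powr (2 * q)) \<in> borel_measurable borel" by measurable
        show "\<eta> \<in> borel_measurable borel" by measurable
        show "0 \<le> 1 / (- t) * u x powr (2 * q)" for x using t by (simp add: divide_nonneg_neg)
        show "(u x - u y) * (u x powr t * (\<eta> x)\<^sup>2 - u y powr t * (\<eta> y)\<^sup>2)
            \<le> 0 * ((u x - u y) * (u x powr t * (\<eta> x)\<^sup>2 - u y powr t * (\<eta> y)\<^sup>2))
              + (1 / (- t) * u x powr (2 * q) + 1 / (- t) * u y powr (2 * q)) * (\<eta> x - \<eta> y)\<^sup>2" for x y
          using weighted_negative_powr_diff_le[OF t(1,2) u_pos[of x] u_pos[of y] \<eta>(2)[of x] \<eta>(2)[of y]]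
          by (simp only: t(3) distrib_left mult_zero_left add_0)
        show "1 / (- t) * B \<ge> 0" using t B by (simp add: divide_nonneg_neg)
        show "(\<integral>\<^sup>+x. ennreal (1 / (- t) * u x powr (2 * q)) *
          (\<integral>\<^sup>+y. ennreal ((\<eta> x - \<eta> y)\<^sup>2 * norm (x - y) powr (- d)) \<partial>lborel) \<partial>lborel) \<le> ennreal (1 / (- t) * B)"
          using t B by (intro scaled) auto
      qed
      also have "(\<lambda>x. (u x powr t * (\<eta> x)\<^sup>2) * (h x * u x powr p / c))
          = (\<lambda>x. h x * u x powr (p + 2 * q - 1) * (\<eta> x)\<^sup>2 / c)"
        by (auto simp: fun_eq_iff t_def powr_add powr_diff un0)
      finally have "(\<integral>x. h x * u x powr (p + 2 * q - 1) * (\<eta> x)\<^sup>2 \<partial>lborel) / c \<le> 1 / (- t) * B"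
        by simp
      then show "(\<integral>x. h x * u x powr (p + 2 * q - 1) * (\<eta> x)\<^sup>2 \<partial>lborel) \<le> c / (- t) * B"
        using c by (simp add: field_simps)
    qed
  next
    case 2
    define t where "t = 2 * q - 1"
    have t: "t > 0" using 2 by (simp add: t_def)
    have q: "q > 0" using 2 by simp
    \<comment> \<open>Admissibility is Q > 1. Half of the excess goes to \<open>e\<close>, so that K
      = (1 + e) q^2 / t stays below \<open>p\<close> and the pairing on the right can be absorbed on
      the left.\<close>
    define Q where "Q = p * t / q\<^sup>2"
    define e where "e = (Q - 1) / 2"
    have "1 < Q" using 2 q by (simp add: Q_def t_def)
    then have e: "e > 0" "1 + e < Q" by (simp_all add: e_def field_simps)
    define K where "K = (1 + e) * q\<^sup>2 / t"
    have K: "K < p" using e(2) q t by (simp add: K_def Q_def field_simps)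
    obtain C where C: "C \<ge> 0"
      "\<And>a b A B :: real. \<lbrakk>a > 0; b > 0; A \<ge> 0; B \<ge> 0\<rbrakk> \<Longrightarrow>
       (2 * q - 1) * (a powr q * A - b powr q * B)\<^sup>2
       \<le> (1 + e) * q\<^sup>2 * ((a - b) * (a powr (2 * q - 1) * A\<^sup>2 - b powr (2 * q - 1) * B\<^sup>2))
         + C * (a powr (2 * q) + b powr (2 * q)) * (A - B)\<^sup>2"
      using weighted_powr_diff_le[OF 2(1) e(1)] by blast
    show thesis
    proof (rule that)
      show "c * (C / t) / (p - K) \<ge> 0" using c C(1) t K by simp
      fix \<eta> :: "'a \<Rightarrow> real" and r B
      assume \<eta>: "continuous_on UNIV \<eta>" "\<And>x. \<eta> x \<ge> 0" "\<And>x. norm x > r \<Longrightarrow> \<eta> x = 0" and B: "B \<ge> 0"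
       "(\<integral>\<^sup>+x. ennreal (u x powr (2 * q)) *
        (\<integral>\<^sup>+y. ennreal ((\<eta> x - \<eta> y)\<^sup>2 * norm (x - y) powr (- d)) \<partial>lborel) \<partial>lborel) \<le> ennreal B"
      have [measurable]: "\<eta> \<in> borel_measurable borel" using \<eta>(1) by (rule borel_measurable_continuous_onI)
      define X where "X x = u x powr q * \<eta> x" for x
      have X_cont: "continuous_on UNIV X"
        unfolding X_def using u_cont \<eta>(1) un0 by (intro continuous_intros) auto
      \<comment> \<open>Both equations yield the same integral up to the factor 1 / c: on the left
        \<open>\<zeta>\<close> cancels and the coefficient is \<open>p\<close>, on the right it is
        \<open>K\<close>.\<close>
      have "(\<integral>x. ((X x)\<^sup>2 / \<zeta> x) * (p * h x * u x powr (p - 1) * \<zeta> x / c) \<partial>lborel)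
          \<le> K * (\<integral>x. (u x powr t * (\<eta> x)\<^sup>2) * (h x * u x powr p / c) \<partial>lborel) + C / t * B"
      proof (rule energy_comparison[OF d(1) rep(2) rep(1)])
        show "continuous_on UNIV (\<lambda>x. (X x)\<^sup>2 / \<zeta> x)"
          using X_cont \<zeta>_cont un0 by (intro continuous_intros) auto
        show "continuous_on UNIV (\<lambda>x. u x powr t * (\<eta> x)\<^sup>2)"
          using u_cont \<eta>(1) un0 by (intro continuous_intros) auto
        show "(X x)\<^sup>2 / \<zeta> x = 0" if "norm x > r" for x using \<eta>(3)[OF that] by (simp add: X_def)
        show "u x powr t * (\<eta> x)\<^sup>2 = 0" if "norm x > r" for x using \<eta>(3)[OF that] by simp
        show "(\<lambda>x. C / t * u x powr (2 * q)) \<in> borel_measurable borel" by measurable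
        show "\<eta> \<in> borel_measurable borel" by measurable
        show "0 \<le> C / t * u x powr (2 * q)" for x using t C(1) by simp
        show "(\<zeta> x - \<zeta> y) * ((X x)\<^sup>2 / \<zeta> x - (X y)\<^sup>2 / \<zeta> y)
            \<le> K * ((u x - u y) * (u x powr t * (\<eta> x)\<^sup>2 - u y powr t * (\<eta> y)\<^sup>2))
              + (C / t * u x powr (2 * q) + C / t * u y powr (2 * q)) * (\<eta> x - \<eta> y)\<^sup>2" for x y
        proof -
          have "(\<zeta> x - \<zeta> y) * ((X x)\<^sup>2 / \<zeta> x - (X y)\<^sup>2 / \<zeta> y) \<le> (X x - X y)\<^sup>2"
            by (rule picone_pointwise[OF \<zeta>_pos \<zeta>_pos])
          also have "t * (X x - X y)\<^sup>2 \<le> (1 + e) * q\<^sup>2 * ((u x - u y) * (u x powr t * (\<eta> x)\<^sup>2 - u y powr t * (\<eta> y)\<^sup>2))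
              + C * (u x powr (2 * q) + u y powr (2 * q)) * (\<eta> x - \<eta> y)\<^sup>2"
            using C(2)[OF u_pos[of x] u_pos[of y] \<eta>(2)[of x] \<eta>(2)[of y]] by (simp add: X_def t_def)
          then have "(X x - X y)\<^sup>2 \<le> ((1 + e) * q\<^sup>2 * ((u x - u y) * (u x powr t * (\<eta> x)\<^sup>2 - u y powr t * (\<eta> y)\<^sup>2))
              + C * (u x powr (2 * q) + u y powr (2 * q)) * (\<eta> x - \<eta> y)\<^sup>2) / t"
            using t by (simp add: pos_le_divide_eq mult.commute)
          also have "\<dots> = K * ((u x - u y) * (u x powr t * (\<eta> x)\<^sup>2 - u y powr t * (\<eta> y)\<^sup>2))
              + (C / t * u x powr (2 * q) + C / t * u y powr (2 * q)) * (\<eta> x - \<eta> y)\<^sup>2"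
            by (simp add: K_def add_divide_distrib distrib_left distrib_right)
          finally show ?thesis .
        qed
        show "C / t * B \<ge> 0" using t B C(1) by simp
        show "(\<integral>\<^sup>+x. ennreal (C / t * u x powr (2 * q)) *
          (\<integral>\<^sup>+y. ennreal ((\<eta> x - \<eta> y)\<^sup>2 * norm (x - y) powr (- d)) \<partial>lborel) \<partial>lborel) \<le> ennreal (C / t * B)"
          using t B C(1) by (intro scaled) auto
      qed
      also have "(\<lambda>x. ((X x)\<^sup>2 / \<zeta> x) * (p * h x * u x powr (p - 1) * \<zeta> x / c))
          = (\<lambda>x. p / c * (h x * u x powr (p + 2 * q - 1) * (\<eta> x)\<^sup>2))"
      proof
        fix x
        have "(u x powr q)\<^sup>2 * u x powr (p - 1) = u x powr (p + 2 * q - 1)"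
          unfolding power2_eq_square powr_add[symmetric] by (rule arg_cong) simp
        then show "((X x)\<^sup>2 / \<zeta> x) * (p * h x * u x powr (p - 1) * \<zeta> x / c)
            = p / c * (h x * u x powr (p + 2 * q - 1) * (\<eta> x)\<^sup>2)"
          using un0(2)[of x] by (simp add: X_def power_mult_distrib mult_ac)
      qed
      also have "(\<lambda>x. (u x powr t * (\<eta> x)\<^sup>2) * (h x * u x powr p / c))
          = (\<lambda>x. 1 / c * (h x * u x powr (p + 2 * q - 1) * (\<eta> x)\<^sup>2))"
        by (auto simp: fun_eq_iff t_def powr_add powr_diff un0 mult_ac)
      finally have "p / c * (\<integral>x. h x * u x powr (p + 2 * q - 1) * (\<eta> x)\<^sup>2 \<partial>lborel)
          \<le> K * (1 / c * (\<integral>x. h x * u x powr (p + 2 * q - 1) * (\<eta> x)\<^sup>2 \<partial>lborel)) + C / t * B"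
        (is "p / c * ?I \<le> _") unfolding integral_mult_right_zero .
      then have "(p - K) * ?I \<le> c * (C / t * B)" using c by (simp add: field_simps)
      moreover have pos: "p - K > 0" using K by simp
      ultimately have "?I \<le> c * (C / t * B) / (p - K)"
        by (simp only: pos_le_divide_eq[OF pos] mult.commute[of ?I])
      then show "?I \<le> c * (C / t) / (p - K) * B" by simp
    qed
  qed
qed

section \<open>Cutoffs without compact support\<close>

definition cutoff :: "real \<Rightarrow> 'a \<Rightarrow> real" where
  "cutoff R x = bump d (x /\<^sub>R R)"

lemma cutoff_cont: "continuous_on UNIV (cutoff R)"
  unfolding cutoff_def bump_def by (intro continuous_intros) (auto simp: add_nonneg_eq_0_iff)

lemma cutoff_measurable [measurable]: "cutoff R \<in> borel_measurable borel"
  using cutoff_cont by (rule borel_measurable_continuous_onI)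

lemma cutoff_nonneg: "cutoff R x \<ge> 0"
  by (simp add: cutoff_def)

lemma cutoff_square: "(cutoff R x)\<^sup>2 = (1 + norm (x /\<^sub>R R)) powr (- d)"
  by (simp only: cutoff_def bump_square)

lemma cutoff_one_square: "(cutoff 1 x)\<^sup>2 = tail d x"
  by (simp add: cutoff_square)

text \<open>Keeping only the part \<theta> of the decay exponent costs R^\<theta> instead of R^d.
  This freedom decides the sign of the final power of \<open>R\<close>.\<close>

lemma cutoff_square_le:
  assumes R: "R \<ge> 1" and \<theta>: "0 \<le> \<theta>" "\<theta> \<le> d"
  shows "(cutoff R x)\<^sup>2 \<le> R powr \<theta> * tail \<theta> x"
proof -
  have pos: "1 + norm x > 0" by (simp add: add_pos_nonneg)
  have "(cutoff R x)\<^sup>2 = (1 + norm x / R) powr (- d)" using R by (simp add: cutoff_square divide_inverse mult.commute)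
  also have "\<dots> \<le> (1 + norm x / R) powr (- \<theta>)" using R \<theta> by (intro powr_mono) auto
  also have "\<dots> \<le> ((1 + norm x) / R) powr (- \<theta>)"
  proof (rule powr_mono2')
    show "0 < (1 + norm x) / R" using R pos by simp
    show "(1 + norm x) / R \<le> 1 + norm x / R" using R by (simp add: add_divide_distrib)
  qed (use \<theta> in simp)
  also have "\<dots> = R powr \<theta> * tail \<theta> x"
    using R pos by (simp add: powr_divide powr_minus field_simps)
  finally show ?thesis .
qed

lemma cutoff_one_le: "R \<ge> 1 \<Longrightarrow> (cutoff 1 x)\<^sup>2 \<le> (cutoff R x)\<^sup>2"
  unfolding cutoff_square using d(3)
  by (intro powr_mono2') (auto simp: add_pos_nonneg divide_inverse[symmetric] mult_left_le_one_le inverse_le_1_iff)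

lemma cutoff_vanishes:
  assumes "R > 0" "\<delta> > 0"
  obtains r where "\<And>x. norm x > r \<Longrightarrow> cutoff R x \<le> \<delta>"
proof
  fix x :: 'a assume x: "norm x > R * \<delta> powr (- 2 / d)"
  have "1 + norm (x /\<^sub>R R) \<ge> \<delta> powr (- 2 / d)" using x assms(1) by (simp add: field_simps)
  then have "cutoff R x \<le> (\<delta> powr (- 2 / d)) powr (- d / 2)"
    unfolding cutoff_def bump_def using d(3) assms by (intro powr_mono2') auto
  also have "\<dots> = \<delta>" using d(3) assms by (simp add: powr_powr)
  finally show "cutoff R x \<le> \<delta>" .
qed

text \<open>The cutoff is approximated from below by its positive parts after subtraction of 1 / (n
  + 1), which have compact support. This operation is 1-Lipschitz, so the energies do not grow, and
  monotone convergence gives the limit.\<close>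

lemma cutoff_estimate:
  assumes q: "admissible q" and fin: "(\<integral>\<^sup>+x. ennreal (u x powr (2 * q) * tail d x) \<partial>lborel) < \<infinity>"
  obtains D where "D \<ge> 0" "\<And>R. R \<ge> 1 \<Longrightarrow>
      (\<integral>\<^sup>+x. ennreal (h x * u x powr (p + 2 * q - 1) * (cutoff R x)\<^sup>2) \<partial>lborel)
      \<le> ennreal (D * R powr (- 2 * s)) * (\<integral>\<^sup>+x. ennreal (u x powr (2 * q) * (cutoff R x)\<^sup>2) \<partial>lborel)"
    "\<And>R. R \<ge> 1 \<Longrightarrow> (\<integral>\<^sup>+x. ennreal (u x powr (2 * q) * (cutoff R x)\<^sup>2) \<partial>lborel) < \<infinity>"
proof -
  obtain D where D: "D \<ge> 0"
    "\<And>\<eta> r B. \<lbrakk>continuous_on UNIV \<eta>; \<And>x. \<eta> x \<ge> 0; \<And>x. norm x > r \<Longrightarrow> \<eta> x = 0; B \<ge> 0;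
      (\<integral>\<^sup>+x. ennreal (u x powr (2 * q)) *
        (\<integral>\<^sup>+y. ennreal ((\<eta> x - \<eta> y)\<^sup>2 * norm (x - y) powr (- d)) \<partial>lborel) \<partial>lborel) \<le> ennreal B\<rbrakk> \<Longrightarrow>
      (\<integral>x. h x * u x powr (p + 2 * q - 1) * (\<eta> x)\<^sup>2 \<partial>lborel) \<le> D * B"
    using compact_support_estimate[OF q] by blast
  obtain C where C: "C \<ge> 0" "\<And>(x::'a) R. R > 0 \<Longrightarrow>
      (\<integral>\<^sup>+y. ennreal ((cutoff R x - cutoff R y)\<^sup>2 * norm (x - y) powr (- d)) \<partial>lborel)
      \<le> ennreal (C * R powr (DIM('a) - d) * (cutoff R x)\<^sup>2)"
    using scaled_bump_energy_bound[OF d(1,2)] unfolding cutoff_def by blast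
  have finR: "(\<integral>\<^sup>+x. ennreal (u x powr (2 * q) * (cutoff R x)\<^sup>2) \<partial>lborel) < \<infinity>" if R: "R \<ge> 1" for R
  proof -
    have "u x powr (2 * q) * (cutoff R x)\<^sup>2 \<le> R powr d * (u x powr (2 * q) * tail d x)" for x
      using mult_left_mono[OF cutoff_square_le[OF R, of d x], of "u x powr (2 * q)"] d(3)
      by (simp add: mult_ac)
    then have "(\<integral>\<^sup>+x. ennreal (u x powr (2 * q) * (cutoff R x)\<^sup>2) \<partial>lborel)
        \<le> (\<integral>\<^sup>+x. ennreal (R powr d) * ennreal (u x powr (2 * q) * tail d x) \<partial>lborel)"
      by (intro nn_integral_mono) (simp add: ennreal_mult[symmetric] ennreal_leI)
    also have "\<dots> = ennreal (R powr d) * (\<integral>\<^sup>+x. ennreal (u x powr (2 * q) * tail d x) \<partial>lborel)"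
      by (rule nn_integral_cmult) measurable
    also have "\<dots> < \<infinity>" using fin by (simp add: ennreal_mult_less_top)
    finally show ?thesis .
  qed
  show thesis
  proof (rule that)
    show "D * C \<ge> 0" using D(1) C(1) by simp
    fix R :: real assume R: "R \<ge> 1"
    define I where "I = (\<integral>\<^sup>+x. ennreal (u x powr (2 * q) * (cutoff R x)\<^sup>2) \<partial>lborel)"
    have I: "I = ennreal (enn2real I)" using finR[OF R] by (simp add: I_def)
    \<comment> \<open>The bound of \<open>scaled_bump_energy_bound\<close> integrated against
      u^(2q): the squared cutoff reappears, so \<open>B\<close> involves an integral already known
      to be finite.\<close>
    define B where "B = C * R powr (- 2 * s) * enn2real I"
    have Bnn: "B \<ge> 0" using C(1) by (simp add: B_def)
    define \<eta> where "\<eta> n x = max (cutoff R x - 1 / real (Suc n)) 0" for n :: nat and x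
    have \<eta>_cont: "continuous_on UNIV (\<eta> n)" for n
      unfolding \<eta>_def by (intro continuous_intros cutoff_cont)
    have \<eta>_supp: "\<exists>r. \<forall>x. norm x > r \<longrightarrow> \<eta> n x = 0" for n
    proof -
      obtain r where "\<And>x. norm x > r \<Longrightarrow> cutoff R x \<le> 1 / real (Suc n)"
        using cutoff_vanishes[of R "1 / real (Suc n)"] R by auto
      then show ?thesis by (intro exI[of _ r]) (auto simp: \<eta>_def)
    qed
    have \<eta>_energy: "(\<integral>\<^sup>+x. ennreal (u x powr (2 * q)) *
        (\<integral>\<^sup>+y. ennreal ((\<eta> n x - \<eta> n y)\<^sup>2 * norm (x - y) powr (- d)) \<partial>lborel) \<partial>lborel) \<le> ennreal B" for n
    proof -
      have inner: "(\<integral>\<^sup>+y. ennreal ((\<eta> n x - \<eta> n y)\<^sup>2 * norm (x - y) powr (- d)) \<partial>lborel)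
          \<le> ennreal (C * R powr (- 2 * s) * (cutoff R x)\<^sup>2)" for x
      proof -
        have "(\<eta> n x - \<eta> n y)\<^sup>2 \<le> (cutoff R x - cutoff R y)\<^sup>2" for y
          unfolding abs_le_square_iff[symmetric] \<eta>_def by (auto simp: max_def)
        then have "(\<integral>\<^sup>+y. ennreal ((\<eta> n x - \<eta> n y)\<^sup>2 * norm (x - y) powr (- d)) \<partial>lborel)
            \<le> (\<integral>\<^sup>+y. ennreal ((cutoff R x - cutoff R y)\<^sup>2 * norm (x - y) powr (- d)) \<partial>lborel)"
          by (intro nn_integral_mono ennreal_leI mult_right_mono) auto
        also have "\<dots> \<le> ennreal (C * R powr (DIM('a) - d) * (cutoff R x)\<^sup>2)"
          using R by (intro C) auto
        finally show ?thesis by (simp add: d_def)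
      qed
      have "(\<integral>\<^sup>+x. ennreal (u x powr (2 * q)) *
          (\<integral>\<^sup>+y. ennreal ((\<eta> n x - \<eta> n y)\<^sup>2 * norm (x - y) powr (- d)) \<partial>lborel) \<partial>lborel)
          \<le> (\<integral>\<^sup>+x. ennreal (u x powr (2 * q)) * ennreal (C * R powr (- 2 * s) * (cutoff R x)\<^sup>2) \<partial>lborel)"
        by (intro nn_integral_mono mult_left_mono inner) auto
      also have "\<dots> = (\<integral>\<^sup>+x. ennreal (C * R powr (- 2 * s)) * ennreal (u x powr (2 * q) * (cutoff R x)\<^sup>2) \<partial>lborel)"
        using C(1) by (simp add: ennreal_mult[symmetric] mult_ac)
      also have "\<dots> = ennreal (C * R powr (- 2 * s)) * I"
        unfolding I_def by (rule nn_integral_cmult) measurable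
      also have "\<dots> = ennreal B" using C(1) by (subst I) (simp add: B_def ennreal_mult[symmetric])
      finally show ?thesis .
    qed
    let ?f = "\<lambda>n x. h x * u x powr (p + 2 * q - 1) * (\<eta> n x)\<^sup>2"
    have hu: "h x * u x powr (p + 2 * q - 1) \<ge> 0" for x using h_pos[of x] by simp
    have un0: "u x \<noteq> 0" for x using u_pos[of x] by auto
    have [measurable]: "\<eta> n \<in> borel_measurable borel" for n
      using \<eta>_cont by (rule borel_measurable_continuous_onI)
    have bound: "(\<integral>\<^sup>+x. ennreal (?f n x) \<partial>lborel) \<le> ennreal (D * B)" for n
    proof -
      obtain r where r: "\<And>x. norm x > r \<Longrightarrow> \<eta> n x = 0" using \<eta>_supp by blast
      have "integrable lborel (?f n)"
        using r h_cont u_cont \<eta>_cont un0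
        by (intro integrable_continuous_compact_support[where r=r] continuous_intros) auto
      then have "(\<integral>\<^sup>+x. ennreal (?f n x) \<partial>lborel) = ennreal (\<integral>x. ?f n x \<partial>lborel)"
        using hu by (intro nn_integral_eq_integral) auto
      also have "\<dots> \<le> ennreal (D * B)"
        by (intro ennreal_leI D(2)[OF \<eta>_cont _ r Bnn \<eta>_energy]) (auto simp: \<eta>_def)
      finally show ?thesis .
    qed
    have lim: "(\<lambda>n. \<integral>\<^sup>+x. ennreal (?f n x) \<partial>lborel)
        \<longlonglongrightarrow> (\<integral>\<^sup>+x. ennreal (h x * u x powr (p + 2 * q - 1) * (cutoff R x)\<^sup>2) \<partial>lborel)"
    proof (rule nn_integral_LIMSEQ)
      show "incseq (\<lambda>n x. ennreal (?f n x))"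
      proof (rule incseq_SucI, rule le_funI)
        fix n x
        have "1 / real (Suc (Suc n)) \<le> 1 / real (Suc n)" by (intro divide_left_mono) auto
        then have "\<eta> n x \<le> \<eta> (Suc n) x" unfolding \<eta>_def by linarith
        moreover have "\<eta> n x \<ge> 0" by (simp add: \<eta>_def)
        ultimately show "ennreal (?f n x) \<le> ennreal (?f (Suc n) x)"
          using hu by (intro ennreal_leI mult_left_mono power_mono) auto
      qed
      show "(\<lambda>x. ennreal (?f n x)) \<in> borel_measurable lborel" for n by measurable
      fix x
      have "(\<lambda>n. \<eta> n x) \<longlonglongrightarrow> max (cutoff R x - 0) 0"
        unfolding \<eta>_def using LIMSEQ_inverse_real_of_nat
        by (intro tendsto_max tendsto_diff tendsto_const) (simp add: inverse_eq_divide)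
      then have "(\<lambda>n. \<eta> n x) \<longlonglongrightarrow> cutoff R x" using cutoff_nonneg[of R x] by simp
      then show "(\<lambda>n. ennreal (?f n x)) \<longlonglongrightarrow> ennreal (h x * u x powr (p + 2 * q - 1) * (cutoff R x)\<^sup>2)"
        by (intro tendsto_ennrealI tendsto_intros)
    qed
    have "(\<integral>\<^sup>+x. ennreal (h x * u x powr (p + 2 * q - 1) * (cutoff R x)\<^sup>2) \<partial>lborel) \<le> ennreal (D * B)"
      using LIMSEQ_le_const2[OF lim] bound by blast
    also have "\<dots> = ennreal (D * C * R powr (- 2 * s)) * I"
      using D(1) C(1) by (subst I) (simp add: B_def ennreal_mult[symmetric] mult_ac)
    finally show "(\<integral>\<^sup>+x. ennreal (h x * u x powr (p + 2 * q - 1) * (cutoff R x)\<^sup>2) \<partial>lborel)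
      \<le> ennreal (D * C * R powr (- 2 * s)) * (\<integral>\<^sup>+x. ennreal (u x powr (2 * q) * (cutoff R x)\<^sup>2) \<partial>lborel)"
      unfolding I_def .
  qed (use finR in auto)
qed

section \<open>Moments of the solution against the weight\<close>

definition has_moment :: "real \<Rightarrow> bool" where
  "has_moment a \<longleftrightarrow> (\<integral>\<^sup>+x. ennreal (u x powr a * tail d x) \<partial>lborel) < \<infinity>"

lemma tail_integral_finite:
  fixes b :: real
  assumes "DIM('a) < b"
  shows "(\<integral>\<^sup>+x. ennreal (k * tail b (x::'a)) \<partial>lborel) < \<infinity>"
proof (cases "k \<ge> 0")
  case True
  have "(\<integral>\<^sup>+x. ennreal (k * tail b (x::'a)) \<partial>lborel) = ennreal k * (\<integral>\<^sup>+x. ennreal (tail b (x::'a)) \<partial>lborel)"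
    using True by (simp add: ennreal_mult nn_integral_cmult)
  also have "\<dots> < \<infinity>"
    using nn_integral_one_plus_norm_powr_finite[OF assms] by (simp add: ennreal_mult_less_top)
  finally show ?thesis .
next
  case False
  then have "k * tail b x \<le> 0" for x :: 'a by (simp add: mult_nonpos_nonneg)
  then show ?thesis by (simp add: ennreal_neg)
qed

text \<open>This is membership of \<open>u\<close> in L_s, the source of the first moments.\<close>

lemma has_moment_one: "has_moment 1"
proof -
  have "integrable lborel (\<lambda>x. u x * tail d x)" using u_rep by (simp add: frac_rep_def d_def)
  then have "(\<integral>\<^sup>+x. ennreal (u x * tail d x) \<partial>lborel) < \<infinity>"
    using u_pos by (simp add: integrable_iff_bounded abs_mult less_imp_le)
  then show ?thesis using u_pos by (simp add: has_moment_def less_imp_le)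
qed

text \<open>The weight is a finite measure, and t^a <= 1 + t^b for t > 0.\<close>

lemma has_moment_mono:
  assumes "0 \<le> a" "a \<le> b" "has_moment b"
  shows "has_moment a"
proof -
  have "u x powr a \<le> 1 + u x powr b" for x
  proof (cases "u x \<le> 1")
    case True
    then have "u x powr a \<le> 1" using assms u_pos[of x] by (intro powr_le1) auto
    then show ?thesis by (rule order_trans) simp
  next
    case False
    then have "u x powr a \<le> u x powr b" using assms by (intro powr_mono) auto
    then show ?thesis by simp
  qed
  then have "u x powr a * tail d x \<le> 1 * tail d x + u x powr b * tail d x" for x
    by (metis distrib_right mult_right_mono powr_ge_zero)
  then have "(\<integral>\<^sup>+x. ennreal (u x powr a * tail d x) \<partial>lborel)
      \<le> (\<integral>\<^sup>+x. ennreal (1 * tail d x) + ennreal (u x powr b * tail d x) \<partial>lborel)"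
    by (intro nn_integral_mono) (simp flip: ennreal_plus add: ennreal_leI)
  also have "\<dots> = (\<integral>\<^sup>+x. ennreal (1 * tail d (x::'a)) \<partial>lborel) + (\<integral>\<^sup>+x. ennreal (u x powr b * tail d x) \<partial>lborel)"
    by (rule nn_integral_add) auto
  also have "\<dots> < \<infinity>"
    using tail_integral_finite[OF d(1), of 1] assms(3) by (simp add: has_moment_def)
  finally show ?thesis by (simp add: has_moment_def)
qed

text \<open>\<open>cutoff_estimate\<close> at R = 1, where the squared cutoff is the tail itself;
  the factor \<open>h\<close> is removed by means of h >= m.\<close>

lemma has_moment_gain:
  assumes q: "admissible q" and "has_moment (2 * q)"
  shows "has_moment (p + 2 * q - 1)"
proof -
  have fin: "(\<integral>\<^sup>+x. ennreal (u x powr (2 * q) * tail d x) \<partial>lborel) < \<infinity>"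
    using assms(2) by (simp add: has_moment_def)
  obtain D where "\<And>R. R \<ge> 1 \<Longrightarrow>
      (\<integral>\<^sup>+x. ennreal (h x * u x powr (p + 2 * q - 1) * (cutoff R x)\<^sup>2) \<partial>lborel)
      \<le> ennreal (D * R powr (- 2 * s)) * (\<integral>\<^sup>+x. ennreal (u x powr (2 * q) * (cutoff R x)\<^sup>2) \<partial>lborel)"
    using cutoff_estimate[OF q fin] by blast
  from this[of 1] have "(\<integral>\<^sup>+x. ennreal (h x * u x powr (p + 2 * q - 1) * (cutoff 1 x)\<^sup>2) \<partial>lborel)
      \<le> ennreal (D * 1 powr (- 2 * s)) * (\<integral>\<^sup>+x. ennreal (u x powr (2 * q) * (cutoff 1 x)\<^sup>2) \<partial>lborel)"
    by simp
  also have "\<dots> < \<infinity>" using fin by (simp add: cutoff_one_square ennreal_mult_less_top)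
  finally have X: "(\<integral>\<^sup>+x. ennreal (h x * u x powr (p + 2 * q - 1) * tail d x) \<partial>lborel) < \<infinity>"
    by (simp add: cutoff_one_square)
  have "u x powr (p + 2 * q - 1) * tail d x \<le> 1 / m * (h x * u x powr (p + 2 * q - 1) * tail d x)" for x
  proof -
    have "1 * (u x powr (p + 2 * q - 1) * tail d x) \<le> h x / m * (u x powr (p + 2 * q - 1) * tail d x)"
      using h_ge_m[of x] m by (intro mult_right_mono) auto
    then show ?thesis by simp
  qed
  then have "(\<integral>\<^sup>+x. ennreal (u x powr (p + 2 * q - 1) * tail d x) \<partial>lborel)
      \<le> (\<integral>\<^sup>+x. ennreal (1 / m) * ennreal (h x * u x powr (p + 2 * q - 1) * tail d x) \<partial>lborel)"
    using m h_pos by (intro nn_integral_mono) (simp add: ennreal_mult[symmetric] ennreal_leI less_imp_le)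
  also have "\<dots> = ennreal (1 / m) * (\<integral>\<^sup>+x. ennreal (h x * u x powr (p + 2 * q - 1) * tail d x) \<partial>lborel)"
    by (rule nn_integral_cmult) measurable
  also have "\<dots> < \<infinity>" using X by (simp add: ennreal_mult_less_top)
  finally show ?thesis by (simp add: has_moment_def)
qed

section \<open>Admissible exponents and the bootstrap\<close>

lemma sqrt_discriminant: "0 < sqrt (p\<^sup>2 - p)" "sqrt (p\<^sup>2 - p) < p" "(sqrt (p\<^sup>2 - p))\<^sup>2 = p\<^sup>2 - p"
proof -
  have 1: "p\<^sup>2 - p > 0" using p by (simp add: power2_eq_square)
  then show "0 < sqrt (p\<^sup>2 - p)" "(sqrt (p\<^sup>2 - p))\<^sup>2 = p\<^sup>2 - p" by auto
  show "sqrt (p\<^sup>2 - p) < p" using p by (intro real_less_lsqrt) auto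
qed

text \<open>Completing the square turns q^2 < p (2q - 1) into (q - p)^2 < p^2 - p, and positivity of
  p (2q - 1) then also yields q > 1/2.\<close>

lemma admissible_if_near:
  assumes "\<bar>q - p\<bar> < sqrt (p\<^sup>2 - p)"
  shows "admissible q"
proof -
  have "\<bar>q - p\<bar>\<^sup>2 < (sqrt (p\<^sup>2 - p))\<^sup>2" using assms by (intro power_strict_mono) auto
  then have "(q - p)\<^sup>2 < p\<^sup>2 - p" using sqrt_discriminant(3) by simp
  then have *: "q\<^sup>2 < p * (2 * q - 1)" by (simp add: power2_eq_square algebra_simps)
  then have "p * (2 * q - 1) > 0" using zero_le_power2[of q] by linarith
  then have "q > 1 / 2" using p by (simp add: zero_less_mult_iff)
  with * show ?thesis by (simp add: admissible_def)
qed

text \<open>Bootstrap by \<open>has_moment_gain\<close>: with S the square root,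
  \<open>a / 2\<close> is admissible for 2 (p - S) < a < 2 (p + S), and each gain raises the
  exponent by p - 1. The first gain starts from an exponent below 1, where L_s supplies the
  moment.\<close>

lemma has_moment_if_exponent_large:
  assumes p4: "p > 4 / 3" and a: "0 < a" "a < 2 * (p + sqrt (p\<^sup>2 - p))"
  shows "has_moment a"
proof -
  define S where "S = sqrt (p\<^sup>2 - p)"
  have S: "0 < S" "S < p" using sqrt_discriminant by (auto simp: S_def)
  have "p / 2 < S"
  proof -
    have "0 < p * (p * (3 / 4) - 1)" using p4 by (intro mult_pos_pos) auto
    then have "(p / 2)\<^sup>2 < p\<^sup>2 - p" by (simp add: power2_eq_square algebra_simps)
    then show ?thesis unfolding S_def by (rule real_less_rsqrt)
  qed
  \<comment> \<open>This is where \<open>p > 4/3\<close> enters: the exponents \<open>a < 1\<close> with \<open>a + p - 1 > 2 (p - S)\<close> are not empty.\<close>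
  define a' where "a' = max (1 / 2) ((1 + (2 * (p - S) - p + 1)) / 2)"
  define a0 where "a0 = p + 2 * (a' / 2) - 1"
  have a': "0 < a'" "a' < 1" "2 * (p - S) - p + 1 < a'"
    using \<open>p / 2 < S\<close> by (auto simp: a'_def max_def)
  have a0: "2 * (p - S) < a0" "a0 < p" using a' by (auto simp: a0_def)
  have a0_moment: "has_moment a0"
    unfolding a0_def
  proof (rule has_moment_gain)
    show "admissible (a' / 2)" using a' by (simp add: admissible_def)
    show "has_moment (2 * (a' / 2))" using a' by (auto intro: has_moment_mono[OF _ _ has_moment_one])
  qed
  have step: "has_moment a" if "2 * (p - S) < a" "a < 2 * (p + S)" "a \<le> a0 + real n * (p - 1)" for n a
    using that
  proof (induction n arbitrary: a)
    case 0
    then show ?case using S by (intro has_moment_mono[OF _ _ a0_moment]) auto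
  next
    case (Suc n)
    \<comment> \<open>The exponent before the last gain. The maximum with \<open>a0\<close> keeps it
      above 2 (p - S); an overshoot beyond \<open>a\<close> is removed by
      \<open>has_moment_mono\<close>.\<close>
    define b where "b = max (a - (p - 1)) a0"
    have "a - (p - 1) \<le> a0 + real n * (p - 1)" using Suc.prems(3) by (simp add: algebra_simps)
    moreover have "a0 \<le> a0 + real n * (p - 1)" using p by simp
    ultimately have b: "2 * (p - S) < b" "b < 2 * (p + S)" "b \<le> a0 + real n * (p - 1)" "a \<le> p + 2 * (b / 2) - 1"
      using Suc.prems a0 S p by (auto simp: b_def)
    have "has_moment (p + 2 * (b / 2) - 1)"
    proof (rule has_moment_gain)
      show "admissible (b / 2)"
        using b by (intro admissible_if_near) (auto simp: S_def[symmetric] abs_less_iff)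
      show "has_moment (2 * (b / 2))" using Suc.IH[of b] b by simp
    qed
    then show ?case using b(4) Suc.prems S by (intro has_moment_mono[of a]) auto
  qed
  \<comment> \<open>Exponents at or below 2 (p - S) are reached from a larger one: 2p - S lies
    strictly between 2 (p - S) and 2 (p + S).\<close>
  define a1 where "a1 = max a (p - S + p)"
  have a1: "2 * (p - S) < a1" "a1 < 2 * (p + S)" "a \<le> a1"
    using a S by (auto simp: a1_def S_def[symmetric])
  obtain n where "(a1 - a0) / (p - 1) < real n" using reals_Archimedean2 by blast
  then have "a1 \<le> a0 + real n * (p - 1)" using p by (simp add: field_simps)
  with step a1 have "has_moment a1" by blast
  then show ?thesis using a a1 by (intro has_moment_mono[of a a1]) auto
qed

lemma has_moment_if_bounded:
  assumes "bounded (range u)" "a \<ge> 0"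
  shows "has_moment a"
proof -
  obtain U where U: "\<And>x. \<bar>u x\<bar> \<le> U" using assms(1) by (auto simp: bounded_iff)
  have "u x powr a * tail d x \<le> U powr a * tail d x" for x
    using U[of x] u_pos[of x] assms(2) by (intro mult_right_mono powr_mono2) auto
  then have "(\<integral>\<^sup>+x. ennreal (u x powr a * tail d x) \<partial>lborel) \<le> (\<integral>\<^sup>+x. ennreal (U powr a * tail d (x::'a)) \<partial>lborel)"
    by (intro nn_integral_mono ennreal_leI)
  also have "\<dots> < \<infinity>" by (rule tail_integral_finite[OF d(1)])
  finally show ?thesis by (simp add: has_moment_def)
qed

text \<open>Stated for moments of any origin, so that it applies both to those of the bootstrap and
  to those of a bounded solution.\<close>

lemma subcritical_contradiction:
  assumes mom: "\<And>a. \<lbrakk>0 < a; a < 2 * (p + sqrt (p\<^sup>2 - p))\<rbrakk> \<Longrightarrow> has_moment a"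
    and sub: "real DIM('a) < 2 * s + 2 * (2 * s + l) / (p - 1) * (p + sqrt (p\<^sup>2 - p))"
  shows False
proof -
  define S where "S = sqrt (p\<^sup>2 - p)"
  have S: "0 < S" "S < p" using sqrt_discriminant by (auto simp: S_def)
  \<comment> \<open>The dimension condition reads z < p + S, with z the ratio of DIM('a) - 2 s to
    \<open>k\<close>, so \<open>q\<close> can be taken admissible, above \<open>p\<close> and above
    \<open>z\<close>.\<close>
  define k where "k = 2 * (2 * s + l) / (p - 1)"
  have k: "k > 0" using p s l by (simp add: k_def)
  define z where "z = (DIM('a) - 2 * s) / k"
  define q where "q = (max p z + (p + S)) / 2"
  have "DIM('a) - 2 * s < k * (p + S)" using sub unfolding k_def S_def by linarith
  then have "z < p + S" using k by (simp add: z_def pos_divide_less_eq mult.commute)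
  then have q: "p < q" "q < p + S" "z < q"
    using S by (auto simp: q_def max_def)
  have q_adm: "admissible q" using q by (intro admissible_if_near) (auto simp: S_def[symmetric])
  have "has_moment (2 * q)" using q p by (intro mom) (auto simp: S_def)
  then have fin: "(\<integral>\<^sup>+x. ennreal (u x powr (2 * q) * tail d x) \<partial>lborel) < \<infinity>"
    by (simp add: has_moment_def)
  \<comment> \<open>u^(2q) is the power \<open>g\<close> of u^(p-1); where u^(p-1) is at most a
    multiple of 1 / h, it therefore decays like (1 + |x|)^(-l g).\<close>
  define g where "g = 2 * q / (p - 1)"
  have g: "g > 0" using q p by (simp add: g_def)
  define ub where "ub = min (2 * s * (1 + g)) d"
  \<comment> \<open>The midpoint between the constraints: \<theta> > DIM('a) - l g makes the tail of
    exponent l g + \<theta> integrable, \<theta> < 2 s (1 + g) makes the final power of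
    \<open>R\<close> negative, and 0 <= \<theta> <= d is what \<open>cutoff_square_le\<close> asks
    for.\<close>
  define \<theta> where "\<theta> = (max 0 (DIM('a) - l * g) + ub) / 2"
  have "DIM('a) - l * g < 2 * s * (1 + g)"
  proof -
    have "DIM('a) - 2 * s < q * k" using q(3) k by (simp add: z_def pos_divide_less_eq)
    also have "q * k = (2 * s + l) * g" by (simp add: k_def g_def)
    finally show ?thesis by (simp add: algebra_simps)
  qed
  moreover have "DIM('a) - l * g < d" using mult_pos_pos[OF l g] s unfolding d_def by linarith
  moreover have "0 < 2 * s * (1 + g)" using s g by simp
  ultimately have "max 0 (DIM('a) - l * g) < ub" using d(3) by (simp add: ub_def)
  then have \<theta>: "0 \<le> \<theta>" "DIM('a) - l * g < \<theta>" "\<theta> < 2 * s * (1 + g)" "\<theta> \<le> d"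
    by (auto simp: \<theta>_def ub_def max_def min_def field_simps split: if_splits)
  obtain D where D: "D \<ge> 0" "\<And>R. R \<ge> 1 \<Longrightarrow>
      (\<integral>\<^sup>+x. ennreal (h x * u x powr (p + 2 * q - 1) * (cutoff R x)\<^sup>2) \<partial>lborel)
      \<le> ennreal (D * R powr (- 2 * s)) * (\<integral>\<^sup>+x. ennreal (u x powr (2 * q) * (cutoff R x)\<^sup>2) \<partial>lborel)"
    "\<And>R. R \<ge> 1 \<Longrightarrow> (\<integral>\<^sup>+x. ennreal (u x powr (2 * q) * (cutoff R x)\<^sup>2) \<partial>lborel) < \<infinity>"
    using cutoff_estimate[OF q_adm fin] by blast
  define X where "X R = (\<integral>\<^sup>+x. ennreal (h x * u x powr (p + 2 * q - 1) * (cutoff R x)\<^sup>2) \<partial>lborel)" for R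
  define T where "T = (\<integral>\<^sup>+x. ennreal (tail (l * g + \<theta>) (x::'a)) \<partial>lborel)"
  have T: "T < \<infinity>" using nn_integral_one_plus_norm_powr_finite[of "l * g + \<theta>", where 'a='a] \<theta>(2) by (simp add: T_def)
  then have T': "T = ennreal (enn2real T)" by simp
  \<comment> \<open>Either the left-hand side is at most \<open>h u\<^sup>P / 2\<close>, or \<open>u\<^sup>p\<^sup>-\<^sup>1 < 2 M / h\<close>.\<close>
  have absorb: "M * u x powr (2 * q) \<le> 1 / 2 * (h x * u x powr (p + 2 * q - 1)) + M * (2 * M / m) powr g * tail (l * g) x"
    if M: "M \<ge> 0" for M x
  proof (cases "2 * M \<le> h x * u x powr (p - 1)")
    case True
    have "2 * M * u x powr (2 * q) \<le> h x * u x powr (p - 1) * u x powr (2 * q)"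
      using True by (intro mult_right_mono) auto
    also have "\<dots> = h x * u x powr (p + 2 * q - 1)"
      unfolding mult.assoc powr_add[symmetric] by (intro arg_cong2[where f="(*)"] refl arg_cong2[where f="(powr)"]) simp
    finally have "M * u x powr (2 * q) \<le> 1 / 2 * (h x * u x powr (p + 2 * q - 1))" by simp
    moreover have "0 \<le> M * (2 * M / m) powr g * tail (l * g) x" using M by simp
    ultimately show ?thesis by linarith
  next
    case False
    have "u x powr (p - 1) \<le> 2 * M / h x" using False h_pos[of x] by (simp add: field_simps)
    also have "\<dots> \<le> 2 * M / (m * (1 + norm x) powr l)"
    proof (rule divide_left_mono)
      have "1 + norm x > 0" by (simp add: add_pos_nonneg)
      then show "0 < h x * (m * (1 + norm x) powr l)" using m h_pos[of x] by simp
    qed (use M h_ge in auto)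
    also have "\<dots> = 2 * M / m * tail l x" by (simp add: powr_minus field_simps)
    finally have "(u x powr (p - 1)) powr g \<le> (2 * M / m * tail l x) powr g"
      using g by (intro powr_mono2) auto
    also have "\<dots> = (2 * M / m) powr g * tail (l * g) x"
      using M m by (subst powr_mult) (auto simp: powr_powr)
    also have "(u x powr (p - 1)) powr g = u x powr (2 * q)" using p by (simp add: powr_powr g_def)
    finally have "M * u x powr (2 * q) \<le> M * ((2 * M / m) powr g * tail (l * g) x)"
      using M by (intro mult_left_mono) auto
    moreover have "0 \<le> 1 / 2 * (h x * u x powr (p + 2 * q - 1))" using h_pos[of x] by simp
    ultimately show ?thesis by (simp add: mult.assoc)
  qed
  define A where "A = 2 * D * (2 * D / m) powr g * enn2real T"
  have X_le: "X R \<le> ennreal (A * R powr (\<theta> - 2 * s * (1 + g)))" if R: "R \<ge> 1" for R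
  proof -
    define M where "M = D * R powr (- 2 * s)"
    have M: "M \<ge> 0" using D(1) by (simp add: M_def)
    define Y where "Y = M * (2 * M / m) powr g * R powr \<theta>"
    have Y: "Y \<ge> 0" using M by (simp add: Y_def)
    \<comment> \<open>Finiteness is needed before half of \<open>X R\<close> can be moved to the
      left.\<close>
    have X_fin: "X R < \<infinity>"
    proof -
      have "X R \<le> ennreal M * (\<integral>\<^sup>+x. ennreal (u x powr (2 * q) * (cutoff R x)\<^sup>2) \<partial>lborel)"
        unfolding X_def M_def by (rule D(2)[OF R])
      also have "\<dots> < \<infinity>" using D(3)[OF R] by (simp add: ennreal_mult_less_top)
      finally show ?thesis .
    qed
    then have X': "X R = ennreal (enn2real (X R))" by simp
    have pw: "M * (u x powr (2 * q) * (cutoff R x)\<^sup>2)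
        \<le> 1 / 2 * (h x * u x powr (p + 2 * q - 1) * (cutoff R x)\<^sup>2) + Y * tail (l * g + \<theta>) x" for x
    proof -
      have "M * u x powr (2 * q) * (cutoff R x)\<^sup>2
          \<le> (1 / 2 * (h x * u x powr (p + 2 * q - 1)) + M * (2 * M / m) powr g * tail (l * g) x) * (cutoff R x)\<^sup>2"
        by (intro mult_right_mono absorb M) auto
      also have "\<dots> = 1 / 2 * (h x * u x powr (p + 2 * q - 1) * (cutoff R x)\<^sup>2) + M * (2 * M / m) powr g * tail (l * g) x * (cutoff R x)\<^sup>2"
        by (simp add: distrib_right)
      also have "M * (2 * M / m) powr g * tail (l * g) x * (cutoff R x)\<^sup>2
          \<le> M * (2 * M / m) powr g * tail (l * g) x * (R powr \<theta> * tail \<theta> x)"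
        using M by (intro mult_left_mono cutoff_square_le R \<theta>) auto
      also have "\<dots> = Y * (tail (l * g) x * tail \<theta> x)" by (simp add: Y_def)
      also have "tail (l * g) x * tail \<theta> x = tail (l * g + \<theta>) x" by (simp add: powr_add[symmetric])
      finally show ?thesis by (simp add: mult.assoc)
    qed
    have distrib: "ennreal (1 / 2 * z + Y * w) = ennreal (1 / 2) * ennreal z + ennreal Y * ennreal w"
      if "z \<ge> 0" "w \<ge> 0" for z w
    proof -
      have "ennreal (1 / 2 * z + Y * w) = ennreal (1 / 2 * z) + ennreal (Y * w)"
        using that Y by (intro ennreal_plus) auto
      also have "\<dots> = ennreal (1 / 2) * ennreal z + ennreal Y * ennreal w"
        using that Y by (intro arg_cong2[where f = "(+)"] ennreal_mult) auto
      finally show ?thesis .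
    qed
    have "X R \<le> ennreal M * (\<integral>\<^sup>+x. ennreal (u x powr (2 * q) * (cutoff R x)\<^sup>2) \<partial>lborel)"
      unfolding X_def M_def by (rule D(2)[OF R])
    also have "\<dots> = (\<integral>\<^sup>+x. ennreal (M * (u x powr (2 * q) * (cutoff R x)\<^sup>2)) \<partial>lborel)"
      using M by (subst nn_integral_cmult[symmetric]) (auto simp: ennreal_mult)
    also have "\<dots> \<le> (\<integral>\<^sup>+x. ennreal (1 / 2) * ennreal (h x * u x powr (p + 2 * q - 1) * (cutoff R x)\<^sup>2)
        + ennreal Y * ennreal (tail (l * g + \<theta>) x) \<partial>lborel)"
    proof (rule nn_integral_mono)
      fix x
      have "h x * u x powr (p + 2 * q - 1) * (cutoff R x)\<^sup>2 \<ge> 0" using h_pos[of x] by simp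
      then show "ennreal (M * (u x powr (2 * q) * (cutoff R x)\<^sup>2))
          \<le> ennreal (1 / 2) * ennreal (h x * u x powr (p + 2 * q - 1) * (cutoff R x)\<^sup>2)
            + ennreal Y * ennreal (tail (l * g + \<theta>) x)"
        using ennreal_leI[OF pw[of x]] by (simp only: distrib[OF _ powr_ge_zero])
    qed
    also have "\<dots> = ennreal (1 / 2) * X R + ennreal Y * T"
      unfolding X_def T_def by (subst nn_integral_add) (auto simp: nn_integral_cmult)
    finally have "ennreal (enn2real (X R)) \<le> ennreal (1 / 2) * ennreal (enn2real (X R)) + ennreal Y * ennreal (enn2real T)"
      by (simp only: X'[symmetric] T'[symmetric])
    then have "ennreal (enn2real (X R)) \<le> ennreal (1 / 2 * enn2real (X R) + Y * enn2real T)"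
      by (simp only: distrib enn2real_nonneg)
    then have "enn2real (X R) \<le> 1 / 2 * enn2real (X R) + Y * enn2real T"
      using Y by (subst (asm) ennreal_le_iff) auto
    then have "enn2real (X R) \<le> 2 * (Y * enn2real T)" by simp
    \<comment> \<open>\<open>M\<close> contributes R^(-2s) once directly and once raised to the
      power \<open>g\<close>; the cutoff contributes R^\<theta>.\<close>
    also have "Y = D * (2 * D / m) powr g * R powr (\<theta> - 2 * s * (1 + g))"
    proof -
      have "(2 * M / m) powr g = (2 * D / m * R powr (- 2 * s)) powr g"
        by (simp add: M_def mult.assoc)
      also have "\<dots> = (2 * D / m) powr g * R powr (- 2 * s * g)"
        using D(1) m by (subst powr_mult) (auto simp: powr_powr)
      finally have "Y = D * (2 * D / m) powr g * (R powr (- 2 * s) * R powr (- 2 * s * g) * R powr \<theta>)"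
        by (simp add: Y_def M_def)
      also have "R powr (- 2 * s) * R powr (- 2 * s * g) * R powr \<theta> = R powr (\<theta> - 2 * s * (1 + g))"
        unfolding powr_add[symmetric] by (rule arg_cong) (simp add: algebra_simps)
      finally show ?thesis .
    qed
    finally have "enn2real (X R) \<le> A * R powr (\<theta> - 2 * s * (1 + g))" by (simp add: A_def mult_ac)
    then show ?thesis by (subst X') (rule ennreal_leI)
  qed
  have X_mono: "X 1 \<le> X R" if "R \<ge> 1" for R
    unfolding X_def using h_pos cutoff_one_le[OF that]
    by (intro nn_integral_mono ennreal_leI mult_left_mono) (auto simp: less_imp_le)
  \<comment> \<open>\<open>X 1\<close> is at most \<open>X R\<close> for every R >= 1, and the bound
    on \<open>X R\<close> tends to 0. The integrand of \<open>X 1\<close> is positive everywhere,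
    which is the contradiction.\<close>
  have "X 1 = 0"
  proof -
    have "((\<lambda>R. A * R powr (\<theta> - 2 * s * (1 + g))) \<longlongrightarrow> A * 0) at_top"
      using \<theta>(3) by (intro tendsto_mult tendsto_const tendsto_neg_powr filterlim_ident) auto
    then have lim: "((\<lambda>R. ennreal (A * R powr (\<theta> - 2 * s * (1 + g)))) \<longlongrightarrow> ennreal 0) at_top"
      by (intro tendsto_ennrealI) simp
    have "eventually (\<lambda>R. X 1 \<le> ennreal (A * R powr (\<theta> - 2 * s * (1 + g)))) at_top"
      using eventually_ge_at_top[of "1::real"]
      by eventually_elim (use X_mono X_le in \<open>blast intro: order_trans\<close>)
    then have "X 1 \<le> ennreal 0"
      by (intro tendsto_lowerbound[OF lim]) auto
    then show ?thesis by simp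
  qed
  then have "AE x in lborel. ennreal (h x * u x powr (p + 2 * q - 1) * (cutoff 1 x)\<^sup>2) = 0"
    unfolding X_def by (subst (asm) nn_integral_0_iff_AE) auto
  moreover have "ennreal (h x * u x powr (p + 2 * q - 1) * (cutoff 1 x)\<^sup>2) \<noteq> 0" for x
  proof -
    have "h x * u x powr (p + 2 * q - 1) * (cutoff 1 x)\<^sup>2 > 0"
      using h_pos[of x] u_pos[of x] bump_pos[of d x] by (simp add: cutoff_def)
    then show ?thesis by (simp add: ennreal_eq_0_iff not_le)
  qed
  ultimately have "AE x in (lborel :: 'a measure). False" by simp
  then have "emeasure (lborel :: 'a measure) UNIV = 0" by (simp add: AE_iff_null null_sets_def)
  then show False by simp
qed

end

text \<open>The linearised system is symmetric in its two unknowns, since both components of the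
  solution are \<open>u\<close>. Adding its equations therefore gives a scalar equation for the sum,
  and Picone's inequality needs only this one positive function.\<close>

lemma stable_pair_if_stable_solution:
  fixes h u :: "real ^ 'n \<Rightarrow> real"
  assumes s: "0 < s" "s < 1" and l: "l > 0" and p: "p > 1" and m: "m > 0"
    and h: "continuous_on UNIV h" "\<And>x. m * (1 + norm x) powr l \<le> h x"
    and st: "is_stable_solution s p h u"
  obtains \<zeta> where "stable_pair s p (frac_const CARD('n) s) l m h u \<zeta>"
proof -
  have sol: "u \<in> frac_domain s" "\<And>x. u x > 0" "\<And>x. has_frac_laplacian s u x (h x * u x powr p)"
    using st by (auto simp: is_stable_solution_def is_solution_def)
  obtain \<zeta>1 \<zeta>2 where z: "\<zeta>1 \<in> frac_domain s" "\<zeta>2 \<in> frac_domain s" "\<And>x. \<zeta>1 x > 0" "\<And>x. \<zeta>2 x > 0"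
    "\<And>x. has_frac_laplacian s \<zeta>1 x (p * h x * u x powr (p - 1) * \<zeta>2 x)"
    "\<And>x. has_frac_laplacian s \<zeta>2 x (p * h x * u x powr (p - 1) * \<zeta>1 x)"
    using st by (auto simp: is_stable_solution_def)
  let ?c = "frac_const CARD('n) s" and ?d = "DIM(real ^ 'n) + 2 * s"
  have d: "DIM(real ^ 'n) < ?d" using s by simp
  note rep = frac_rep_if_has_frac_laplacian[OF s]
  have "frac_rep ?d (\<lambda>x. \<zeta>1 x + \<zeta>2 x)
      (\<lambda>x. p * h x * u x powr (p - 1) * \<zeta>2 x / ?c + p * h x * u x powr (p - 1) * \<zeta>1 x / ?c)"
    using rep[OF z(1,5)] rep[OF z(2,6)] by (intro frac_rep_add[OF d]) auto
  also have "(\<lambda>x. p * h x * u x powr (p - 1) * \<zeta>2 x / ?c + p * h x * u x powr (p - 1) * \<zeta>1 x / ?c)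
      = (\<lambda>x. p * h x * u x powr (p - 1) * (\<zeta>1 x + \<zeta>2 x) / ?c)"
    by (simp add: fun_eq_iff distrib_left add_divide_distrib add.commute)
  finally have "stable_pair s p ?c l m h u (\<lambda>x. \<zeta>1 x + \<zeta>2 x)"
    using s p l m h sol z(3,4) frac_const_pos[OF s, of "CARD('n)"] rep[OF sol(1,3)]
    by unfold_locales (auto simp: add_pos_pos)
  then show thesis by (rule that)
qed

text \<open>From (p - 1)^2 < p^2 - p the quotient of p + S by p - 1, with S the square root, exceeds
  2. With 2 in its place the bound on the dimension becomes 2 s + 4 (2 s + l) = 10 s + 4 l.\<close>

lemma subcritical_if_dimension_le:
  assumes "0 < s" "l > 0" "p > 1" "real N \<le> 10 * s + 4 * l"
  shows "subcritical N s l p"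
proof -
  have "(p - 1)\<^sup>2 < p\<^sup>2 - p" using assms by (simp add: power2_eq_square algebra_simps)
  then have "p - 1 < sqrt (p\<^sup>2 - p)" by (rule real_less_rsqrt)
  then have "2 < (p + sqrt (p\<^sup>2 - p)) / (p - 1)" using assms(3) by (simp add: pos_less_divide_eq)
  then have "2 * (2 * s + l) * 2 < 2 * (2 * s + l) * ((p + sqrt (p\<^sup>2 - p)) / (p - 1))"
    using assms(1,2) by (intro mult_strict_left_mono) auto
  then show ?thesis using assms(4) unfolding subcritical_def by simp
qed

theorem corollary1p3:
  fixes s l :: real and h :: "real ^ 'n \<Rightarrow> real"
  assumes "0 < s" and "s < 1" and "l > 0"
    and "continuous_on UNIV h"
    and "\<forall>x. h x > 0"
    and "Liminf at_infinity (\<lambda>x. ereal (h x / norm x powr l)) > 0"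
  shows
    "(\<forall>p. p > 4 / 3 \<and> subcritical CARD('n) s l p \<longrightarrow>
        \<not> (\<exists>u. is_stable_solution s p h u)) \<and>
     (real CARD('n) \<le> 10 * s + 4 * l \<longrightarrow>
        (\<forall>p. p > 4 / 3 \<longrightarrow> \<not> (\<exists>u. is_stable_solution s p h u))) \<and>
     (\<forall>p. 1 < p \<and> p \<le> 4 / 3 \<and> subcritical CARD('n) s l p \<longrightarrow>
        \<not> (\<exists>u. is_stable_solution s p h u \<and> bounded (range u))) \<and>
     (real CARD('n) \<le> 10 * s + 4 * l \<longrightarrow>
        (\<forall>p. p > 1 \<longrightarrow> \<not> (\<exists>u. is_stable_solution s p h u \<and> bounded (range u))))"
proof -
  obtain m where m: "m > 0" "\<And>x. m * (1 + norm x) powr l \<le> h x"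
    using lower_bound_if_Liminf_pos[OF assms(3,4) _ assms(6)] assms(5) by blast
  have unbounded_case: False
    if p4: "p > 4 / 3" and sub: "subcritical CARD('n) s l p" and st: "is_stable_solution s p h u" for p u
  proof -
    have p: "p > 1" using p4 by simp
    obtain \<zeta> where "stable_pair s p (frac_const CARD('n) s) l m h u \<zeta>"
      using stable_pair_if_stable_solution[OF assms(1-3) p m(1) assms(4) m(2) st] by blast
    then interpret stable_pair s p "frac_const CARD('n) s" l m h u \<zeta> .
    show False
      using subcritical_contradiction[OF has_moment_if_exponent_large[OF p4]] sub
      by (simp add: subcritical_def)
  qed
  \<comment> \<open>A bounded solution has all moments for every p > 1, so this serves both the
    range p <= 4/3 and the last claim.\<close>
  have bounded_case: False
    if p: "p > 1" and sub: "subcritical CARD('n) s l p" and st: "is_stable_solution s p h u"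
      and bdd: "bounded (range u)" for p u
  proof -
    obtain \<zeta> where "stable_pair s p (frac_const CARD('n) s) l m h u \<zeta>"
      using stable_pair_if_stable_solution[OF assms(1-3) p m(1) assms(4) m(2) st] by blast
    then interpret stable_pair s p "frac_const CARD('n) s" l m h u \<zeta> .
    show False
      using subcritical_contradiction[OF has_moment_if_bounded[OF bdd]] sub
      by (simp add: subcritical_def)
  qed
  have dim: "subcritical CARD('n) s l p" if "real CARD('n) \<le> 10 * s + 4 * l" "p > 1" for p
    using subcritical_if_dimension_le[OF assms(1,3) that(2,1)] .
  show ?thesis
  proof (intro conjI allI impI notI; elim exE conjE)
    fix p u assume "p > 4 / 3" "real CARD('n) \<le> 10 * s + 4 * l" "is_stable_solution s p h u"
    then show False using unbounded_case[of p u] dim[of p] by simp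
  next
    fix p u assume "p > 1" "real CARD('n) \<le> 10 * s + 4 * l" "is_stable_solution s p h u" "bounded (range u)"
    then show False using bounded_case[of p u] dim[of p] by simp
  qed (auto intro: unbounded_case bounded_case)
qed

end
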